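(* Let $a\ge 0$, $p>1$ and $N\ge 5$. If $$1<p<\frac{N+4+2a}{N-4},$$ then the equation $$\Delta^2 u=|x|^{a}u^{p}\quad\text{in }\mathbb{R}^N$$ has no positive solution with finite Morse index.
   Context: Solutions are classical ($C^4$). For a positive solution $u$ of $\Delta^2u=|x|^a u^p$ in $\mathbb{R}^N$ and $\phi\in C^4_c(\mathbb{R}^N)$ set $$I_{uu}(\phi):=\int_{\mathbb{R}^N}|\Delta\phi|^2\,dx-p\int_{\mathbb{R}^N}|x|^a u^{p-1}\phi^2\,dx .$$ The solution $u$ is called stable if $I_{uu}(\phi)\ge 0$ for all $\phi\in C_c^4(\mathbb{R}^N)$ (Morse index $0$). It has Morse index equal to $m\ge1$ if $m$ is the maximal dimension of a linear subspace $X_m\subset C_c^4(\mathbb{R}^N)$ such that $I_{uu}(\phi)<0$ for all $\phi\in X_m\setminus\{0\}$. It has finite Morse index if it is stable or has Morse index equal to some integer $m\ge 1$. *)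

theory Defs
  imports "HOL-Analysis.Analysis" "HOL-Library.Function_Algebras"
begin

text \<open>
  The pointwise real vector space structure on functions. With it the library notions
  \<^const>\<open>subspace\<close>, \<^const>\<open>span\<close> and \<open>independent\<close> apply to spaces of functions.
\<close>

instantiation "fun" :: (type, real_vector) real_vector
begin

definition scaleR_fun :: "real \<Rightarrow> ('a \<Rightarrow> 'b) \<Rightarrow> 'a \<Rightarrow> 'b"
  where "scaleR_fun c f = (\<lambda>x. c *\<^sub>R f x)"

instance
  by standard
    (simp_all add: scaleR_fun_def fun_eq_iff scaleR_add_right scaleR_add_left)

end

text \<open>
  The library \<^const>\<open>dim\<close> is 0 for spaces without a finite basis; the following relation
  holds only for finite-dimensional \<open>X\<close>.
\<close>

definition has_finite_dim :: "'v::real_vector set \<Rightarrow> nat \<Rightarrow> bool"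
  where "has_finite_dim X m \<longleftrightarrow>
    (\<exists>B. finite B \<and> independent B \<and> span B = X \<and> card B = m)"

definition partial_deriv :: "'a::euclidean_space \<Rightarrow> ('a \<Rightarrow> real) \<Rightarrow> 'a \<Rightarrow> real"
  where "partial_deriv i f x = frechet_derivative f (at x) i"

primrec C_class :: "nat \<Rightarrow> ('a::euclidean_space \<Rightarrow> real) \<Rightarrow> bool"
  where
    "C_class 0 f \<longleftrightarrow> continuous_on UNIV f"
  | "C_class (Suc k) f \<longleftrightarrow>
      f differentiable_on UNIV \<and> (\<forall>i\<in>Basis. C_class k (partial_deriv i f))"

definition C4_compact_support :: "('a::euclidean_space \<Rightarrow> real) set"
  where "C4_compact_support = {\<phi>. C_class 4 \<phi> \<and> compact (closure {x. \<phi> x \<noteq> 0})}"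

definition laplacian :: "('a::euclidean_space \<Rightarrow> real) \<Rightarrow> 'a \<Rightarrow> real"
  where "laplacian f x = (\<Sum>i\<in>Basis. partial_deriv i (partial_deriv i f) x)"

text \<open>
  The weight \<open>|x|\<^sup>a\<close>. In the library \<open>0 powr 0 = 0\<close>, whereas for \<open>a = 0\<close> the weight has to
  be identically 1, also at the origin.
\<close>

definition weight :: "real \<Rightarrow> 'a::euclidean_space \<Rightarrow> real"
  where "weight a x = (if a = 0 then 1 else norm x powr a)"

definition positive_solution :: "real \<Rightarrow> real \<Rightarrow> ('a::euclidean_space \<Rightarrow> real) \<Rightarrow> bool"
  where "positive_solution a p u \<longleftrightarrow>
    C_class 4 u \<and> (\<forall>x. u x > 0) \<and>
    (\<forall>x. laplacian (laplacian u) x = weight a x * u x powr p)"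

definition I_uu ::
    "real \<Rightarrow> real \<Rightarrow> ('a::euclidean_space \<Rightarrow> real) \<Rightarrow> ('a \<Rightarrow> real) \<Rightarrow> real"
  where "I_uu a p u \<phi> =
    (LINT x|lborel. \<bar>laplacian \<phi> x\<bar>\<^sup>2) -
    p * (LINT x|lborel. weight a x * u x powr (p - 1) * (\<phi> x)\<^sup>2)"

definition stable :: "real \<Rightarrow> real \<Rightarrow> ('a::euclidean_space \<Rightarrow> real) \<Rightarrow> bool"
  where "stable a p u \<longleftrightarrow> (\<forall>\<phi>\<in>C4_compact_support. I_uu a p u \<phi> \<ge> 0)"

definition negative_subspace ::
    "real \<Rightarrow> real \<Rightarrow> ('a::euclidean_space \<Rightarrow> real) \<Rightarrow> ('a \<Rightarrow> real) set \<Rightarrow> bool"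
  where "negative_subspace a p u X \<longleftrightarrow>
    subspace X \<and> X \<subseteq> C4_compact_support \<and> (\<forall>\<phi>\<in>X - {0}. I_uu a p u \<phi> < 0)"

text \<open>
  Maximality of \<open>m\<close> includes that no infinite-dimensional subspace is negative.
\<close>

definition has_morse_index ::
    "real \<Rightarrow> real \<Rightarrow> ('a::euclidean_space \<Rightarrow> real) \<Rightarrow> nat \<Rightarrow> bool"
  where "has_morse_index a p u m \<longleftrightarrow>
    (\<exists>X. negative_subspace a p u X \<and> has_finite_dim X m) \<and>
    (\<forall>X. negative_subspace a p u X \<longrightarrow> (\<exists>k\<le>m. has_finite_dim X k))"

definition finite_morse_index :: "real \<Rightarrow> real \<Rightarrow> ('a::euclidean_space \<Rightarrow> real) \<Rightarrow> bool"
  where "finite_morse_index a p u \<longleftrightarrow>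
    stable a p u \<or> (\<exists>m\<ge>1. has_morse_index a p u m)"

end

theory Submission
  imports Defs
begin

text \<open>
  Idea of the proof. A solution with finite Morse index is stable outside some ball: beyond the supports
  of a maximal negative subspace, a test function with negative energy would enlarge that subspace
  (\<open>finite_morse_index_imp_stable_outside\<close>). The equation is invariant under the rescaling
  \<open>u\<^sub>R(x) = R^\<gamma> u(R x)\<close> with \<open>\<gamma> = (4 + a) / (p - 1)\<close>, so for large \<open>R\<close> the functions \<open>u\<^sub>R\<close> are solutions
  that are stable outside the unit ball.

  The core is a bound that is uniform over all such solutions \<open>v\<close>: for a cutoff function \<open>\<beta>\<close> around
  the origin, the integral of \<open>|x|^a v^(p+1) \<beta>\<close> is at most a constant that does not depend on \<open>v\<close>
  (\<open>pohozaev_bound\<close>). For \<open>v = u\<^sub>R\<close> this integral is at least \<open>R^s\<close> times its value for \<open>u\<close>, where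
  \<open>s = 4 + (8 + 2 a) / (p - 1) - N\<close> is positive exactly when \<open>p\<close> is subcritical, and \<open>R \<rightarrow> \<infinity>\<close> gives
  a contradiction. Because the estimate is made at a fixed scale, no cutoff function depends on \<open>R\<close>.

  The uniform bound has two ingredients.

  On an annulus, stability is tested with \<open>u \<psi>\<close> and the equation with \<open>u \<psi>\<^sup>2\<close>. The functions
  \<open>(\<Delta>(u \<psi>))\<^sup>2\<close> and \<open>\<Delta>u \<Delta>(u \<psi>\<^sup>2)\<close> differ only by terms that contain derivatives of \<open>\<psi>\<close>, and since
  \<open>p > 1\<close> the comparison bounds \<open>\<integral> |x|^a u^(p+1) \<psi>\<^sup>2 + \<integral> (\<Delta>u)\<^sup>2 \<psi>\<^sup>2\<close> by an integral of \<open>u\<^sup>2\<close>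
  (\<open>stable_energy_estimate\<close>). For \<open>\<psi>\<close> a high power of a cutoff function, that integral is absorbed
  by the superlinear term (\<open>annular_energy_bound\<close>). Integration by parts then also bounds the gradient
  and the Hessian of \<open>u\<close> in \<open>L\<^sup>2\<close> of a smaller annulus (\<open>annular_bounds\<close>).

  On the ball, the Pohozaev identity (multiplier \<open>\<beta> x \<bullet> \<nabla>u\<close>) and the energy identity (multiplier
  \<open>\<beta> u\<close>) are combined so that \<open>\<integral> (\<Delta>u)\<^sup>2 \<beta>\<close> cancels. What remains is \<open>\<integral> |x|^a u^(p+1) \<beta>\<close> with the
  coefficient \<open>(N + a) / (p + 1) - (N - 4) / 2\<close>, which is positive in the subcritical range, while
  all other terms contain derivatives of \<open>\<beta>\<close> and therefore live on the annulus.
\<close>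

section \<open>Calculus of iterated partial derivatives\<close>

notation partial_deriv (\<open>\<partial>\<close>)
notation laplacian (\<open>\<Delta>\<close>)

lemma partial_deriv_eq: "(f has_derivative f') (at x) \<Longrightarrow> \<partial> i f x = f' i"
  unfolding partial_deriv_def by (metis frechet_derivative_at)

lemma C_class_differentiable: "C_class (Suc k) f \<Longrightarrow> f differentiable (at x)"
  by (simp add: differentiable_on_def)

text \<open>
  The class is defined by partial derivatives; this recovers the total derivative, which the chain
  rule and the mean value theorem along arbitrary segments need.
\<close>

lemma C_class_has_derivative:
  assumes "C_class (Suc k) f"
  shows "(f has_derivative (\<lambda>h. \<Sum>i\<in>Basis. (h \<bullet> i) * \<partial> i f x)) (at x)"
proof -
  have d: "(f has_derivative frechet_derivative f (at x)) (at x)"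
    using C_class_differentiable[OF assms] frechet_derivative_works by blast
  then interpret bounded_linear "frechet_derivative f (at x)"
    by (rule has_derivative_bounded_linear)
  have "frechet_derivative f (at x) h = (\<Sum>i\<in>Basis. (h \<bullet> i) * \<partial> i f x)" for h
  proof -
    have "frechet_derivative f (at x) (\<Sum>i\<in>Basis. (h \<bullet> i) *\<^sub>R i) = (\<Sum>i\<in>Basis. (h \<bullet> i) * \<partial> i f x)"
      unfolding sum scale partial_deriv_def by simp
    then show ?thesis by (simp add: euclidean_representation)
  qed
  then have "frechet_derivative f (at x) = (\<lambda>h. \<Sum>i\<in>Basis. (h \<bullet> i) * \<partial> i f x)" by blast
  with d show ?thesis by metis
qed

lemma C_class_partial_deriv: "C_class (Suc k) f \<Longrightarrow> i \<in> Basis \<Longrightarrow> C_class k (\<partial> i f)"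
  by simp

lemma C_class_Suc_D: "C_class (Suc k) f \<Longrightarrow> C_class k f"
proof (induction k arbitrary: f)
  case 0
  then show ?case by (simp add: differentiable_imp_continuous_on)
next
  case (Suc k)
  then show ?case using C_class.simps(2) by blast
qed

lemma C_class_mono:
  assumes "C_class k f" "l \<le> k"
  shows "C_class l f"
  using assms(2,1) by (induction rule: inc_induct) (blast dest: C_class_Suc_D)+

lemma C_class_continuous: "C_class k f \<Longrightarrow> continuous_on A f"
  using C_class_mono[of k f 0] by (auto intro: continuous_on_subset)

lemma C_class_SucI:
  assumes "\<And>x. f differentiable (at x)" "\<And>i. i \<in> Basis \<Longrightarrow> C_class k (\<partial> i f)"
  shows "C_class (Suc k) f"
  using assms by (simp add: differentiable_on_def)

lemma partial_deriv_const: "\<partial> i (\<lambda>x. c) = (\<lambda>x. 0)"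
  by (rule ext, rule partial_deriv_eq[THEN trans], rule has_derivative_const) simp

lemma partial_deriv_inner: "\<partial> i (\<lambda>x. x \<bullet> j) = (\<lambda>x. i \<bullet> j)"
  by (rule ext, rule partial_deriv_eq, rule derivative_eq_intros, rule has_derivative_ident) simp

lemma has_derivative_works:
  assumes "f differentiable (at x)"
  shows "(f has_derivative frechet_derivative f (at x)) (at x)"
  using assms frechet_derivative_works by blast

lemma partial_deriv_add:
  assumes "C_class (Suc k) f" "C_class (Suc l) g"
  shows "\<partial> i (\<lambda>x. f x + g x) = (\<lambda>x. \<partial> i f x + \<partial> i g x)"
proof
  fix x
  note * = has_derivative_works[OF C_class_differentiable[OF assms(1)], of x]
    has_derivative_works[OF C_class_differentiable[OF assms(2)], of x]
  show "\<partial> i (\<lambda>x. f x + g x) x = \<partial> i f x + \<partial> i g x"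
    using partial_deriv_eq[OF has_derivative_add[OF *], of i] unfolding partial_deriv_def .
qed

lemma partial_deriv_mult:
  assumes "C_class (Suc k) f" "C_class (Suc l) g"
  shows "\<partial> i (\<lambda>x. f x * g x) = (\<lambda>x. f x * \<partial> i g x + \<partial> i f x * g x)"
proof
  fix x
  note * = has_derivative_works[OF C_class_differentiable[OF assms(1)], of x]
    has_derivative_works[OF C_class_differentiable[OF assms(2)], of x]
  show "\<partial> i (\<lambda>x. f x * g x) x = f x * \<partial> i g x + \<partial> i f x * g x"
    using partial_deriv_eq[OF has_derivative_mult[OF *], of i] unfolding partial_deriv_def .
qed

lemma C_class_const: "C_class k (\<lambda>x. c)"
  by (induction k arbitrary: c) (auto simp: partial_deriv_const)

lemma C_class_inner: "C_class k (\<lambda>x. x \<bullet> j)"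
  by (cases k) (auto simp: partial_deriv_inner C_class_const differentiable_on_def
      intro!: continuous_intros differentiable_inner)

lemma C_class_add: "C_class k f \<Longrightarrow> C_class k g \<Longrightarrow> C_class k (\<lambda>x. f x + g x)"
proof (induction k arbitrary: f g)
  case 0
  then show ?case by (auto intro: continuous_intros)
next
  case (Suc k)
  then show ?case
    using partial_deriv_add[OF Suc.prems] by (auto intro: derivative_intros)
qed

lemma C_class_mult: "C_class k f \<Longrightarrow> C_class k g \<Longrightarrow> C_class k (\<lambda>x. f x * g x)"
proof (induction k arbitrary: f g)
  case 0
  then show ?case by (auto intro: continuous_intros)
next
  case (Suc k)
  have "C_class k (\<partial> i (\<lambda>x. f x * g x))" if "i \<in> Basis" for i
    unfolding partial_deriv_mult[OF Suc.prems]
    using that Suc.prems by (intro C_class_add Suc.IH) (blast intro: C_class_Suc_D C_class_partial_deriv)+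
  then show ?case
    using Suc.prems by (auto simp: differentiable_on_def intro: differentiable_mult)
qed

lemma C_class_cmult: "C_class k f \<Longrightarrow> C_class k (\<lambda>x. c * f x)"
  by (intro C_class_mult C_class_const)

lemma partial_deriv_cmult:
  "C_class (Suc k) f \<Longrightarrow> \<partial> i (\<lambda>x. c * f x) = (\<lambda>x. c * \<partial> i f x)"
  by (subst partial_deriv_mult[OF C_class_const[of "Suc k"]]) (auto simp: partial_deriv_const)

lemma C_class_minus: "C_class k f \<Longrightarrow> C_class k (\<lambda>x. - f x)"
  using C_class_cmult[of k f "-1"] by simp

lemma C_class_diff: "C_class k f \<Longrightarrow> C_class k g \<Longrightarrow> C_class k (\<lambda>x. f x - g x)"
  using C_class_add[OF _ C_class_minus, of k f g] by simp

lemma partial_deriv_diff: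
  assumes "C_class (Suc k) f" "C_class (Suc l) g"
  shows "\<partial> i (\<lambda>x. f x - g x) = (\<lambda>x. \<partial> i f x - \<partial> i g x)"
  using partial_deriv_add[OF assms(1) C_class_cmult[OF assms(2), of "-1"], of i]
    partial_deriv_cmult[OF assms(2), of i "-1"] by simp

lemma C_class_sum: "(\<And>j. j \<in> S \<Longrightarrow> C_class k (f j)) \<Longrightarrow> C_class k (\<lambda>x. \<Sum>j\<in>S. f j x)"
  by (induction S rule: infinite_finite_induct) (auto intro!: C_class_const C_class_add)

lemma partial_deriv_sum:
  "(\<And>j. j \<in> S \<Longrightarrow> C_class (Suc k) (f j)) \<Longrightarrow> \<partial> i (\<lambda>x. \<Sum>j\<in>S. f j x) = (\<lambda>x. \<Sum>j\<in>S. \<partial> i (f j) x)"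
proof (induction S rule: infinite_finite_induct)
  case (insert a S)
  have "\<partial> i (\<lambda>x. f a x + (\<Sum>j\<in>S. f j x)) = (\<lambda>x. \<partial> i (f a) x + \<partial> i (\<lambda>x. \<Sum>j\<in>S. f j x) x)"
    by (rule partial_deriv_add[of k _ k]) (use insert.prems in \<open>auto intro!: C_class_sum simp del: C_class.simps\<close>)
  with insert show ?case by simp
qed (simp_all add: partial_deriv_const)

lemma C_class_power: "C_class k f \<Longrightarrow> C_class k (\<lambda>x. f x ^ m)"
  by (induction m) (auto intro!: C_class_const C_class_mult)

lemma partial_deriv_power:
  assumes f: "C_class (Suc k) f"
  shows "\<partial> i (\<lambda>x. f x ^ m) = (\<lambda>x. real m * f x ^ (m - 1) * \<partial> i f x)"
proof
  fix x
  note * = has_derivative_works[OF C_class_differentiable[OF f], of x]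
  show "\<partial> i (\<lambda>x. f x ^ m) x = real m * f x ^ (m - 1) * \<partial> i f x"
    using partial_deriv_eq[OF has_derivative_power[OF *, of m], of i] unfolding partial_deriv_def 
    by (simp add: mult_ac)
qed

lemma C_class_laplacian: "C_class (Suc (Suc k)) f \<Longrightarrow> C_class k (\<Delta> f)"
  unfolding laplacian_def[abs_def] by (intro C_class_sum) simp

lemmas C_class_intros =
  C_class_const C_class_inner C_class_add C_class_mult C_class_diff C_class_minus C_class_sum C_class_power

lemma partial_deriv_dilate:
  assumes f: "C_class (Suc k) f"
  shows "\<partial> i (\<lambda>x. f (c *\<^sub>R x)) = (\<lambda>x. c * \<partial> i f (c *\<^sub>R x))"
proof
  fix x
  note * = has_derivative_works[OF C_class_differentiable[OF f], of "c *\<^sub>R x"]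
  interpret l: bounded_linear "frechet_derivative f (at (c *\<^sub>R x))"
    using * by (rule has_derivative_bounded_linear)
  have "((\<lambda>x. f (c *\<^sub>R x)) has_derivative (\<lambda>h. frechet_derivative f (at (c *\<^sub>R x)) (c *\<^sub>R h))) (at x)"
    by (rule has_derivative_compose[where g = f and f = "\<lambda>x. c *\<^sub>R x", OF _ *]) (auto intro!: derivative_eq_intros)
  from partial_deriv_eq[OF this, of i]
  show "\<partial> i (\<lambda>x. f (c *\<^sub>R x)) x = c * \<partial> i f (c *\<^sub>R x)"
    by (simp add: partial_deriv_def l.scale)
qed

lemma C_class_dilate: "C_class k f \<Longrightarrow> C_class k (\<lambda>x. f (c *\<^sub>R x))"
proof (induction k arbitrary: f)
  case 0
  then show ?case by (auto intro!: continuous_intros continuous_on_compose2[of UNIV f])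
next
  case (Suc k)
  have "C_class k (\<partial> i (\<lambda>x. f (c *\<^sub>R x)))" if "i \<in> Basis" for i
    unfolding partial_deriv_dilate[OF Suc.prems]
    using that Suc by (intro C_class_cmult Suc.IH) auto
  moreover have "(\<lambda>x. f (c *\<^sub>R x)) differentiable (at x)" for x
    using has_derivative_works[OF C_class_differentiable[OF Suc.prems], of "c *\<^sub>R x"]
    by (intro differentiableI[OF has_derivative_compose[where g = f and f = "\<lambda>x. c *\<^sub>R x"]])
       (auto intro!: derivative_eq_intros)
  ultimately show ?case by (simp add: differentiable_on_def)
qed

lemma laplacian_dilate:
  assumes f: "C_class (Suc (Suc k)) f"
  shows "\<Delta> (\<lambda>x. f (c *\<^sub>R x)) = (\<lambda>x. c\<^sup>2 * \<Delta> f (c *\<^sub>R x))"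
proof -
  have "\<partial> i (\<partial> i (\<lambda>x. f (c *\<^sub>R x))) x = c\<^sup>2 * \<partial> i (\<partial> i f) (c *\<^sub>R x)" if "i \<in> Basis" for i x
  proof -
    have c: "C_class (Suc k) (\<partial> i f)" using f that by (rule C_class_partial_deriv)
    show ?thesis unfolding partial_deriv_dilate[OF f]
      by (subst partial_deriv_cmult[OF C_class_dilate[OF c]])
         (simp add: partial_deriv_dilate[OF c] power2_eq_square)
  qed
  then show ?thesis by (simp add: laplacian_def fun_eq_iff sum_distrib_left)
qed

lemma partial_deriv_local:
  assumes "open S" "x \<in> S" "\<And>y. y \<in> S \<Longrightarrow> f y = g y"
  shows "\<partial> i f x = \<partial> i g x"
proof -
  have "(f has_derivative F) (at x) = (g has_derivative F) (at x)" for F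
    using assms by (metis has_derivative_transform_within_open)
  then show ?thesis by (simp add: partial_deriv_def frechet_derivative_def)
qed

lemma partial_deriv_locally_constant:
  assumes "open S" "x \<in> S" "\<And>y. y \<in> S \<Longrightarrow> f y = c"
  shows "\<partial> i f x = 0"
  using partial_deriv_local[OF assms(1,2), of f "\<lambda>_. c" i] assms(3) by (simp add: partial_deriv_const)

lemma open_norm_greater: "open {x::'a::real_normed_vector. r < norm x}"
  by (intro open_Collect_less continuous_intros)

lemma partial_deriv_vanishes:
  assumes "\<And>x. norm x > r \<Longrightarrow> f x = 0" "norm x > r"
  shows "\<partial> i f x = 0"
  using assms by (intro partial_deriv_locally_constant[OF open_norm_greater[of r]]) auto

lemma laplacian_locally_constant:
  assumes "open S" "x \<in> S" "\<And>y. y \<in> S \<Longrightarrow> f y = c"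
  shows "\<Delta> f x = 0"
  unfolding laplacian_def
  by (intro sum.neutral ballI partial_deriv_locally_constant[OF assms(1,2), of _ 0]
      partial_deriv_locally_constant[OF assms(1) _ assms(3)])

lemma laplacian_vanishes:
  assumes "\<And>x. norm x > r \<Longrightarrow> f x = 0" "norm x > r"
  shows "\<Delta> f x = 0"
  using assms by (intro laplacian_locally_constant[OF open_norm_greater[of r]]) auto

text \<open>
  Schwarz's theorem, by the classical argument: the mixed second difference of a square with side
  \<open>h\<close> equals \<open>h\<^sup>2\<close> times either mixed derivative at some point of the square, and both derivatives are
  continuous.
\<close>

lemma partial_deriv_commute:
  fixes f :: "'a::euclidean_space \<Rightarrow> real"
  assumes f: "C_class (Suc (Suc k)) f" and i: "i \<in> Basis" and j: "j \<in> Basis"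
  shows "\<partial> i (\<partial> j f) x = \<partial> j (\<partial> i f) x"
proof -
  have line: "((\<lambda>t. g (y + t *\<^sub>R e)) has_real_derivative \<partial> e g (y + t *\<^sub>R e)) (at t within T)"
    if g: "C_class (Suc 0) g" and e: "e \<in> Basis" for g :: "'a \<Rightarrow> real" and y e t T
  proof -
    note * = has_derivative_works[OF C_class_differentiable[OF g], of "y + t *\<^sub>R e"]
    interpret l: bounded_linear "frechet_derivative g (at (y + t *\<^sub>R e))"
      using * by (rule has_derivative_bounded_linear)
    have "((\<lambda>t. g (y + t *\<^sub>R e)) has_derivative (\<lambda>h. frechet_derivative g (at (y + t *\<^sub>R e)) (h *\<^sub>R e))) (at t within T)"
      by (rule has_derivative_compose[where g = g and f = "\<lambda>t. y + t *\<^sub>R e", OF _ *]) (auto intro!: derivative_eq_intros)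
    then show ?thesis
      by (simp add: has_field_derivative_def l.scale partial_deriv_def mult_commute_abs)
  qed
  have f1: "C_class (Suc 0) f" and fd: "\<And>e. e \<in> Basis \<Longrightarrow> C_class (Suc 0) (\<partial> e f)"
    using f by (auto intro: C_class_mono simp del: C_class.simps dest: C_class_partial_deriv)
  have fdd: "continuous_on UNIV (\<partial> d (\<partial> e f))" if "d \<in> Basis" "e \<in> Basis" for d e
    using C_class_continuous[OF C_class_partial_deriv[OF C_class_partial_deriv[OF f]]] that by blast
  define S where "S h = f (x + h *\<^sub>R i + h *\<^sub>R j) - f (x + h *\<^sub>R i) - f (x + h *\<^sub>R j) + f x" for h
  have mvt: "\<exists>s t. 0 < s \<and> s < h \<and> 0 < t \<and> t < h \<and>
      f (x + h *\<^sub>R d + h *\<^sub>R e) - f (x + h *\<^sub>R d) - f (x + h *\<^sub>R e) + f x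
        = h * h * \<partial> e (\<partial> d f) (x + s *\<^sub>R d + t *\<^sub>R e)"
    if h: "h > 0" and d: "d \<in> Basis" and e: "e \<in> Basis" for h d e
  proof -
    define g where "g s = f ((x + h *\<^sub>R e) + s *\<^sub>R d) - f (x + s *\<^sub>R d)" for s
    have "\<exists>s>0. s < h \<and> g h - g 0 = (h - 0) * (\<partial> d f ((x + h *\<^sub>R e) + s *\<^sub>R d) - \<partial> d f (x + s *\<^sub>R d))"
      unfolding g_def by (rule MVT2[OF h]) (intro derivative_intros line f1 d)
    then obtain s where s: "0 < s" "s < h"
      "g h - g 0 = h * (\<partial> d f ((x + h *\<^sub>R e) + s *\<^sub>R d) - \<partial> d f (x + s *\<^sub>R d))" by auto
    have "\<exists>t>0. t < h \<and> \<partial> d f ((x + s *\<^sub>R d) + h *\<^sub>R e) - \<partial> d f ((x + s *\<^sub>R d) + 0 *\<^sub>R e)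
        = (h - 0) * \<partial> e (\<partial> d f) ((x + s *\<^sub>R d) + t *\<^sub>R e)"
      by (rule MVT2[OF h]) (intro line fd d e)
    then obtain t where t: "0 < t" "t < h" "\<partial> d f ((x + s *\<^sub>R d) + h *\<^sub>R e) - \<partial> d f (x + s *\<^sub>R d)
        = h * \<partial> e (\<partial> d f) ((x + s *\<^sub>R d) + t *\<^sub>R e)" by auto
    show ?thesis
      using s t by (intro exI[of _ s] exI[of _ t]) (auto simp: g_def algebra_simps)
  qed
  have lim: "(\<lambda>n. \<partial> e (\<partial> d f) (x + s n *\<^sub>R d + t n *\<^sub>R e)) \<longlonglongrightarrow> \<partial> e (\<partial> d f) x"
    if "d \<in> Basis" "e \<in> Basis" and st: "\<And>n. 0 < s n \<and> s n < inverse (real (Suc n))" "\<And>n. 0 < t n \<and> t n < inverse (real (Suc n))"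
    for d e s t
  proof -
    have "s \<longlonglongrightarrow> 0" "t \<longlonglongrightarrow> 0"
      using st by (auto intro!: tendsto_sandwich[OF _ _ tendsto_const LIMSEQ_inverse_real_of_nat] always_eventually less_imp_le)
    then have "(\<lambda>n. x + s n *\<^sub>R d + t n *\<^sub>R e) \<longlonglongrightarrow> x + 0 *\<^sub>R d + 0 *\<^sub>R e"
      by (intro tendsto_intros)
    then show ?thesis using continuous_on_tendsto_compose[OF fdd[of e d]] that by force
  qed
  have "\<forall>n. \<exists>s t. 0 < s \<and> s < inverse (real (Suc n)) \<and> 0 < t \<and> t < inverse (real (Suc n)) \<and>
      S (inverse (real (Suc n))) = inverse (real (Suc n)) * inverse (real (Suc n)) * \<partial> j (\<partial> i f) (x + s *\<^sub>R i + t *\<^sub>R j)"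
    unfolding S_def by (intro allI mvt i j) simp
  then obtain s t where st: "\<And>n. 0 < s n \<and> s n < inverse (real (Suc n))" "\<And>n. 0 < t n \<and> t n < inverse (real (Suc n))"
    "\<And>n. S (inverse (real (Suc n))) = inverse (real (Suc n)) * inverse (real (Suc n)) * \<partial> j (\<partial> i f) (x + s n *\<^sub>R i + t n *\<^sub>R j)"
    by metis
  have "\<forall>n. \<exists>s t. 0 < s \<and> s < inverse (real (Suc n)) \<and> 0 < t \<and> t < inverse (real (Suc n)) \<and>
      S (inverse (real (Suc n))) = inverse (real (Suc n)) * inverse (real (Suc n)) * \<partial> i (\<partial> j f) (x + s *\<^sub>R j + t *\<^sub>R i)"
    using mvt[OF _ j i] unfolding S_def by (auto simp: algebra_simps)
  then obtain s' t' where st': "\<And>n. 0 < s' n \<and> s' n < inverse (real (Suc n))" "\<And>n. 0 < t' n \<and> t' n < inverse (real (Suc n))"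
    "\<And>n. S (inverse (real (Suc n))) = inverse (real (Suc n)) * inverse (real (Suc n)) * \<partial> i (\<partial> j f) (x + s' n *\<^sub>R j + t' n *\<^sub>R i)"
    by metis
  have "\<partial> j (\<partial> i f) (x + s n *\<^sub>R i + t n *\<^sub>R j) = \<partial> i (\<partial> j f) (x + s' n *\<^sub>R j + t' n *\<^sub>R i)" for n
    using st(3)[of n] st'(3)[of n] by simp
  with lim[OF i j st(1,2)] lim[OF j i st'(1,2)] show ?thesis
    by (simp add: LIMSEQ_unique)
qed

declare C_class.simps(2) [simp del]

section \<open>Integration by parts and dilations\<close>

lemma C_class_differentiable_on_line:
  assumes "C_class (Suc k) f"
  shows "((\<lambda>t. f (y + t *\<^sub>R e)) has_real_derivative (\<Sum>i\<in>Basis. (e \<bullet> i) * \<partial> i f (y + t *\<^sub>R e))) (at t within T)"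
proof -
  have "((\<lambda>t. f (y + t *\<^sub>R e)) has_derivative (\<lambda>h. \<Sum>i\<in>Basis. ((h *\<^sub>R e) \<bullet> i) * \<partial> i f (y + t *\<^sub>R e))) (at t within T)"
    by (rule has_derivative_compose[where g = f and f = "\<lambda>t. y + t *\<^sub>R e", OF _ C_class_has_derivative[OF assms]])
       (auto intro!: derivative_eq_intros)
  moreover have "(\<lambda>h. \<Sum>i\<in>Basis. ((h *\<^sub>R e) \<bullet> i) * \<partial> i f (y + t *\<^sub>R e))
      = (*) (\<Sum>i\<in>Basis. (e \<bullet> i) * \<partial> i f (y + t *\<^sub>R e))"
    by (rule ext) (simp only: inner_scaleR_left sum_distrib_right, simp add: mult_ac)
  ultimately show ?thesis
    unfolding has_field_derivative_def by simp
qed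

lemma integrable_vanishing:
  fixes f :: "'a::euclidean_space \<Rightarrow> real"
  assumes "continuous_on UNIV f" "\<And>x. r < norm x \<Longrightarrow> f x = 0"
  shows "integrable lborel f"
proof -
  have "integrable lborel (\<lambda>x. indicator (cball 0 r) x *\<^sub>R f x)"
    by (intro borel_integrable_compact compact_cball continuous_on_subset[OF assms(1)]) auto
  moreover have "(\<lambda>x. indicator (cball 0 r) x *\<^sub>R f x) = f"
    using assms(2) by (force simp: indicator_def not_le)
  ultimately show ?thesis by simp
qed

lemma bounded_vanishing:
  fixes f :: "'a::euclidean_space \<Rightarrow> real"
  assumes "continuous_on UNIV f" "\<And>x. r < norm x \<Longrightarrow> f x = 0"
  shows "\<exists>K\<ge>0. \<forall>x. \<bar>f x\<bar> \<le> K"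
proof -
  have "bounded (f ` cball 0 r)"
    by (intro compact_imp_bounded compact_continuous_image continuous_on_subset[OF assms(1)]) auto
  then obtain K where "K > 0" "\<And>x. x \<in> cball 0 r \<Longrightarrow> \<bar>f x\<bar> \<le> K"
    unfolding bounded_pos by auto
  then show ?thesis using assms(2)
    by (intro exI[of _ K]) (metis abs_zero dist_0_norm less_imp_le mem_cball not_le)
qed

text \<open>
  Differentiation under the integral sign along a continuous vector field \<open>b\<close>. A constant field gives
  the divergence theorem, and the field \<open>b x = x\<close> gives the dilation identity. The weight \<open>w\<close> is only
  continuous, so that \<open>|x|^a\<close> is admissible although it need not be differentiable at the origin.
\<close>

lemma integral_difference_quotient_tendsto:
  fixes F w :: "'a::euclidean_space \<Rightarrow> real" and b :: "'a \<Rightarrow> 'a"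
  assumes F: "C_class 1 F" and w: "continuous_on UNIV w" and b: "continuous_on UNIV b"
    and supp: "\<And>x h. r < norm x \<Longrightarrow> 0 \<le> h \<Longrightarrow> h \<le> 1 \<Longrightarrow> F (x + h *\<^sub>R b x) = 0"
  shows "(\<lambda>n. LINT x|lborel. w x * ((F (x + inverse (real (Suc n)) *\<^sub>R b x) - F x) / inverse (real (Suc n))))
     \<longlonglongrightarrow> (LINT x|lborel. w x * (\<Sum>i\<in>Basis. (b x \<bullet> i) * \<partial> i F x))"
proof -
  define \<epsilon> where "\<epsilon> n = inverse (real (Suc n))" for n
  have \<epsilon>: "0 < \<epsilon> n" "\<epsilon> n \<le> 1" for n by (auto simp: \<epsilon>_def field_simps)
  have F1: "C_class (Suc 0) F" using F by simp
  have cF[continuous_intros]: "continuous_on A F" for A by (rule C_class_continuous[OF F])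
  have cdF: "continuous_on A (\<partial> i F)" if "i \<in> Basis" for i A
    using C_class_continuous[OF C_class_partial_deriv[OF F1 that]] .
  define g where "g = (\<lambda>(x, s). w x * (\<Sum>i\<in>Basis. (b x \<bullet> i) * \<partial> i F (x + s *\<^sub>R b x)))"
  have w': "continuous_on A (\<lambda>x. w (fst x))" and b': "continuous_on A (\<lambda>x. b (fst x))" for A :: "('a \<times> real) set"
    by (auto intro!: continuous_on_compose2[OF w] continuous_on_compose2[OF b] continuous_intros)
  have "continuous_on (cball 0 r \<times> {0..1}) g"
    unfolding g_def case_prod_beta
    by (intro continuous_intros w' b' continuous_on_compose2[OF cdF[of _ UNIV]]) auto
  then have "bounded (g ` (cball 0 r \<times> {0..1}))"
    by (intro compact_imp_bounded compact_continuous_image compact_Times) auto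
  then obtain K where K: "K > 0" "\<And>x s. norm x \<le> r \<Longrightarrow> 0 \<le> s \<Longrightarrow> s \<le> 1 \<Longrightarrow> \<bar>g (x, s)\<bar> \<le> K"
    unfolding bounded_pos by fastforce
  define S where "S n x = w x * ((F (x + \<epsilon> n *\<^sub>R b x) - F x) / \<epsilon> n)" for n x
  have S_bound: "norm (S n x) \<le> K * indicator (cball 0 r) x" for n x
  proof (cases "norm x \<le> r")
    case True
    have "\<exists>s>0. s < \<epsilon> n \<and> F (x + \<epsilon> n *\<^sub>R b x) - F (x + 0 *\<^sub>R b x)
        = (\<epsilon> n - 0) * (\<Sum>i\<in>Basis. (b x \<bullet> i) * \<partial> i F (x + s *\<^sub>R b x))"
      by (rule MVT2[OF \<epsilon>(1)]) (rule C_class_differentiable_on_line[OF F1])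
    then obtain s where s: "0 < s" "s < \<epsilon> n"
      "F (x + \<epsilon> n *\<^sub>R b x) - F x = \<epsilon> n * (\<Sum>i\<in>Basis. (b x \<bullet> i) * \<partial> i F (x + s *\<^sub>R b x))"
      by auto
    then have "S n x = g (x, s)" using \<epsilon>(1)[of n] by (simp add: S_def g_def)
    with K(2)[of x s] True s \<epsilon>(2)[of n] show ?thesis by simp
  next
    case False
    with supp[of x 0] supp[of x "\<epsilon> n"] \<epsilon>[of n] show ?thesis by (simp add: S_def less_imp_le)
  qed
  have "(\<lambda>n. integral\<^sup>L lborel (S n)) \<longlonglongrightarrow> (LINT x|lborel. g (x, 0))"
  proof (rule integral_dominated_convergence[where w = "\<lambda>x. K * indicator (cball 0 r) x"])
    show "(\<lambda>x. g (x, 0)) \<in> borel_measurable lborel"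
      unfolding g_def by (simp, intro borel_measurable_continuous_onI continuous_intros w b cdF)
    show "S n \<in> borel_measurable lborel" for n
    proof -
      have "continuous_on UNIV (S n)"
        unfolding S_def by (intro continuous_intros w b continuous_on_compose2[OF cF[of UNIV]]) (use \<epsilon>(1)[of n] in auto)
      then show ?thesis by (simp add: borel_measurable_continuous_onI)
    qed
    show "integrable lborel (\<lambda>x::'a. K * indicator (cball 0 r) x)"
      using emeasure_lborel_cball_finite[of "0 :: 'a" r] by (intro integrable_mult_right integrable_real_indicator) auto
    show "AE x in lborel. norm (S n x) \<le> K * indicator (cball 0 r) x" for n
      using S_bound by simp
    show "AE x in lborel. (\<lambda>n. S n x) \<longlonglongrightarrow> g (x, 0)"
    proof (intro always_eventually allI)
      fix x
      have "((\<lambda>h. (F (x + (0 + h) *\<^sub>R b x) - F (x + 0 *\<^sub>R b x)) / h) \<longlongrightarrow> (\<Sum>i\<in>Basis. (b x \<bullet> i) * \<partial> i F (x + 0 *\<^sub>R b x))) (at 0)"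
        using C_class_differentiable_on_line[OF F1, of x "b x" 0 UNIV] unfolding DERIV_def .
      moreover have "filterlim \<epsilon> (at 0) sequentially"
        unfolding filterlim_at using LIMSEQ_inverse_real_of_nat \<epsilon>(1) by (auto simp: \<epsilon>_def[abs_def])
      ultimately have "(\<lambda>n. (F (x + (0 + \<epsilon> n) *\<^sub>R b x) - F (x + 0 *\<^sub>R b x)) / \<epsilon> n) \<longlonglongrightarrow> (\<Sum>i\<in>Basis. (b x \<bullet> i) * \<partial> i F (x + 0 *\<^sub>R b x))"
        by (rule filterlim_compose)
      then show "(\<lambda>n. S n x) \<longlonglongrightarrow> g (x, 0)"
        unfolding S_def g_def by (simp only: prod.case) (rule tendsto_mult_left, simp)
    qed
  qed
  then show ?thesis by (simp add: S_def[abs_def] g_def \<epsilon>_def)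
qed

lemma integral_dilate:
  fixes f :: "'a::euclidean_space \<Rightarrow> real"
  assumes [measurable]: "f \<in> borel_measurable borel" and c: "c > 0"
  shows "(LINT x|lborel. f x) = c ^ DIM('a) * (LINT x|lborel. f (c *\<^sub>R x))"
proof -
  have "(LINT x|lborel. f x) = (LINT x|density (distr lborel borel (\<lambda>x. 0 + c *\<^sub>R x)) (\<lambda>_. ennreal (\<bar>c\<bar> ^ DIM('a))). f x)"
    using lborel_affine[of c "0 :: 'a"] c by simp
  also have "\<dots> = c ^ DIM('a) * (LINT x|lborel. f (c *\<^sub>R x))"
    using c by (subst integral_density) (auto simp: integral_distr)
  finally show ?thesis .
qed

lemma integral_translate:
  fixes f :: "'a::euclidean_space \<Rightarrow> real"
  assumes [measurable]: "f \<in> borel_measurable borel"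
  shows "(LINT x|lborel. f (x + e)) = (LINT x|lborel. f x)"
proof -
  have "(LINT x|lborel. f x) = (LINT x|distr lborel borel ((+) e). f x)"
    by (simp add: lborel_distr_plus)
  also have "\<dots> = (LINT x|lborel. f (x + e))"
    by (subst integral_distr) (auto simp: add.commute)
  finally show ?thesis by simp
qed

text \<open>
  Translation invariance of Lebesgue measure: all difference quotients have integral zero.
\<close>

lemma integral_partial_deriv_eq_0:
  fixes F :: "'a::euclidean_space \<Rightarrow> real"
  assumes F: "C_class (Suc k) F" and supp: "\<And>x. r < norm x \<Longrightarrow> F x = 0" and i: "i \<in> Basis"
  shows "(LINT x|lborel. \<partial> i F x) = 0"
proof -
  have cF: "continuous_on A F" for A by (rule C_class_continuous[OF F])
  have supp': "F (x + h *\<^sub>R i) = 0" if "r + 1 < norm x" "0 \<le> h" "h \<le> 1" for x h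
  proof (rule supp)
    have "norm x \<le> norm (x + h *\<^sub>R i) + norm (h *\<^sub>R i)" using norm_triangle_ineq4[of "x + h *\<^sub>R i" "h *\<^sub>R i"] by simp
    with that i show "r < norm (x + h *\<^sub>R i)" by simp
  qed
  have z: "(LINT x|lborel. 1 * ((F (x + inverse (real (Suc n)) *\<^sub>R i) - F x) / inverse (real (Suc n)))) = 0" for n
  proof -
    define h where "h = inverse (real (Suc n))"
    have h: "0 < h" "h \<le> 1" by (auto simp: h_def field_simps)
    have "integrable lborel F"
      by (rule integrable_vanishing[OF cF]) (rule supp)
    moreover have "integrable lborel (\<lambda>x. F (x + h *\<^sub>R i))"
      by (rule integrable_vanishing[where r = "r + 1"])
         (use h in \<open>auto intro!: continuous_on_compose2[OF cF[of UNIV]] continuous_intros supp'\<close>)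
    ultimately have "(LINT x|lborel. F (x + h *\<^sub>R i) - F x) = 0"
      using integral_translate[of F "h *\<^sub>R i"] borel_measurable_continuous_onI[OF cF] by simp
    then show ?thesis by (simp add: h_def)
  qed
  have "C_class 1 F" using F by (rule C_class_mono) simp
  from integral_difference_quotient_tendsto[OF this, of "\<lambda>_. 1" "\<lambda>_. i" "r + 1"]
  have "(\<lambda>n. 0) \<longlonglongrightarrow> (LINT x|lborel. 1 * (\<Sum>j\<in>Basis. (i \<bullet> j) * \<partial> j F x))"
    unfolding z using supp' by (auto intro: continuous_intros)
  moreover have "(\<Sum>j\<in>Basis. (i \<bullet> j) * \<partial> j F x) = \<partial> i F x" for x
    using i by (simp add: inner_Basis if_distrib[of "\<lambda>t. t * _"] cong: if_cong)
  ultimately show ?thesis by (simp add: LIMSEQ_const_iff)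
qed

theorem integral_divergence_eq_0:
  fixes X :: "'a::euclidean_space \<Rightarrow> 'a \<Rightarrow> real"
  assumes X: "\<And>i. i \<in> Basis \<Longrightarrow> C_class (Suc k) (X i)"
    and supp: "\<And>i x. i \<in> Basis \<Longrightarrow> r < norm x \<Longrightarrow> X i x = 0"
  shows "(LINT x|lborel. (\<Sum>i\<in>Basis. \<partial> i (X i) x)) = 0"
proof -
  have "integrable lborel (\<partial> i (X i))" if "i \<in> Basis" for i
    by (rule integrable_vanishing[of _ r])
       (use that X supp in \<open>auto intro: C_class_continuous[OF C_class_partial_deriv] partial_deriv_vanishes[of r "X i"]\<close>)
  then have "(LINT x|lborel. (\<Sum>i\<in>Basis. \<partial> i (X i) x)) = (\<Sum>i\<in>Basis. LINT x|lborel. \<partial> i (X i) x)"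
    by (rule Bochner_Integration.integral_sum)
  also have "\<dots> = 0"
    by (intro sum.neutral ballI integral_partial_deriv_eq_0[OF X]) (auto intro: supp)
  finally show ?thesis .
qed

lemma weight_nonneg: "0 \<le> weight a x"
  by (simp add: weight_def)

lemma weight_ge_1: "0 \<le> a \<Longrightarrow> 1 \<le> norm x \<Longrightarrow> 1 \<le> weight a x"
  by (simp add: weight_def ge_one_powr_ge_zero)

lemma weight_pos: "x \<noteq> 0 \<Longrightarrow> 0 < weight a x"
  by (simp add: weight_def)

lemma weight_dilate: "0 < c \<Longrightarrow> weight a (c *\<^sub>R x) = c powr a * weight a x"
  by (simp add: weight_def powr_mult)

lemma continuous_on_weight: "0 \<le> a \<Longrightarrow> continuous_on A (weight a)"
  unfolding weight_def[abs_def] by (cases "a = 0") (auto intro!: continuous_on_powr' continuous_on_norm continuous_on_id continuous_on_const)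

text \<open>
  The weak form of \<open>div (|x|^a x) = (N + a) |x|^a\<close>. It is obtained from the scaling behaviour
  of \<open>\<integral> |x|^a F(c x) dx\<close> at \<open>c = 1\<close> instead of differentiating the weight, which avoids its lack of
  smoothness at the origin.
\<close>

lemma integral_weight_radial_derivative:
  fixes F :: "'a::euclidean_space \<Rightarrow> real"
  assumes a: "0 \<le> a" and F: "C_class (Suc k) F" and supp: "\<And>x. r < norm x \<Longrightarrow> F x = 0"
  shows "(LINT x|lborel. weight a x * (\<Sum>i\<in>Basis. (x \<bullet> i) * \<partial> i F x))
    = - (real DIM('a) + a) * (LINT x|lborel. weight a x * F x)"
proof -
  define d where "d = real DIM('a) + a"
  define I where "I = (LINT x|lborel. weight a x * F x)"
  define \<epsilon> where "\<epsilon> n = inverse (real (Suc n))" for n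
  have \<epsilon>: "0 < \<epsilon> n" "\<epsilon> n \<le> 1" for n by (auto simp: \<epsilon>_def field_simps)
  have cF: "continuous_on A F" for A by (rule C_class_continuous[OF F])
  note cw = continuous_on_weight[OF a]
  have supp': "F (c *\<^sub>R x) = 0" if "r < norm x" "1 \<le> c" for x c
    using that mult_right_mono[of 1 c "norm x"] by (intro supp) auto
  have z: "(LINT x|lborel. weight a x * ((F (x + \<epsilon> n *\<^sub>R x) - F x) / \<epsilon> n)) = ((1 + \<epsilon> n) powr (-d) - 1) / \<epsilon> n * I" for n
  proof -
    define c where "c = 1 + \<epsilon> n"
    have c: "c > 0" "c \<ge> 1" using \<epsilon>[of n] by (auto simp: c_def)
    have int: "integrable lborel (\<lambda>x. weight a x * F x)"
      by (rule integrable_vanishing[of _ r]) (auto intro!: continuous_intros cF cw supp)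
    have "I = c ^ DIM('a) * (LINT x|lborel. weight a (c *\<^sub>R x) * F (c *\<^sub>R x))"
      unfolding I_def by (rule integral_dilate[OF borel_measurable_continuous_onI c(1)]) (intro continuous_intros cF cw)
    also have "(LINT x|lborel. weight a (c *\<^sub>R x) * F (c *\<^sub>R x)) = c powr a * (LINT x|lborel. weight a x * F (c *\<^sub>R x))"
      using c by (simp add: weight_dilate mult.assoc)
    finally have "I = c powr d * (LINT x|lborel. weight a x * F (c *\<^sub>R x))"
      using c by (simp add: d_def powr_add powr_realpow)
    then have I: "(LINT x|lborel. weight a x * F (c *\<^sub>R x)) = c powr (-d) * I"
      using c by (simp add: powr_minus)
    have "integrable lborel (\<lambda>x. weight a x * F (c *\<^sub>R x))"
      by (rule integrable_vanishing[of _ r])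
         (auto intro!: continuous_intros cw continuous_on_compose2[OF cF[of UNIV]] supp' c)
    then have "(LINT x|lborel. weight a x * F (c *\<^sub>R x) - weight a x * F x) = (c powr (-d) - 1) * I"
      using int I by (simp add: I_def algebra_simps)
    moreover have "weight a x * ((F (x + \<epsilon> n *\<^sub>R x) - F x) / \<epsilon> n)
        = (weight a x * F (c *\<^sub>R x) - weight a x * F x) / \<epsilon> n" for x
      by (simp add: c_def scaleR_add_left algebra_simps diff_divide_distrib)
    ultimately show ?thesis by (simp only: integral_divide_zero flip: c_def) simp
  qed
  have "C_class 1 F" using F by (rule C_class_mono) simp
  from integral_difference_quotient_tendsto[OF this cw, of "\<lambda>x. x" r, folded \<epsilon>_def, unfolded z]
  have "(\<lambda>n. ((1 + \<epsilon> n) powr (-d) - 1) / \<epsilon> n * I)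
      \<longlonglongrightarrow> (LINT x|lborel. weight a x * (\<Sum>i\<in>Basis. (x \<bullet> i) * \<partial> i F x))"
    using supp'[of _ "1 + _"] by (auto intro: continuous_intros simp: scaleR_add_left)
  moreover have "(\<lambda>n. ((1 + \<epsilon> n) powr (-d) - 1) / \<epsilon> n * I) \<longlonglongrightarrow> -d * I"
  proof -
    have "((\<lambda>t. (1 + t) powr (-d)) has_real_derivative -d) (at 0)"
      by (auto intro!: derivative_eq_intros)
    then have "((\<lambda>h. ((1 + (0 + h)) powr (-d) - (1 + 0) powr (-d)) / h) \<longlongrightarrow> -d) (at 0)"
      unfolding DERIV_def .
    moreover have "filterlim \<epsilon> (at 0) sequentially"
      unfolding filterlim_at using LIMSEQ_inverse_real_of_nat \<epsilon>(1) by (auto simp: \<epsilon>_def[abs_def])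
    ultimately have "(\<lambda>n. ((1 + (0 + \<epsilon> n)) powr (-d) - (1 + 0) powr (-d)) / \<epsilon> n) \<longlonglongrightarrow> -d"
      by (rule filterlim_compose)
    then show ?thesis by (intro tendsto_mult_right) simp
  qed
  ultimately show ?thesis unfolding d_def I_def by (rule LIMSEQ_unique)
qed

section \<open>Cutoff functions\<close>

text \<open>
  Powers of the positive part are the building blocks of cutoff functions: the exponent \<open>k + 1\<close>
  gives class \<open>k\<close>, so that no function of class \<open>C\<^sup>\<infinity>\<close> has to be constructed.
\<close>

lemma has_real_derivative_pos_part_power:
  "((\<lambda>t::real. max 0 t ^ Suc (Suc k)) has_real_derivative real (Suc (Suc k)) * max 0 t ^ Suc k) (at t)"
proof (cases "t = 0")
  case False
  show ?thesis
  proof (cases "t > 0")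
    case True
    have "((\<lambda>t::real. t ^ Suc (Suc k)) has_real_derivative real (Suc (Suc k)) * t ^ Suc k) (at t)"
      by (rule DERIV_pow[THEN DERIV_cong]) simp
    then have "((\<lambda>t. max 0 t ^ Suc (Suc k)) has_real_derivative real (Suc (Suc k)) * t ^ Suc k) (at t)"
      by (rule has_field_derivative_transform_within_open[where S = "{0<..}"]) (use True in auto)
    with True show ?thesis by simp
  next
    case F: False
    have "((\<lambda>t. max 0 t ^ Suc (Suc k)) has_real_derivative 0) (at t)"
      by (rule has_field_derivative_transform_within_open[where S = "{..<0}" and f = "\<lambda>_. 0"]) (use F False in auto)
    with F show ?thesis by (simp add: max_absorb1)
  qed
next
  case True
  have "((\<lambda>h::real. max 0 h ^ Suc (Suc k) / h) \<longlongrightarrow> 0) (at 0)"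
  proof (rule Lim_null_comparison)
    show "\<forall>\<^sub>F h in at 0. norm (max 0 h ^ Suc (Suc k) / h) \<le> \<bar>h\<bar> ^ Suc k"
    proof (intro always_eventually allI)
      show "norm (max 0 h ^ Suc (Suc k) / h) \<le> \<bar>h\<bar> ^ Suc k" for h :: real
        by (cases "0 < h") (simp add: abs_mult, simp add: max_absorb1 del: power_Suc)
    qed
    have "((\<lambda>h::real. \<bar>h\<bar> ^ Suc k) \<longlongrightarrow> \<bar>0\<bar> ^ Suc k) (at 0)" by (intro tendsto_intros)
    then show "((\<lambda>h::real. \<bar>h\<bar> ^ Suc k) \<longlongrightarrow> 0) (at 0)" by simp
  qed
  with True show ?thesis by (simp add: DERIV_def)
qed

lemma C_class_pos_part_power:
  fixes f :: "'a::euclidean_space \<Rightarrow> real"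
  shows "C_class k f \<Longrightarrow> C_class k (\<lambda>x. max 0 (f x) ^ Suc k)"
proof (induction k arbitrary: f)
  case 0
  then show ?case by (auto intro!: continuous_intros)
next
  case (Suc k)
  have *: "((\<lambda>x. max 0 (f x) ^ Suc (Suc k)) has_derivative
      (\<lambda>h. real (Suc (Suc k)) * max 0 (f x) ^ Suc k * frechet_derivative f (at x) h)) (at x)" for x
    by (rule has_derivative_compose[where g = "\<lambda>t. max 0 t ^ Suc (Suc k)" and f = f, OF
      has_derivative_works[OF C_class_differentiable[OF Suc.prems]]
      has_real_derivative_pos_part_power[unfolded has_field_derivative_def]])
  show ?case
  proof (rule C_class_SucI)
    show "(\<lambda>x. max 0 (f x) ^ Suc (Suc k)) differentiable (at x)" for x
      using differentiableI[OF *] .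
    fix i :: 'a assume i: "i \<in> Basis"
    have "\<partial> i (\<lambda>x. max 0 (f x) ^ Suc (Suc k)) = (\<lambda>x. real (Suc (Suc k)) * max 0 (f x) ^ Suc k * \<partial> i f x)"
      by (rule ext, rule partial_deriv_eq[OF *, THEN trans]) (simp only: partial_deriv_def)
    moreover have "C_class k (\<lambda>x. real (Suc (Suc k)) * max 0 (f x) ^ Suc k * \<partial> i f x)"
      by (intro C_class_mult C_class_const Suc.IH C_class_partial_deriv[OF Suc.prems i] C_class_Suc_D[OF Suc.prems])
    ultimately show "C_class k (\<partial> i (\<lambda>x. max 0 (f x) ^ Suc (Suc k)))" by presburger
  qed
qed

text \<open>
  Applying the positive-part power twice produces a plateau on both sides: the inner power is at
  least 1 for \<open>|x|\<^sup>2 \<le> s\<close> and 0 for \<open>|x|\<^sup>2 \<ge> t\<close>. Cutoff levels refer to \<open>|x|\<^sup>2\<close>, a polynomial,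
  so that smoothness at the origin is immediate.
\<close>

lemma exterior_cutoff_exists:
  assumes "s < t"
  obtains g :: "'a::euclidean_space \<Rightarrow> real" where "C_class k g" "\<And>x. 0 \<le> g x" "\<And>x. g x \<le> 1"
    "\<And>x. x \<bullet> x \<le> s \<Longrightarrow> g x = 0" "\<And>x. t \<le> x \<bullet> x \<Longrightarrow> g x = 1"
proof -
  define f where "f x = max 0 ((t - (\<Sum>i\<in>Basis. (x \<bullet> i) * (x \<bullet> i))) * (1 / (t - s))) ^ Suc k" for x :: 'a
  define g where "g x = max 0 (1 - f x) ^ Suc k" for x :: 'a
  have f_eq: "f x = max 0 ((t - x \<bullet> x) / (t - s)) ^ Suc k" for x
    by (simp add: f_def euclidean_inner[of x x])
  have f0: "f x \<ge> 0" for x by (simp add: f_def)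
  have "C_class k f" unfolding f_def[abs_def]
    by (rule C_class_pos_part_power) (intro C_class_intros)
  then have "C_class k (\<lambda>x. 1 - f x)"
    by (intro C_class_intros)
  then have "C_class k g" unfolding g_def[abs_def]
    by (rule C_class_pos_part_power)
  moreover have "0 \<le> g x" for x
    unfolding g_def by (intro zero_le_power) simp
  moreover have "g x \<le> 1" for x
    unfolding g_def using f0[of x] by (intro power_le_one) auto
  moreover have "g x = 0" if "x \<bullet> x \<le> s" for x
  proof -
    have "1 \<le> (t - x \<bullet> x) / (t - s)" using that assms by (simp add: field_simps)
    then have "1 ^ Suc k \<le> f x" unfolding f_eq by (intro power_mono) auto
    then show ?thesis by (simp add: g_def)
  qed
  moreover have "g x = 1" if "t \<le> x \<bullet> x" for x
  proof -
    have "(t - x \<bullet> x) / (t - s) \<le> 0" using that assms by (simp add: divide_le_0_iff)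
    then show ?thesis by (simp add: g_def f_eq max_def)
  qed
  ultimately show ?thesis by (rule that)
qed

section \<open>Gradient and Hessian estimates\<close>

definition grad_dot :: "('a::euclidean_space \<Rightarrow> real) \<Rightarrow> ('a \<Rightarrow> real) \<Rightarrow> 'a \<Rightarrow> real"
  where "grad_dot f g x = (\<Sum>i\<in>Basis. \<partial> i f x * \<partial> i g x)"

definition hess_sq :: "('a::euclidean_space \<Rightarrow> real) \<Rightarrow> 'a \<Rightarrow> real"
  where "hess_sq f x = (\<Sum>i\<in>Basis. \<Sum>j\<in>Basis. (\<partial> i (\<partial> j f) x)\<^sup>2)"

lemma grad_dot_self_nonneg: "0 \<le> grad_dot f f x"
  by (simp add: grad_dot_def sum_nonneg)

lemma hess_sq_nonneg: "0 \<le> hess_sq f x"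
  by (simp add: hess_sq_def sum_nonneg)

lemma continuous_on_partial_deriv: "C_class (Suc k) f \<Longrightarrow> i \<in> Basis \<Longrightarrow> continuous_on A (\<partial> i f)"
  by (rule C_class_continuous[OF C_class_partial_deriv])

lemma continuous_on_laplacian: "C_class (Suc (Suc k)) f \<Longrightarrow> continuous_on A (\<Delta> f)"
  by (rule C_class_continuous[OF C_class_laplacian])

lemma continuous_on_grad_dot:
  "C_class (Suc k) f \<Longrightarrow> C_class (Suc l) g \<Longrightarrow> continuous_on A (grad_dot f g)"
  unfolding grad_dot_def[abs_def] by (intro continuous_intros continuous_on_partial_deriv)

lemma continuous_on_hess_sq: "C_class (Suc (Suc k)) f \<Longrightarrow> continuous_on A (hess_sq f)"
  unfolding hess_sq_def[abs_def]
  by (intro continuous_intros continuous_on_partial_deriv C_class_partial_deriv)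

lemma grad_dot_locally_constant:
  "open S \<Longrightarrow> x \<in> S \<Longrightarrow> (\<And>y. y \<in> S \<Longrightarrow> g y = c) \<Longrightarrow> grad_dot f g x = 0"
  unfolding grad_dot_def by (intro sum.neutral ballI) (simp add: partial_deriv_locally_constant[of S])

lemma hess_sq_locally_constant:
  "open S \<Longrightarrow> x \<in> S \<Longrightarrow> (\<And>y. y \<in> S \<Longrightarrow> g y = c) \<Longrightarrow> hess_sq g x = 0"
  unfolding hess_sq_def
  by (intro sum.neutral ballI)
     (simp add: partial_deriv_locally_constant[of S _ g] partial_deriv_locally_constant[of S _ "\<partial> _ g"])

lemma grad_dot_vanishes:
  "(\<And>x. r < norm x \<Longrightarrow> g x = 0) \<Longrightarrow> r < norm x \<Longrightarrow> grad_dot f g x = 0"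
  by (rule grad_dot_locally_constant[OF open_norm_greater[of r]]) auto

lemma hess_sq_vanishes:
  "(\<And>x. r < norm x \<Longrightarrow> g x = 0) \<Longrightarrow> r < norm x \<Longrightarrow> hess_sq g x = 0"
  by (rule hess_sq_locally_constant[OF open_norm_greater[of r]]) auto

lemma laplacian_mult:
  assumes f: "C_class (Suc (Suc k)) f" and g: "C_class (Suc (Suc l)) g"
  shows "\<Delta> (\<lambda>x. f x * g x) x = f x * \<Delta> g x + 2 * grad_dot f g x + g x * \<Delta> f x"
proof -
  have "\<partial> i (\<partial> i (\<lambda>x. f x * g x)) x
      = f x * \<partial> i (\<partial> i g) x + 2 * (\<partial> i f x * \<partial> i g x) + g x * \<partial> i (\<partial> i f) x" if i: "i \<in> Basis" for i
  proof -
    note f' = C_class_partial_deriv[OF f i] and g' = C_class_partial_deriv[OF g i]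
    note f1 = C_class_Suc_D[OF f] and g1 = C_class_Suc_D[OF g]
    have m: "C_class (Suc (min k l)) f" "C_class (Suc (min k l)) g"
      "C_class (Suc (min k l)) (\<partial> i f)" "C_class (Suc (min k l)) (\<partial> i g)"
      using f1 g1 f' g' by (auto elim!: C_class_mono)
    show ?thesis
      unfolding partial_deriv_mult[OF f g]
      by (subst partial_deriv_add[OF C_class_mult[OF m(1,4)] C_class_mult[OF m(3,2)]])
         (simp add: partial_deriv_mult[OF m(1,4)] partial_deriv_mult[OF m(3,2)])
  qed
  then show ?thesis
    by (simp add: laplacian_def grad_dot_def sum.distrib sum_distrib_left)
qed

lemma laplacian_square:
  assumes f: "C_class (Suc (Suc k)) f"
  shows "\<Delta> (\<lambda>x. (f x)\<^sup>2) x = 2 * f x * \<Delta> f x + 2 * grad_dot f f x"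
  using laplacian_mult[OF f f] by (simp add: power2_eq_square)

lemma grad_dot_square_right:
  "C_class (Suc k) g \<Longrightarrow> grad_dot f (\<lambda>x. (g x)\<^sup>2) x = 2 * g x * grad_dot f g x"
  by (simp add: grad_dot_def partial_deriv_power sum_distrib_left mult_ac)

lemma laplacian_partial_deriv:
  fixes u :: "'a::euclidean_space \<Rightarrow> real"
  assumes u: "C_class (Suc (Suc (Suc k))) u" and i: "i \<in> Basis"
  shows "\<Delta> (\<partial> i u) x = \<partial> i (\<Delta> u) x"
proof -
  note ddu = C_class_partial_deriv[OF C_class_partial_deriv[OF u]]
  have "\<partial> j (\<partial> j (\<partial> i u)) x = \<partial> i (\<partial> j (\<partial> j u)) x" if j: "j \<in> Basis" for j
  proof -
    have "\<partial> j (\<partial> i u) = \<partial> i (\<partial> j u)" by (rule ext, rule partial_deriv_commute[OF u j i])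
    then show ?thesis using partial_deriv_commute[OF C_class_partial_deriv[OF u j] j i] by simp
  qed
  moreover have "\<partial> i (\<Delta> u) x = (\<Sum>j\<in>Basis. \<partial> i (\<partial> j (\<partial> j u)) x)"
    unfolding laplacian_def[abs_def] by (subst partial_deriv_sum[of _ k]) (auto intro: ddu)
  ultimately show ?thesis by (simp add: laplacian_def)
qed

lemma laplacian_squared_le:
  fixes f :: "'a::euclidean_space \<Rightarrow> real"
  shows "(\<Delta> f x)\<^sup>2 \<le> real DIM('a) * hess_sq f x"
proof -
  have "(\<Delta> f x)\<^sup>2 \<le> real DIM('a) * (\<Sum>i\<in>Basis. (\<partial> i (\<partial> i f) x)\<^sup>2)"
    unfolding laplacian_def using sum_squared_le_sum_of_squares[of "\<lambda>i. \<partial> i (\<partial> i f) x" Basis]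
    by (simp add: mult.commute)
  also have "\<dots> \<le> real DIM('a) * hess_sq f x"
    unfolding hess_sq_def
    by (intro mult_left_mono sum_mono member_le_sum[where f = "\<lambda>j. (\<partial> _ (\<partial> j f) x)\<^sup>2"]) auto
  finally show ?thesis .
qed

lemma grad_dot_squared_le: "(grad_dot f g x)\<^sup>2 \<le> grad_dot f f x * grad_dot g g x"
  using Cauchy_Schwarz_ineq_sum[of "\<lambda>i. \<partial> i f x" "\<lambda>i. \<partial> i g x" Basis]
  by (simp add: grad_dot_def power2_eq_square)

text \<open>
  The form in which the gradient and Hessian estimates use the divergence theorem: terms of the wrong
  sign are estimated pointwise before integrating.
\<close>

lemma integral_nonpos_of_le_divergence:
  fixes L :: "'a::euclidean_space \<Rightarrow> real"
  assumes L: "continuous_on UNIV L" "\<And>x. r < norm x \<Longrightarrow> L x = 0"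
    and X: "\<And>i. i \<in> Basis \<Longrightarrow> C_class (Suc k) (X i)" "\<And>i x. i \<in> Basis \<Longrightarrow> r < norm x \<Longrightarrow> X i x = 0"
    and le: "\<And>x. L x \<le> (\<Sum>i\<in>Basis. \<partial> i (X i) x)"
  shows "(LINT x|lborel. L x) \<le> 0"
proof -
  have "integrable lborel (\<lambda>x. \<Sum>i\<in>Basis. \<partial> i (X i) x)"
    by (rule integrable_vanishing[of _ r])
       (use X partial_deriv_vanishes[of r "X _"] in \<open>auto intro!: continuous_intros continuous_on_partial_deriv sum.neutral\<close>)
  then have "(LINT x|lborel. L x) \<le> (LINT x|lborel. (\<Sum>i\<in>Basis. \<partial> i (X i) x))"
    by (intro integral_mono integrable_vanishing[OF L] le)
  also have "\<dots> = 0" by (rule integral_divergence_eq_0[OF X])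
  finally show ?thesis .
qed

lemma integral_laplacian_symmetric:
  fixes f g :: "'a::euclidean_space \<Rightarrow> real"
  assumes f: "C_class (Suc (Suc 0)) f" and g: "C_class (Suc (Suc 0)) g" and supp: "\<And>x. r < norm x \<Longrightarrow> g x = 0"
  shows "(LINT x|lborel. \<Delta> f x * g x) = (LINT x|lborel. f x * \<Delta> g x)"
proof -
  note f1 = C_class_Suc_D[OF f] and g1 = C_class_Suc_D[OF g]
  define X where "X i x = \<partial> i f x * g x - f x * \<partial> i g x" for i x
  have "\<partial> i (X i) x = \<partial> i (\<partial> i f) x * g x - f x * \<partial> i (\<partial> i g) x" if i: "i \<in> Basis" for i x
    unfolding X_def using C_class_partial_deriv[OF f i] C_class_partial_deriv[OF g i]
    by (subst partial_deriv_diff[of 0 _ 0])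
       (simp_all add: partial_deriv_mult[of 0 _ 0] C_class_mult f1 g1)
  then have eq: "(\<Sum>i\<in>Basis. \<partial> i (X i) x) = \<Delta> f x * g x - f x * \<Delta> g x" for x
    by (simp add: laplacian_def sum_subtractf sum_distrib_left sum_distrib_right)
  have "(LINT x|lborel. (\<Sum>i\<in>Basis. \<partial> i (X i) x)) = 0"
  proof (rule integral_divergence_eq_0[of 0 _ r])
    show "C_class (Suc 0) (X i)" if "i \<in> Basis" for i
      unfolding X_def using that by (intro C_class_diff C_class_mult f1 g1 C_class_partial_deriv[OF f] C_class_partial_deriv[OF g])
    show "X i x = 0" if "r < norm x" for i x
      using that supp partial_deriv_vanishes[of r g] by (simp add: X_def)
  qed
  moreover have "integrable lborel (\<lambda>x. \<Delta> f x * g x)" "integrable lborel (\<lambda>x. f x * \<Delta> g x)"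
    by (rule integrable_vanishing[of _ r], 
        (intro continuous_intros continuous_on_laplacian[OF f] continuous_on_laplacian[OF g]
          C_class_continuous[OF f] C_class_continuous[OF g]), 
        simp add: supp laplacian_vanishes[of r g])+
  ultimately show ?thesis unfolding eq by simp
qed

text \<open>
  Caccioppoli's inequality: the divergence of \<open>s\<^sup>2 u \<nabla>u\<close> is \<open>s\<^sup>2 |\<nabla>u|\<^sup>2 + s\<^sup>2 u \<Delta>u + 2 s u \<nabla>u \<bullet> \<nabla>s\<close>,
  and half of the first term absorbs the last one.
\<close>

lemma gradient_estimate:
  fixes u s :: "'a::euclidean_space \<Rightarrow> real"
  assumes u: "C_class (Suc (Suc 0)) u" and s: "C_class (Suc 0) s" and supp: "\<And>x. r < norm x \<Longrightarrow> s x = 0"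
  shows "(LINT x|lborel. grad_dot u u x * (s x)\<^sup>2)
    \<le> 2 * (LINT x|lborel. \<bar>u x * \<Delta> u x\<bar> * (s x)\<^sup>2) + 4 * (LINT x|lborel. (u x)\<^sup>2 * grad_dot s s x)"
proof -
  note u1 = C_class_Suc_D[OF u]
  define X where "X i x = (u x * \<partial> i u x) * (s x)\<^sup>2" for i x
  have X: "C_class (Suc 0) (X i)" if "i \<in> Basis" for i
    unfolding X_def using that by (intro C_class_mult C_class_power u1 s C_class_partial_deriv[OF u])
  have dX: "\<partial> i (X i) x = (\<partial> i u x)\<^sup>2 * (s x)\<^sup>2 + u x * \<partial> i (\<partial> i u) x * (s x)\<^sup>2 + 2 * (u x * \<partial> i u x * (s x * \<partial> i s x))"
    if i: "i \<in> Basis" for i x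
    unfolding X_def using C_class_partial_deriv[OF u i]
    by (simp add: partial_deriv_mult[of 0 _ 0] partial_deriv_power[of 0] C_class_mult C_class_power u1 s)
       (simp add: power2_eq_square algebra_simps)
  define A where "A x = grad_dot u u x * (s x)\<^sup>2" for x
  define B where "B x = \<bar>u x * \<Delta> u x\<bar> * (s x)\<^sup>2" for x
  define C where "C x = (u x)\<^sup>2 * grad_dot s s x" for x
  note cont = continuous_on_grad_dot[OF u u] continuous_on_grad_dot[OF s s] continuous_on_laplacian[OF u]
    C_class_continuous[OF u] C_class_continuous[OF s]
  have int: "integrable lborel A" "integrable lborel B" "integrable lborel C"
    unfolding A_def[abs_def] B_def[abs_def] C_def[abs_def]
    by (rule integrable_vanishing[of _ r], intro continuous_intros cont, simp add: supp grad_dot_vanishes[of r s])+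
  have "(LINT x|lborel. (1/2) * A x - B x - 2 * C x) \<le> 0"
  proof (rule integral_nonpos_of_le_divergence[of _ r 0 X])
    show "continuous_on UNIV (\<lambda>x. (1/2) * A x - B x - 2 * C x)"
      unfolding A_def B_def C_def by (intro continuous_intros cont)
    show "(1/2) * A x - B x - 2 * C x = 0" if "r < norm x" for x
      using that by (simp add: A_def B_def C_def supp grad_dot_vanishes[of r s])
    show "X i x = 0" if "r < norm x" for i x using that by (simp add: X_def supp)
    show "(1/2) * A x - B x - 2 * C x \<le> (\<Sum>i\<in>Basis. \<partial> i (X i) x)" for x
    proof -
      have "(1/2) * ((\<partial> i u x)\<^sup>2 * (s x)\<^sup>2) + u x * \<partial> i (\<partial> i u) x * (s x)\<^sup>2 - 2 * ((u x)\<^sup>2 * (\<partial> i s x)\<^sup>2) \<le> \<partial> i (X i) x"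
        if "i \<in> Basis" for i
        using zero_le_power2[of "\<partial> i u x * s x + 2 * u x * \<partial> i s x"]
        by (simp add: dX[OF that] power2_eq_square algebra_simps)
      then have "(\<Sum>i\<in>Basis. (1/2) * ((\<partial> i u x)\<^sup>2 * (s x)\<^sup>2) + u x * \<partial> i (\<partial> i u) x * (s x)\<^sup>2 - 2 * ((u x)\<^sup>2 * (\<partial> i s x)\<^sup>2))
          \<le> (\<Sum>i\<in>Basis. \<partial> i (X i) x)" by (rule sum_mono)
      also have "(\<Sum>i\<in>Basis. (1/2) * ((\<partial> i u x)\<^sup>2 * (s x)\<^sup>2) + u x * \<partial> i (\<partial> i u) x * (s x)\<^sup>2 - 2 * ((u x)\<^sup>2 * (\<partial> i s x)\<^sup>2))
          = (1/2) * A x + (u x * \<Delta> u x) * (s x)\<^sup>2 - 2 * C x"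
        by (simp add: A_def C_def grad_dot_def laplacian_def sum.distrib sum_subtractf sum_distrib_left sum_distrib_right power2_eq_square mult_ac)
      finally have "(1/2) * A x + (u x * \<Delta> u x) * (s x)\<^sup>2 - 2 * C x \<le> (\<Sum>i\<in>Basis. \<partial> i (X i) x)" .
      moreover have "- (u x * \<Delta> u x) * (s x)\<^sup>2 \<le> B x"
        unfolding B_def by (intro mult_right_mono) auto
      ultimately show ?thesis by simp
    qed
  qed (rule X)
  then have "(1/2) * integral\<^sup>L lborel A - integral\<^sup>L lborel B - 2 * integral\<^sup>L lborel C \<le> 0"
    using int by simp
  then show ?thesis by (simp add: A_def[abs_def] B_def[abs_def] C_def[abs_def])
qed

text \<open>
  The previous estimate with every partial derivative of \<open>s\<close> as weight, summed. In this form the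
  weight \<open>|\<nabla>s|\<^sup>2\<close> costs only second derivatives of \<open>s\<close>.
\<close>

lemma gradient_estimate_gradient_weight:
  fixes u s :: "'a::euclidean_space \<Rightarrow> real"
  assumes u: "C_class (Suc (Suc 0)) u" and s: "C_class (Suc (Suc 0)) s" and supp: "\<And>x. r < norm x \<Longrightarrow> s x = 0"
  shows "(LINT x|lborel. grad_dot u u x * grad_dot s s x)
    \<le> 2 * (LINT x|lborel. \<bar>u x * \<Delta> u x\<bar> * grad_dot s s x) + 4 * (LINT x|lborel. (u x)\<^sup>2 * hess_sq s x)"
proof -
  note ds = C_class_partial_deriv[OF s]
  have vds: "\<partial> k s x = 0" if "r < norm x" for k x
    using that supp by (rule partial_deriv_vanishes[rotated])
  note cont = continuous_on_grad_dot[OF u u] continuous_on_grad_dot[OF ds ds] continuous_on_laplacian[OF u]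
    C_class_continuous[OF u] C_class_continuous[OF ds]
  have int: "integrable lborel (\<lambda>x. grad_dot u u x * (\<partial> k s x)\<^sup>2)" "integrable lborel (\<lambda>x. \<bar>u x * \<Delta> u x\<bar> * (\<partial> k s x)\<^sup>2)"
      "integrable lborel (\<lambda>x. (u x)\<^sup>2 * grad_dot (\<partial> k s) (\<partial> k s) x)" if "k \<in> Basis" for k
    by (rule integrable_vanishing[of _ r], intro continuous_intros cont that, simp add: vds grad_dot_vanishes[of r "\<partial> k s"])+
  have "(\<Sum>k\<in>Basis. LINT x|lborel. grad_dot u u x * (\<partial> k s x)\<^sup>2)
      \<le> (\<Sum>k\<in>Basis. 2 * (LINT x|lborel. \<bar>u x * \<Delta> u x\<bar> * (\<partial> k s x)\<^sup>2) + 4 * (LINT x|lborel. (u x)\<^sup>2 * grad_dot (\<partial> k s) (\<partial> k s) x))"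
    by (intro sum_mono gradient_estimate[OF u ds, of _ r] vds)
  also have "\<dots> = 2 * (\<Sum>k\<in>Basis. LINT x|lborel. \<bar>u x * \<Delta> u x\<bar> * (\<partial> k s x)\<^sup>2)
      + 4 * (\<Sum>k\<in>Basis. LINT x|lborel. (u x)\<^sup>2 * grad_dot (\<partial> k s) (\<partial> k s) x)"
    by (simp add: sum.distrib sum_distrib_left)
  also have "(\<Sum>k\<in>Basis. LINT x|lborel. \<bar>u x * \<Delta> u x\<bar> * (\<partial> k s x)\<^sup>2) = (LINT x|lborel. \<bar>u x * \<Delta> u x\<bar> * grad_dot s s x)"
    by (subst Bochner_Integration.integral_sum[symmetric], erule int, simp add: grad_dot_def sum_distrib_left power2_eq_square)
  also have "(\<Sum>k\<in>Basis. LINT x|lborel. (u x)\<^sup>2 * grad_dot (\<partial> k s) (\<partial> k s) x) = (LINT x|lborel. (u x)\<^sup>2 * hess_sq s x)"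
  proof -
    have *: "(\<Sum>k\<in>Basis. grad_dot (\<partial> k s) (\<partial> k s) x) = hess_sq s x" for x
      unfolding hess_sq_def grad_dot_def power2_eq_square by (rule sum.swap)
    show ?thesis
      by (subst Bochner_Integration.integral_sum[symmetric], erule int, simp add: * flip: sum_distrib_left)
  qed
  also have "(\<Sum>k\<in>Basis. LINT x|lborel. grad_dot u u x * (\<partial> k s x)\<^sup>2) = (LINT x|lborel. grad_dot u u x * grad_dot s s x)"
    by (subst Bochner_Integration.integral_sum[symmetric], erule int,
       simp add: grad_dot_def[of s s] sum_distrib_left power2_eq_square)
  finally show ?thesis .
qed

text \<open>
  The Bochner argument: the divergence of \<open>s\<^sup>2 (D\<^sup>2u \<nabla>u - \<Delta>u \<nabla>u)\<close> equals
  \<open>s\<^sup>2 (|D\<^sup>2u|\<^sup>2 - (\<Delta>u)\<^sup>2)\<close> plus terms with \<open>\<nabla>s\<close>, because the third derivatives of \<open>u\<close> cancel. Half of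
  the Hessian term absorbs the mixed terms.
\<close>

lemma hessian_estimate:
  fixes u s :: "'a::euclidean_space \<Rightarrow> real"
  assumes u: "C_class (Suc (Suc (Suc 0))) u" and s: "C_class (Suc 0) s" and supp: "\<And>x. r < norm x \<Longrightarrow> s x = 0"
  shows "(LINT x|lborel. hess_sq u x * (s x)\<^sup>2)
    \<le> 4 * (LINT x|lborel. (\<Delta> u x)\<^sup>2 * (s x)\<^sup>2) + 6 * (LINT x|lborel. grad_dot u u x * grad_dot s s x)"
proof -
  note u2 = C_class_Suc_D[OF u] and u1 = C_class_Suc_D[OF C_class_Suc_D[OF u]]
  note du = C_class_partial_deriv[OF u] and ddu = C_class_partial_deriv[OF C_class_partial_deriv[OF u]]
  note du1 = C_class_Suc_D[OF du] and v = C_class_laplacian[OF u]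
  define X where "X j x = ((\<Sum>i\<in>Basis. \<partial> i u x * \<partial> j (\<partial> i u) x) - \<Delta> u x * \<partial> j u x) * (s x)\<^sup>2" for j x
  have X: "C_class (Suc 0) (X j)" if "j \<in> Basis" for j
    unfolding X_def using that by (intro C_class_intros s du1 ddu v)
  define h where "h x = (\<Sum>i\<in>Basis. \<Sum>j\<in>Basis. \<partial> i u x * \<partial> j (\<partial> i u) x * \<partial> j s x)" for x
  have dX: "\<partial> j (X j) x = ((\<Sum>i\<in>Basis. \<partial> i u x * \<partial> j (\<partial> i u) x) - \<Delta> u x * \<partial> j u x) * (2 * s x * \<partial> j s x)
      + ((\<Sum>i\<in>Basis. \<partial> i u x * \<partial> j (\<partial> j (\<partial> i u)) x + (\<partial> j (\<partial> i u) x)\<^sup>2)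
          - (\<Delta> u x * \<partial> j (\<partial> j u) x + \<partial> j (\<Delta> u) x * \<partial> j u x)) * (s x)\<^sup>2"
    if j: "j \<in> Basis" for j x
  proof -
    have 1: "\<partial> j (\<lambda>x. \<Sum>i\<in>Basis. \<partial> i u x * \<partial> j (\<partial> i u) x) = (\<lambda>x. \<Sum>i\<in>Basis. \<partial> i u x * \<partial> j (\<partial> j (\<partial> i u)) x + (\<partial> j (\<partial> i u) x)\<^sup>2)"
      by (subst partial_deriv_sum[of _ 0])
         (simp_all add: partial_deriv_mult[OF du1 ddu] j C_class_mult[OF du1 ddu] power2_eq_square)
    have 2: "\<partial> j (\<lambda>x. \<Delta> u x * \<partial> j u x) = (\<lambda>x. \<Delta> u x * \<partial> j (\<partial> j u) x + \<partial> j (\<Delta> u) x * \<partial> j u x)"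
      using partial_deriv_mult[OF v du1[OF j]] .
    have c1: "C_class (Suc 0) (\<lambda>x. \<Sum>i\<in>Basis. \<partial> i u x * \<partial> j (\<partial> i u) x)"
      using j by (intro C_class_intros du1 ddu)
    have c2: "C_class (Suc 0) (\<lambda>x. \<Delta> u x * \<partial> j u x)"
      using j by (intro C_class_intros du1 v)
    show ?thesis
      unfolding X_def partial_deriv_mult[OF C_class_diff[OF c1 c2] C_class_power[OF s]]
        partial_deriv_diff[OF c1 c2] 1 2 partial_deriv_power[OF s] by simp
  qed
  define A where "A x = hess_sq u x * (s x)\<^sup>2" for x
  define B where "B x = (\<Delta> u x)\<^sup>2 * (s x)\<^sup>2" for x
  define C where "C x = grad_dot u u x * grad_dot s s x" for x
  have div: "(\<Sum>j\<in>Basis. \<partial> j (X j) x) = A x - B x + 2 * s x * h x - 2 * s x * \<Delta> u x * grad_dot u s x" for x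
  proof -
    \<comment> \<open>commuting derivatives makes the third derivatives of \<open>u\<close> cancel\<close>
    have third: "(\<Sum>j\<in>Basis. \<Sum>i\<in>Basis. \<partial> i u x * \<partial> j (\<partial> j (\<partial> i u)) x) = (\<Sum>j\<in>Basis. \<partial> j (\<Delta> u) x * \<partial> j u x)"
      by (subst sum.swap, rule sum.cong[OF refl])
         (simp add: laplacian_partial_deriv[OF u, symmetric] laplacian_def sum_distrib_left mult.commute)
    have hs: "(\<Sum>j\<in>Basis. \<Sum>i\<in>Basis. (\<partial> j (\<partial> i u) x)\<^sup>2) = hess_sq u x" by (simp add: hess_sq_def)
    have hh: "(\<Sum>j\<in>Basis. (\<Sum>i\<in>Basis. \<partial> i u x * \<partial> j (\<partial> i u) x) * (2 * s x * \<partial> j s x)) = 2 * s x * h x"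
      unfolding h_def sum_distrib_left sum_distrib_right by (subst sum.swap) (simp add: mult_ac)
    have "(\<Sum>j\<in>Basis. \<partial> j (X j) x)
      = (\<Sum>j\<in>Basis. (\<Sum>i\<in>Basis. \<partial> i u x * \<partial> j (\<partial> i u) x) * (2 * s x * \<partial> j s x))
        - (\<Sum>j\<in>Basis. \<Delta> u x * \<partial> j u x * (2 * s x * \<partial> j s x))
        + ((\<Sum>j\<in>Basis. \<Sum>i\<in>Basis. \<partial> i u x * \<partial> j (\<partial> j (\<partial> i u)) x) + (\<Sum>j\<in>Basis. \<Sum>i\<in>Basis. (\<partial> j (\<partial> i u) x)\<^sup>2)
          - (\<Delta> u x * \<Delta> u x + (\<Sum>j\<in>Basis. \<partial> j (\<Delta> u) x * \<partial> j u x))) * (s x)\<^sup>2"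
    proof -
      have l: "(\<Sum>j\<in>Basis. \<Delta> u x * \<partial> j (\<partial> j u) x) = \<Delta> u x * \<Delta> u x"
        by (simp add: sum_distrib_left[symmetric], simp add: laplacian_def)
      have "(\<Sum>j\<in>Basis. \<partial> j (X j) x) = (\<Sum>j\<in>Basis. ((\<Sum>i\<in>Basis. \<partial> i u x * \<partial> j (\<partial> i u) x) * (2 * s x * \<partial> j s x)
          - \<Delta> u x * \<partial> j u x * (2 * s x * \<partial> j s x)) + ((\<Sum>i\<in>Basis. \<partial> i u x * \<partial> j (\<partial> j (\<partial> i u)) x) + (\<Sum>i\<in>Basis. (\<partial> j (\<partial> i u) x)\<^sup>2)
          - (\<Delta> u x * \<partial> j (\<partial> j u) x + \<partial> j (\<Delta> u) x * \<partial> j u x)) * (s x)\<^sup>2)"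
        by (intro sum.cong refl) (simp only: dX sum.distrib left_diff_distrib)
      also have "\<dots> = (\<Sum>j\<in>Basis. (\<Sum>i\<in>Basis. \<partial> i u x * \<partial> j (\<partial> i u) x) * (2 * s x * \<partial> j s x))
        - (\<Sum>j\<in>Basis. \<Delta> u x * \<partial> j u x * (2 * s x * \<partial> j s x))
        + ((\<Sum>j\<in>Basis. \<Sum>i\<in>Basis. \<partial> i u x * \<partial> j (\<partial> j (\<partial> i u)) x) + (\<Sum>j\<in>Basis. \<Sum>i\<in>Basis. (\<partial> j (\<partial> i u) x)\<^sup>2)
          - ((\<Sum>j\<in>Basis. \<Delta> u x * \<partial> j (\<partial> j u) x) + (\<Sum>j\<in>Basis. \<partial> j (\<Delta> u) x * \<partial> j u x))) * (s x)\<^sup>2"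
        by (simp only: sum.distrib sum_subtractf sum_distrib_right[symmetric])
      finally show ?thesis unfolding l .
    qed
    also have "(\<Sum>j\<in>Basis. \<Delta> u x * \<partial> j u x * (2 * s x * \<partial> j s x)) = 2 * s x * \<Delta> u x * grad_dot u s x"
      by (simp add: grad_dot_def sum_distrib_left mult_ac)
    finally show ?thesis
      unfolding third hs hh A_def B_def by (simp add: power2_eq_square algebra_simps)
  qed
  note cont = continuous_on_grad_dot[OF u u] continuous_on_grad_dot[OF s s] continuous_on_laplacian[OF u]
    continuous_on_hess_sq[OF u] C_class_continuous[OF u] C_class_continuous[OF s]
  have int: "integrable lborel A" "integrable lborel B" "integrable lborel C"
    unfolding A_def[abs_def] B_def[abs_def] C_def[abs_def]
    by (rule integrable_vanishing[of _ r], intro continuous_intros cont, simp add: supp grad_dot_vanishes[of r s])+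
  have "(LINT x|lborel. (1/2) * A x - 2 * B x - 3 * C x) \<le> 0"
  proof (rule integral_nonpos_of_le_divergence[of _ r 0 X])
    show "continuous_on UNIV (\<lambda>x. (1/2) * A x - 2 * B x - 3 * C x)"
      unfolding A_def B_def C_def by (intro continuous_intros cont)
    show "(1/2) * A x - 2 * B x - 3 * C x = 0" if "r < norm x" for x
      using that by (simp add: A_def B_def C_def supp grad_dot_vanishes[of r s])
    show "X i x = 0" if "r < norm x" for i x using that by (simp add: X_def supp)
    show "(1/2) * A x - 2 * B x - 3 * C x \<le> (\<Sum>i\<in>Basis. \<partial> i (X i) x)" for x
    proof -
      have "- 2 * s x * (\<partial> i u x * \<partial> j (\<partial> i u) x * \<partial> j s x)
          \<le> (1/2) * ((\<partial> j (\<partial> i u) x)\<^sup>2 * (s x)\<^sup>2) + 2 * ((\<partial> i u x)\<^sup>2 * (\<partial> j s x)\<^sup>2)" for i j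
        using zero_le_power2[of "\<partial> j (\<partial> i u) x * s x + 2 * \<partial> i u x * \<partial> j s x"]
        by (simp add: power2_eq_square algebra_simps)
      then have "(\<Sum>i\<in>Basis. \<Sum>j\<in>Basis. - 2 * s x * (\<partial> i u x * \<partial> j (\<partial> i u) x * \<partial> j s x))
          \<le> (\<Sum>i\<in>Basis. \<Sum>j\<in>Basis. (1/2) * ((\<partial> j (\<partial> i u) x)\<^sup>2 * (s x)\<^sup>2) + 2 * ((\<partial> i u x)\<^sup>2 * (\<partial> j s x)\<^sup>2))"
        by (intro sum_mono)
      also have "\<dots> = (1/2) * ((\<Sum>i\<in>Basis. \<Sum>j\<in>Basis. (\<partial> j (\<partial> i u) x)\<^sup>2) * (s x)\<^sup>2) + 2 * (\<Sum>i\<in>Basis. \<Sum>j\<in>Basis. (\<partial> i u x)\<^sup>2 * (\<partial> j s x)\<^sup>2)"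
        by (simp only: sum.distrib sum_distrib_left[symmetric] sum_distrib_right[symmetric])
      also have "(\<Sum>i\<in>Basis. \<Sum>j\<in>Basis. (\<partial> j (\<partial> i u) x)\<^sup>2) = hess_sq u x"
        unfolding hess_sq_def by (rule sum.swap)
      also have "(\<Sum>i\<in>Basis. \<Sum>j\<in>Basis. (\<partial> i u x)\<^sup>2 * (\<partial> j s x)\<^sup>2) = C x"
        by (simp add: C_def grad_dot_def sum_product power2_eq_square)
      also have "(\<Sum>i\<in>Basis. \<Sum>j\<in>Basis. - 2 * s x * (\<partial> i u x * \<partial> j (\<partial> i u) x * \<partial> j s x)) = - 2 * s x * h x"
        by (simp only: h_def sum_distrib_left)
      finally have 1: "- 2 * s x * h x \<le> (1/2) * A x + 2 * C x" by (simp add: A_def)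
      have "2 * s x * \<Delta> u x * grad_dot u s x \<le> (s x * \<Delta> u x)\<^sup>2 + (grad_dot u s x)\<^sup>2"
        using zero_le_power2[of "s x * \<Delta> u x - grad_dot u s x"] by (simp add: power2_eq_square algebra_simps)
      also have "\<dots> \<le> B x + C x"
        using grad_dot_squared_le[of u s x] by (simp add: B_def C_def power_mult_distrib mult.commute)
      finally show ?thesis using 1 unfolding div by simp
    qed
  qed (rule X)
  then have "(1/2) * integral\<^sup>L lborel A - 2 * integral\<^sup>L lborel B - 3 * integral\<^sup>L lborel C \<le> 0"
    using int by simp
  then show ?thesis by (simp add: A_def[abs_def] B_def[abs_def] C_def[abs_def])
qed

section \<open>Energy of solutions that are stable outside a ball\<close>

definition stable_outside :: "real \<Rightarrow> real \<Rightarrow> real \<Rightarrow> ('a::euclidean_space \<Rightarrow> real) \<Rightarrow> bool"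
  where "stable_outside r a p u \<longleftrightarrow>
    (\<forall>\<phi>\<in>C4_compact_support. (\<forall>x. norm x \<le> r \<longrightarrow> \<phi> x = 0) \<longrightarrow> 0 \<le> I_uu a p u \<phi>)"

lemma C4_compact_supportI:
  assumes "C_class 4 \<phi>" "\<And>x. r < norm x \<Longrightarrow> \<phi> x = 0"
  shows "\<phi> \<in> C4_compact_support"
proof -
  have "{x. \<phi> x \<noteq> 0} \<subseteq> cball 0 r" using assms(2) by (force simp: not_le[symmetric])
  then have "bounded {x. \<phi> x \<noteq> 0}" by (rule bounded_subset[OF bounded_cball])
  with assms(1) show ?thesis by (simp add: C4_compact_support_def)
qed

lemma positive_solution_C_class: "positive_solution a p u \<Longrightarrow> k \<le> 4 \<Longrightarrow> C_class k u"
  unfolding positive_solution_def by (blast intro: C_class_mono)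

text \<open>
  The density of the energy identity; it is the nonlinear part of \<open>I_uu\<close> at \<open>\<phi> = u\<close>, up to the factor \<open>p\<close>.
\<close>

lemma positive_solution_multiplied:
  assumes "positive_solution a p u"
  shows "\<Delta> (\<Delta> u) x * u x = weight a x * u x powr (p + 1)"
proof -
  have "0 < u x" using assms by (simp add: positive_solution_def)
  then have "u x powr (p + 1) = u x powr p * u x" by (simp add: powr_add)
  then show ?thesis using assms by (simp add: positive_solution_def)
qed

lemma powr_diff_one_mult_square:
  fixes t :: real
  assumes "t > 0"
  shows "t powr (p - 1) * t\<^sup>2 = t powr (p + 1)"
proof -
  have "t powr (p - 1) * t powr 2 = t powr (p + 1)" by (simp add: add.commute flip: powr_add)
  then show ?thesis using assms by (simp add: powr_numeral)
qed

lemma continuous_on_nonlinearity: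
  assumes "0 \<le> a" "positive_solution a p u"
  shows "continuous_on A (\<lambda>x. weight a x * u x powr q)"
  using assms C_class_continuous[OF positive_solution_C_class[OF assms(2), of 0]]
  by (intro continuous_on_mult continuous_on_weight continuous_on_powr continuous_on_const)
     (auto simp: positive_solution_def less_imp_neq[symmetric])

text \<open>
  Write \<open>T = 2 \<nabla>u \<bullet> \<nabla>\<psi> + u \<Delta>\<psi>\<close>. Then
  \<open>(\<Delta>(u \<psi>))\<^sup>2 = \<Delta>u \<Delta>(u \<psi>\<^sup>2) + T\<^sup>2 - 2 u \<Delta>u |\<nabla>\<psi>|\<^sup>2\<close>. The first term on the right has the integral
  \<open>\<integral> |x|^a u^(p+1) \<psi>\<^sup>2\<close> by the equation, and stability makes the left-hand side at least \<open>p\<close> times as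
  large. So \<open>p - 1 > 0\<close> copies of this energy are controlled by the remaining terms; \<open>|\<nabla>u|\<^sup>2\<close> is removed
  from them by the gradient estimate and \<open>\<Delta>u\<close> by Young's inequality. The function \<open>j\<close> stands for
  \<open>|\<nabla>\<psi>|\<^sup>2 / |\<psi>|\<close>, which has to be bounded near the zeros of \<open>\<psi>\<close> for the last step.
\<close>

lemma stable_energy_estimate:
  fixes u \<psi> j :: "'a::euclidean_space \<Rightarrow> real"
  assumes a: "0 \<le> a" and p: "1 < p" and sol: "positive_solution a p u" and stab: "stable_outside r\<^sub>0 a p u"
    and \<psi>: "C_class 4 \<psi>" and supp: "\<And>x. r < norm x \<Longrightarrow> \<psi> x = 0" and hole: "\<And>x. norm x \<le> r\<^sub>0 \<Longrightarrow> \<psi> x = 0"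
    and j: "continuous_on UNIV j" "\<And>x. 0 \<le> j x" "\<And>x. r < norm x \<Longrightarrow> j x = 0"
    and grad_le: "\<And>x. grad_dot \<psi> \<psi> x \<le> \<bar>\<psi> x\<bar> * j x"
  defines "C\<^sub>0 \<equiv> 3 * (32 + 2 * real DIM('a)) / (p - 1) + 128 + 8 * real DIM('a)"
  shows "(LINT x|lborel. weight a x * u x powr (p + 1) * (\<psi> x)\<^sup>2) + (LINT x|lborel. (\<Delta> u x)\<^sup>2 * (\<psi> x)\<^sup>2)
    \<le> (2 * C\<^sub>0 + C\<^sub>0\<^sup>2) * (LINT x|lborel. (u x)\<^sup>2 * (hess_sq \<psi> x + (j x)\<^sup>2))"
proof -
  define N where "N = real DIM('a)"
  have N: "N \<ge> 0" by (simp add: N_def)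
  have pos: "u x > 0" for x using sol by (simp add: positive_solution_def)
  note uk = positive_solution_C_class[OF sol]
  have u2: "C_class (Suc (Suc 0)) u" and v2: "C_class (Suc (Suc 0)) (\<Delta> u)"
    using uk C_class_laplacian[of "Suc (Suc 0)" u] uk[of "Suc (Suc (Suc (Suc 0)))"] by simp_all
  have \<psi>2: "C_class (Suc (Suc 0)) \<psi>" using \<psi> by (rule C_class_mono) simp
  have \<psi>sq: "C_class (Suc (Suc 0)) (\<lambda>x. (\<psi> x)\<^sup>2)" using \<psi>2 by (rule C_class_power)
  note u\<psi> = C_class_mult[OF u2 \<psi>2] and u\<psi>sq = C_class_mult[OF u2 \<psi>sq]
  define P where "P x = weight a x * u x powr (p + 1)" for x
  define q where "q = grad_dot \<psi> \<psi>"
  define T where "T x = 2 * grad_dot u \<psi> x + u x * \<Delta> \<psi> x" for x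
  note vanish = supp grad_dot_vanishes[of r \<psi>, OF supp] laplacian_vanishes[of r \<psi>, OF supp] hess_sq_vanishes[of r \<psi>, OF supp]
  have cP: "continuous_on A P" for A unfolding P_def by (rule continuous_on_nonlinearity[OF a sol])
  note cont = cP continuous_on_grad_dot[OF u2 u2] continuous_on_grad_dot[OF \<psi>2 \<psi>2] continuous_on_grad_dot[OF u2 \<psi>2]
    continuous_on_laplacian[OF u2] continuous_on_laplacian[OF \<psi>2] continuous_on_laplacian[OF u\<psi>] 
    continuous_on_laplacian[OF u\<psi>sq] continuous_on_hess_sq[OF \<psi>2]
    C_class_continuous[OF u2] C_class_continuous[OF \<psi>2] j(1)
  have lap: "\<Delta> (\<lambda>x. u x * \<psi> x) x = T x + \<psi> x * \<Delta> u x" for x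
    by (simp add: laplacian_mult[OF u2 \<psi>2] T_def)
  have lap2: "\<Delta> (\<lambda>x. u x * (\<psi> x)\<^sup>2) x = u x * (2 * \<psi> x * \<Delta> \<psi> x + 2 * q x) + 4 * \<psi> x * grad_dot u \<psi> x + (\<psi> x)\<^sup>2 * \<Delta> u x" for x
    by (simp add: laplacian_mult[OF u2 \<psi>sq] laplacian_square[OF \<psi>2] grad_dot_square_right[OF \<psi>2] q_def)
  define fQ where "fQ x = P x * (\<psi> x)\<^sup>2" for x
  define fV where "fV x = (\<Delta> u x)\<^sup>2 * (\<psi> x)\<^sup>2" for x
  define fS where "fS x = (\<Delta> (\<lambda>x. u x * \<psi> x) x)\<^sup>2" for x
  define fR where "fR x = \<Delta> u x * \<Delta> (\<lambda>x. u x * (\<psi> x)\<^sup>2) x" for x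
  define fT where "fT x = (T x)\<^sup>2" for x
  define fW where "fW x = \<bar>u x * \<Delta> u x\<bar> * q x" for x
  define fG where "fG x = grad_dot u u x * q x" for x
  define fZ where "fZ x = (u x)\<^sup>2 * hess_sq \<psi> x" for x
  define fJ where "fJ x = (u x)\<^sup>2 * (j x)\<^sup>2" for x
  note defs = fQ_def[abs_def] fV_def[abs_def] fS_def[abs_def] fR_def[abs_def] fT_def[abs_def] fW_def[abs_def]
    fG_def[abs_def] fZ_def[abs_def] fJ_def[abs_def]
  have int: "integrable lborel fQ" "integrable lborel fV" "integrable lborel fS" "integrable lborel fR" "integrable lborel fT"
    "integrable lborel fW" "integrable lborel fG" "integrable lborel fZ" "integrable lborel fJ"
    unfolding defs T_def q_def
    by (rule integrable_vanishing[of _ r], intro continuous_intros cont,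
        simp add: vanish j(3) laplacian_vanishes[of r "\<lambda>x. u x * \<psi> x"] laplacian_vanishes[of r "\<lambda>x. u x * (\<psi> x)\<^sup>2"])+
  have stability: "p * integral\<^sup>L lborel fQ \<le> integral\<^sup>L lborel fS"
  proof -
    have "(\<lambda>x. u x * \<psi> x) \<in> C4_compact_support"
      by (rule C4_compact_supportI[of _ r]) (simp_all add: C_class_mult uk \<psi> supp)
    with stab have "0 \<le> I_uu a p u (\<lambda>x. u x * \<psi> x)"
      unfolding stable_outside_def using hole by simp
    moreover have "weight a x * u x powr (p - 1) * (u x * \<psi> x)\<^sup>2 = fQ x" for x
      using powr_diff_one_mult_square[OF pos[of x], of p] by (simp add: fQ_def P_def power_mult_distrib)
    ultimately show ?thesis by (simp add: I_uu_def fS_def[abs_def])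
  qed
  have green: "integral\<^sup>L lborel fQ = integral\<^sup>L lborel fR"
  proof -
    have "fQ x = \<Delta> (\<Delta> u) x * (u x * (\<psi> x)\<^sup>2)" for x
      using positive_solution_multiplied[OF sol, of x] by (simp add: fQ_def P_def mult.assoc[symmetric])
    then have "integral\<^sup>L lborel fQ = (LINT x|lborel. \<Delta> (\<Delta> u) x * (u x * (\<psi> x)\<^sup>2))" by (metis (no_types, lifting) ext)
    also have "\<dots> = integral\<^sup>L lborel fR"
      unfolding fR_def[abs_def] by (rule integral_laplacian_symmetric[OF v2 u\<psi>sq, of r]) (simp add: supp)
    finally show ?thesis .
  qed
  have "integral\<^sup>L lborel fS \<le> (LINT x|lborel. fR x + fT x + 2 * fW x)"
  proof (rule integral_mono)
    show "fS x \<le> fR x + fT x + 2 * fW x" for x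
    proof -
      have "fS x = fR x + fT x - 2 * (u x * \<Delta> u x) * q x"
        unfolding fS_def fR_def fT_def lap lap2 by (simp add: T_def power2_eq_square algebra_simps)
      moreover have "- (u x * \<Delta> u x) * q x \<le> fW x"
        unfolding fW_def q_def by (intro mult_right_mono grad_dot_self_nonneg) simp
      ultimately show ?thesis by (simp add: mult_ac)
    qed
  qed (use int in auto)
  then have S: "integral\<^sup>L lborel fS \<le> integral\<^sup>L lborel fQ + integral\<^sup>L lborel fT + 2 * integral\<^sup>L lborel fW"
    using int green by simp
  have "integral\<^sup>L lborel fT \<le> (LINT x|lborel. 8 * fG x + 2 * N * fZ x)"
  proof (rule integral_mono)
    show "fT x \<le> 8 * fG x + 2 * N * fZ x" for x
    proof -
      have "fT x \<le> 8 * (grad_dot u \<psi> x)\<^sup>2 + 2 * ((u x)\<^sup>2 * (\<Delta> \<psi> x)\<^sup>2)"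
        unfolding fT_def T_def using zero_le_power2[of "2 * grad_dot u \<psi> x - u x * \<Delta> \<psi> x"]
        by (simp add: power2_eq_square algebra_simps)
      also have "\<dots> \<le> 8 * fG x + 2 * ((u x)\<^sup>2 * (N * hess_sq \<psi> x))"
        unfolding fG_def q_def N_def using grad_dot_squared_le[of u \<psi> x] laplacian_squared_le[of \<psi> x]
        by (intro add_mono mult_left_mono) auto
      finally show ?thesis by (simp add: fZ_def mult_ac)
    qed
  qed (use int in auto)
  then have T: "integral\<^sup>L lborel fT \<le> 8 * integral\<^sup>L lborel fG + 2 * N * integral\<^sup>L lborel fZ"
    using int by simp
  have G: "integral\<^sup>L lborel fG \<le> 2 * integral\<^sup>L lborel fW + 4 * integral\<^sup>L lborel fZ"
    unfolding fG_def[abs_def] fW_def[abs_def] fZ_def[abs_def] q_def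
    by (rule gradient_estimate_gradient_weight[OF u2 \<psi>2 supp])
  have "integral\<^sup>L lborel fV \<le> (LINT x|lborel. 2 * fS x + 2 * fT x)"
  proof (rule integral_mono)
    show "fV x \<le> 2 * fS x + 2 * fT x" for x
      unfolding fV_def fS_def fT_def lap using zero_le_power2[of "2 * T x + \<psi> x * \<Delta> u x"]
      by (simp add: power2_eq_square algebra_simps)
  qed (use int in auto)
  then have V: "integral\<^sup>L lborel fV \<le> 2 * integral\<^sup>L lborel fS + 2 * integral\<^sup>L lborel fT"
    using int by simp
  have C0: "0 \<le> C\<^sub>0" using p N by (simp add: C\<^sub>0_def N_def)
  have W0: "0 \<le> integral\<^sup>L lborel fW" "0 \<le> integral\<^sup>L lborel fZ" "0 \<le> integral\<^sup>L lborel fQ" "0 \<le> integral\<^sup>L lborel fJ"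
    by (auto intro!: Bochner_Integration.integral_nonneg mult_nonneg_nonneg weight_nonneg
        simp: fW_def fZ_def fQ_def fJ_def P_def q_def grad_dot_self_nonneg hess_sq_nonneg)
  have C0_bound: "integral\<^sup>L lborel fQ + integral\<^sup>L lborel fV \<le> C\<^sub>0 * (integral\<^sup>L lborel fW + integral\<^sup>L lborel fZ)"
  proof -
    define w where "w = integral\<^sup>L lborel fW + integral\<^sup>L lborel fZ"
    have w0: "0 \<le> N * integral\<^sup>L lborel fW" using W0 N by simp
    have "(p - 1) * integral\<^sup>L lborel fQ \<le> (32 + 2 * N) * w"
      using stability S T G W0 w0 by (simp add: w_def algebra_simps)
    then have "integral\<^sup>L lborel fQ \<le> (32 + 2 * N) / (p - 1) * w"
      using p by (simp add: field_simps)
    moreover have "integral\<^sup>L lborel fV \<le> 2 * integral\<^sup>L lborel fQ + (128 + 8 * N) * w"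
      using V S T G W0 w0 by (simp add: w_def algebra_simps)
    ultimately have "integral\<^sup>L lborel fQ + integral\<^sup>L lborel fV \<le> 3 * ((32 + 2 * N) / (p - 1) * w) + (128 + 8 * N) * w" by simp
    also have "\<dots> = C\<^sub>0 * w" by (simp add: C\<^sub>0_def N_def algebra_simps add_divide_distrib)
    finally show ?thesis by (simp add: w_def)
  qed
  have "(LINT x|lborel. C\<^sub>0 * fW x) \<le> (LINT x|lborel. (1/2) * fV x + C\<^sub>0\<^sup>2 / 2 * fJ x)"
  proof (rule integral_mono)
    show "C\<^sub>0 * fW x \<le> (1/2) * fV x + C\<^sub>0\<^sup>2 / 2 * fJ x" for x
    proof -
      have "fW x \<le> \<bar>u x * \<Delta> u x\<bar> * (\<bar>\<psi> x\<bar> * j x)"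
        unfolding fW_def q_def by (intro mult_left_mono grad_le) simp
      then have "C\<^sub>0 * fW x \<le> C\<^sub>0 * (\<bar>u x * \<Delta> u x\<bar> * (\<bar>\<psi> x\<bar> * j x))" using C0 by (rule mult_left_mono)
      also have "\<dots> = (\<bar>\<Delta> u x\<bar> * \<bar>\<psi> x\<bar>) * (C\<^sub>0 * \<bar>u x\<bar> * j x)" by (simp add: abs_mult)
      also have "\<dots> \<le> (1/2) * (\<bar>\<Delta> u x\<bar> * \<bar>\<psi> x\<bar>)\<^sup>2 + (1/2) * (C\<^sub>0 * \<bar>u x\<bar> * j x)\<^sup>2"
        using zero_le_power2[of "\<bar>\<Delta> u x\<bar> * \<bar>\<psi> x\<bar> - C\<^sub>0 * \<bar>u x\<bar> * j x"] unfolding power2_diff by linarith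
      finally show ?thesis by (simp add: fV_def fJ_def power_mult_distrib mult.assoc)
    qed
  qed (use int in auto)
  then have "C\<^sub>0 * integral\<^sup>L lborel fW \<le> (1/2) * integral\<^sup>L lborel fV + C\<^sub>0\<^sup>2 / 2 * integral\<^sup>L lborel fJ"
    using int by simp
  with C0_bound have "integral\<^sup>L lborel fQ + integral\<^sup>L lborel fV \<le> 2 * C\<^sub>0 * integral\<^sup>L lborel fZ + C\<^sub>0\<^sup>2 * integral\<^sup>L lborel fJ"
    using W0 by (simp add: algebra_simps)
  also have "\<dots> \<le> (2 * C\<^sub>0 + C\<^sub>0\<^sup>2) * (integral\<^sup>L lborel fZ + integral\<^sup>L lborel fJ)"
    using W0 C0 by (simp add: algebra_simps)
  also have "integral\<^sup>L lborel fZ + integral\<^sup>L lborel fJ = (LINT x|lborel. (u x)\<^sup>2 * (hess_sq \<psi> x + (j x)\<^sup>2))"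
    using int by (simp add: distrib_left fZ_def[abs_def] fJ_def[abs_def])
  finally show ?thesis by (simp add: fQ_def[abs_def] fV_def[abs_def] P_def)
qed

text \<open>
  Young's inequality by cases. With \<open>y = t \<eta>^(4/(p-1))\<close>, the left-hand side is absorbed if
  \<open>y^(p-1) \<ge> 2 L\<close>. Otherwise \<open>y\<close> is bounded, and the condition on \<open>m\<close> says that \<open>t\<^sup>2 \<eta>^(2m-4) \<le> y\<^sup>2\<close>.
\<close>

lemma absorb_square:
  fixes t \<eta> L p :: real
  assumes t: "0 < t" and \<eta>: "0 \<le> \<eta>" "\<eta> \<le> 1" and L: "0 \<le> L" and p: "1 < p" and m: "2 < m" "2 + 4 / (p - 1) \<le> real m"
  shows "L * (t\<^sup>2 * \<eta> ^ (2 * m - 4)) \<le> t powr (p + 1) * \<eta> ^ (2 * m) / 2 + L * (2 * L) powr (2 / (p - 1))"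
proof (cases "\<eta> = 0")
  case True
  with m show ?thesis using L by (simp add: power_0_left)
next
  case False
  with \<eta> have \<eta>0: "\<eta> > 0" by simp
  define y where "y = t * \<eta> powr (4 / (p - 1))"
  have y0: "y > 0" using t \<eta>0 by (simp add: y_def)
  have yp: "y powr (p - 1) = t powr (p - 1) * \<eta> ^ 4"
  proof -
    have "4 / (p - 1) * (p - 1) = 4" using p by (intro nonzero_eq_divide_eq[THEN iffD1]) auto
    then show ?thesis using t \<eta>0 unfolding y_def by (simp only: powr_mult powr_powr powr_numeral)
  qed
  have m4: "\<eta> ^ (2 * m) = \<eta> ^ 4 * \<eta> ^ (2 * m - 4)"
    using m by (simp flip: power_add)
  have rhs: "0 \<le> t powr (p + 1) * \<eta> ^ (2 * m) / 2" "0 \<le> L * (2 * L) powr (2 / (p - 1))"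
    using t \<eta>0 L by simp_all
  show ?thesis
  proof (cases "2 * L \<le> y powr (p - 1)")
    case True
    have "L * (t\<^sup>2 * \<eta> ^ (2 * m - 4)) \<le> (y powr (p - 1) / 2) * (t\<^sup>2 * \<eta> ^ (2 * m - 4))"
      using True \<eta>0 by (intro mult_right_mono) auto
    also have "\<dots> = (t powr (p - 1) * t\<^sup>2) * \<eta> ^ (2 * m) / 2"
      unfolding yp m4 by simp
    finally show ?thesis using rhs unfolding powr_diff_one_mult_square[OF t] by linarith
  next
    case False
    then have "y powr (p - 1) < 2 * L" by simp
    then have "(y powr (p - 1)) powr (2 / (p - 1)) \<le> (2 * L) powr (2 / (p - 1))"
      using p by (intro powr_mono2) auto
    moreover have "(p - 1) * (2 / (p - 1)) = 2" using p by (simp only: times_divide_eq_right) (rule nonzero_mult_div_cancel_left, simp)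
    ultimately have y2: "y\<^sup>2 \<le> (2 * L) powr (2 / (p - 1))"
      using y0 by (simp only: powr_powr) (simp add: powr_numeral)
    have "\<eta> ^ (2 * m - 4) = \<eta> powr real (2 * m - 4)" using \<eta>0 by (simp add: powr_realpow)
    also have "\<dots> \<le> \<eta> powr (8 / (p - 1))"
      using m \<eta> \<eta>0 by (intro powr_mono') (auto simp: of_nat_diff field_simps)
    also have "\<dots> = (\<eta> powr (4 / (p - 1)))\<^sup>2"
      using \<eta>0 by (simp add: power2_eq_square flip: powr_add)
    finally have "t\<^sup>2 * \<eta> ^ (2 * m - 4) \<le> y\<^sup>2"
      by (simp add: y_def power_mult_distrib mult_left_mono)
    with y2 have "L * (t\<^sup>2 * \<eta> ^ (2 * m - 4)) \<le> L * (2 * L) powr (2 / (p - 1))"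
      using L by (intro mult_left_mono) auto
    with rhs show ?thesis by linarith
  qed
qed


text \<open>
  For \<open>\<psi> = \<eta>^m\<close> every term of the weight in \<open>stable_energy_estimate\<close> contains the factor \<open>\<eta>^(2m-4)\<close>,
  so for large \<open>m\<close> the square \<open>u\<^sup>2\<close> is absorbed by \<open>u^(p+1)\<close> at the price of a constant. Neither \<open>m\<close> nor \<open>C\<close> depends on \<open>u\<close>.
\<close>

lemma annular_energy_bound:
  fixes \<eta> :: "'a::euclidean_space \<Rightarrow> real"
  assumes a: "0 \<le> a" and p: "1 < p" and \<eta>: "C_class 4 \<eta>" "\<And>x. 0 \<le> \<eta> x" "\<And>x. \<eta> x \<le> 1"
    and supp: "\<And>x. r < norm x \<Longrightarrow> \<eta> x = 0" and hole: "\<And>x. norm x \<le> 1 \<Longrightarrow> \<eta> x = 0"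
  shows "\<exists>m C. 0 < m \<and> (\<forall>u. positive_solution a p u \<longrightarrow> stable_outside 1 a p u \<longrightarrow>
    (LINT x|lborel. (weight a x * u x powr (p + 1) + (\<Delta> u x)\<^sup>2) * \<eta> x ^ (2 * m)) \<le> C)"
proof -
  obtain m :: nat where m: "2 < m" "2 + 4 / (p - 1) \<le> real m"
  proof -
    obtain m :: nat where "max 3 (2 + 4 / (p - 1)) \<le> real m" using real_arch_simple by blast
    then show ?thesis by (intro that[of m]) auto
  qed
  have \<eta>2: "C_class (Suc (Suc 0)) \<eta>" using \<eta>(1) by (rule C_class_mono) simp
  note \<eta>1 = C_class_Suc_D[OF \<eta>2]
  define \<psi> where "\<psi> x = \<eta> x ^ m" for x
  define j where "j x = (real m)\<^sup>2 * \<eta> x ^ (m - 2) * grad_dot \<eta> \<eta> x" for x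
  have \<psi>: "C_class 4 \<psi>" unfolding \<psi>_def by (rule C_class_power[OF \<eta>(1)])
  obtain B where B: "0 \<le> B" "\<And>x. grad_dot \<eta> \<eta> x \<le> B" "\<And>x. hess_sq \<eta> x \<le> B"
  proof -
    obtain B1 where "0 \<le> B1" "\<And>x. \<bar>grad_dot \<eta> \<eta> x\<bar> \<le> B1"
      using bounded_vanishing[OF continuous_on_grad_dot[OF \<eta>1 \<eta>1], of r] grad_dot_vanishes[of r \<eta>] supp by blast
    moreover obtain B2 where "0 \<le> B2" "\<And>x. \<bar>hess_sq \<eta> x\<bar> \<le> B2"
      using bounded_vanishing[OF continuous_on_hess_sq[OF \<eta>2], of r] hess_sq_vanishes[of r \<eta>] supp by blast
    ultimately show ?thesis by (intro that[of "max B1 B2"]) (auto intro: order_trans[OF abs_ge_self] simp: le_max_iff_disj)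
  qed
  have d\<psi>: "\<partial> i \<psi> = (\<lambda>x. real m * \<eta> x ^ (m - 1) * \<partial> i \<eta> x)" for i
    unfolding \<psi>_def by (rule partial_deriv_power[OF \<eta>1])
  have dd\<psi>: "\<partial> i (\<partial> k \<psi>) x = real m * \<eta> x ^ (m - 1) * \<partial> i (\<partial> k \<eta>) x
      + real m * (real (m - 1) * \<eta> x ^ (m - 2)) * (\<partial> i \<eta> x * \<partial> k \<eta> x)" if k: "k \<in> Basis" for i k x
  proof -
    have "\<partial> i (\<lambda>x. (real m * \<eta> x ^ (m - 1)) * \<partial> k \<eta> x) x
      = real m * \<eta> x ^ (m - 1) * \<partial> i (\<partial> k \<eta>) x + \<partial> i (\<lambda>x. real m * \<eta> x ^ (m - 1)) x * \<partial> k \<eta> x"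
      using partial_deriv_mult[OF C_class_cmult[OF C_class_power[OF \<eta>1]] C_class_partial_deriv[OF \<eta>2 k]] by simp
    also have "\<partial> i (\<lambda>x. real m * \<eta> x ^ (m - 1)) x = real m * (real (m - 1) * \<eta> x ^ (m - 2) * \<partial> i \<eta> x)"
      using partial_deriv_cmult[OF C_class_power[OF \<eta>1]] partial_deriv_power[OF \<eta>1, of i "m - 1"]
      by (simp add: numeral_2_eq_2)
    finally show ?thesis unfolding d\<psi> by (simp add: mult_ac)
  qed
  have grad\<psi>: "grad_dot \<psi> \<psi> x = \<psi> x * j x" for x
  proof -
    have "m - 1 + (m - 1) = m + (m - 2)" using m by simp
    then have e: "\<eta> x ^ (m - 1) * \<eta> x ^ (m - 1) = \<eta> x ^ m * \<eta> x ^ (m - 2)" by (simp only: flip: power_add)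
    have "grad_dot \<psi> \<psi> x = (real m)\<^sup>2 * (\<eta> x ^ (m - 1) * \<eta> x ^ (m - 1)) * grad_dot \<eta> \<eta> x"
      unfolding grad_dot_def d\<psi> by (simp add: sum_distrib_left power2_eq_square mult_ac)
    then show ?thesis unfolding e by (simp add: \<psi>_def j_def mult_ac)
  qed
  define K where "K = 3 * real m ^ 4 * B\<^sup>2 + 2 * (real m)\<^sup>2 * B"
  have K: "0 \<le> K" using B(1) by (simp add: K_def)
  have weight_le: "hess_sq \<psi> x + (j x)\<^sup>2 \<le> K * \<eta> x ^ (2 * m - 4)" for x
  proof -
    define h where "h = \<eta> x ^ (m - 2)"
    have "(m - 2) * 2 = 2 * m - 4" by simp
    then have h2: "h\<^sup>2 = \<eta> x ^ (2 * m - 4)" unfolding h_def power_mult[symmetric] by simp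
    have h: "0 \<le> h" using \<eta>(2) by (simp add: h_def)
    have "m - 1 = Suc (m - 2)" using m by simp
    then have m1: "\<eta> x ^ (m - 1) = \<eta> x * h" by (simp add: h_def)
    have "(\<partial> i (\<partial> k \<psi>) x)\<^sup>2 \<le> 2 * (real m)\<^sup>2 * h\<^sup>2 * (\<partial> i (\<partial> k \<eta>) x)\<^sup>2 + 2 * real m ^ 4 * h\<^sup>2 * ((\<partial> i \<eta> x)\<^sup>2 * (\<partial> k \<eta> x)\<^sup>2)"
      if k: "k \<in> Basis" for i k
    proof -
      define A1 where "A1 = real m * (\<eta> x * h) * \<partial> i (\<partial> k \<eta>) x"
      define A2 where "A2 = real m * (real (m - 1) * h) * (\<partial> i \<eta> x * \<partial> k \<eta> x)"
      have "(\<partial> i (\<partial> k \<psi>) x)\<^sup>2 = (A1 + A2)\<^sup>2" unfolding dd\<psi>[OF k] m1 A1_def A2_def h_def by simp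
      also have "\<dots> \<le> 2 * A1\<^sup>2 + 2 * A2\<^sup>2"
        using zero_le_power2[of "A1 - A2"] by (simp add: power2_eq_square algebra_simps)
      also have "A1\<^sup>2 \<le> (real m)\<^sup>2 * h\<^sup>2 * (\<partial> i (\<partial> k \<eta>) x)\<^sup>2"
      proof -
        have "(\<eta> x)\<^sup>2 \<le> 1" using \<eta> by (simp add: power_le_one)
        then have "((real m)\<^sup>2 * h\<^sup>2 * (\<partial> i (\<partial> k \<eta>) x)\<^sup>2) * (\<eta> x)\<^sup>2 \<le> (real m)\<^sup>2 * h\<^sup>2 * (\<partial> i (\<partial> k \<eta>) x)\<^sup>2"
          by (intro mult_left_le) auto
        then show ?thesis by (simp add: A1_def power_mult_distrib mult_ac)
      qed
      also have "A2\<^sup>2 \<le> real m ^ 4 * h\<^sup>2 * ((\<partial> i \<eta> x)\<^sup>2 * (\<partial> k \<eta> x)\<^sup>2)"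
      proof -
        have sq: "(real (m - 1))\<^sup>2 \<le> (real m)\<^sup>2" by (intro power_mono) auto
        have "A2\<^sup>2 = (real (m - 1))\<^sup>2 * ((real m)\<^sup>2 * h\<^sup>2 * ((\<partial> i \<eta> x)\<^sup>2 * (\<partial> k \<eta> x)\<^sup>2))"
          by (simp only: A2_def power_mult_distrib mult_ac)
        also have "\<dots> \<le> (real m)\<^sup>2 * ((real m)\<^sup>2 * h\<^sup>2 * ((\<partial> i \<eta> x)\<^sup>2 * (\<partial> k \<eta> x)\<^sup>2))"
          by (rule mult_right_mono[OF sq]) simp
        also have "\<dots> = ((real m)\<^sup>2 * (real m)\<^sup>2) * h\<^sup>2 * ((\<partial> i \<eta> x)\<^sup>2 * (\<partial> k \<eta> x)\<^sup>2)"
          by (simp only: mult.assoc)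
        also have "(real m)\<^sup>2 * (real m)\<^sup>2 = real m ^ 4" by (simp flip: power_add)
        finally show ?thesis .
      qed
      finally show ?thesis by (simp add: mult.assoc)
    qed
    then have "hess_sq \<psi> x \<le> (\<Sum>i\<in>Basis. \<Sum>k\<in>Basis. 2 * (real m)\<^sup>2 * h\<^sup>2 * (\<partial> i (\<partial> k \<eta>) x)\<^sup>2 + 2 * real m ^ 4 * h\<^sup>2 * ((\<partial> i \<eta> x)\<^sup>2 * (\<partial> k \<eta> x)\<^sup>2))"
      unfolding hess_sq_def by (intro sum_mono)
    also have "\<dots> = 2 * (real m)\<^sup>2 * h\<^sup>2 * hess_sq \<eta> x + 2 * real m ^ 4 * h\<^sup>2 * (\<Sum>i\<in>Basis. \<Sum>k\<in>Basis. (\<partial> i \<eta> x)\<^sup>2 * (\<partial> k \<eta> x)\<^sup>2)"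
      by (simp only: sum.distrib sum_distrib_left[symmetric] hess_sq_def)
    also have "(\<Sum>i\<in>Basis. \<Sum>k\<in>Basis. (\<partial> i \<eta> x)\<^sup>2 * (\<partial> k \<eta> x)\<^sup>2) = (grad_dot \<eta> \<eta> x)\<^sup>2"
      by (simp add: grad_dot_def sum_product power2_eq_square)
    finally have H: "hess_sq \<psi> x \<le> 2 * (real m)\<^sup>2 * h\<^sup>2 * hess_sq \<eta> x + 2 * real m ^ 4 * h\<^sup>2 * (grad_dot \<eta> \<eta> x)\<^sup>2" .
    have J: "(j x)\<^sup>2 = real m ^ 4 * h\<^sup>2 * (grad_dot \<eta> \<eta> x)\<^sup>2"
      by (simp add: j_def h_def power_mult_distrib flip: power_mult)
    have "(grad_dot \<eta> \<eta> x)\<^sup>2 \<le> B\<^sup>2" using B grad_dot_self_nonneg by (intro power_mono) auto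
    then have "3 * real m ^ 4 * h\<^sup>2 * (grad_dot \<eta> \<eta> x)\<^sup>2 \<le> 3 * real m ^ 4 * h\<^sup>2 * B\<^sup>2"
      by (intro mult_left_mono) auto
    moreover have "2 * (real m)\<^sup>2 * h\<^sup>2 * hess_sq \<eta> x \<le> 2 * (real m)\<^sup>2 * h\<^sup>2 * B"
      using B by (intro mult_left_mono) auto
    ultimately have "hess_sq \<psi> x + (j x)\<^sup>2 \<le> K * h\<^sup>2"
      using H J by (simp add: K_def algebra_simps)
    then show ?thesis by (simp add: h2)
  qed
  \<comment> \<open>the constant of \<open>stable_energy_estimate\<close>\<close>
  define C\<^sub>0 where "C\<^sub>0 = 3 * (32 + 2 * real DIM('a)) / (p - 1) + 128 + 8 * real DIM('a)"
  have C0: "0 \<le> C\<^sub>0" using p by (simp add: C\<^sub>0_def)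
  define L where "L = (2 * C\<^sub>0 + C\<^sub>0\<^sup>2) * K"
  have L: "0 \<le> L" using C0 K by (simp add: L_def)
  define M where "M = L * (2 * L) powr (2 / (p - 1))"
  define V where "V = (LINT x|lborel. M * indicator (cball (0::'a) r) x)"
  have \<psi>0: "\<psi> x = 0" if "r < norm x \<or> norm x \<le> 1" for x
    using that supp hole m by (auto simp: \<psi>_def)
  have main: "(LINT x|lborel. (weight a x * u x powr (p + 1) + (\<Delta> u x)\<^sup>2) * \<eta> x ^ (2 * m)) \<le> 2 * V"
    if sol: "positive_solution a p u" and stab: "stable_outside 1 a p u" for u
  proof -
    have pos: "u x > 0" for x using sol by (simp add: positive_solution_def)
    have u2: "C_class (Suc (Suc 0)) u" using positive_solution_C_class[OF sol] by simp
    define Q where "Q x = weight a x * u x powr (p + 1) * (\<psi> x)\<^sup>2" for x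
    define W where "W x = (\<Delta> u x)\<^sup>2 * (\<psi> x)\<^sup>2" for x
    have cQ: "continuous_on UNIV Q" unfolding Q_def
      by (intro continuous_intros continuous_on_nonlinearity[OF a sol] C_class_continuous[OF \<psi>])
    have cW: "continuous_on UNIV W" unfolding W_def
      by (intro continuous_intros continuous_on_laplacian[OF u2] C_class_continuous[OF \<psi>])
    have int: "integrable lborel Q" "integrable lborel W"
      by (rule integrable_vanishing[OF cQ, of r], simp add: Q_def \<psi>0) (rule integrable_vanishing[OF cW, of r], simp add: W_def \<psi>0)
    have cj: "continuous_on UNIV j" unfolding j_def
      by (intro continuous_intros continuous_on_grad_dot[OF \<eta>1 \<eta>1] C_class_continuous[OF \<eta>1])
    have j0: "0 \<le> j x" for x using \<eta>(2) by (simp add: j_def grad_dot_self_nonneg)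
    have jv: "j x = 0" if "r < norm x" for x using grad_dot_vanishes[of r \<eta> x] supp that by (simp add: j_def)
    have \<psi>2: "C_class (Suc (Suc 0)) \<psi>" using \<psi> by (rule C_class_mono) simp
    have "integral\<^sup>L lborel Q + integral\<^sup>L lborel W \<le> (2 * C\<^sub>0 + C\<^sub>0\<^sup>2) * (LINT x|lborel. (u x)\<^sup>2 * (hess_sq \<psi> x + (j x)\<^sup>2))"
      unfolding Q_def[abs_def] W_def[abs_def] C\<^sub>0_def
      by (rule stable_energy_estimate[OF a p sol stab \<psi> _ _ cj j0 jv]) (auto simp: grad\<psi> j0 \<psi>0 intro: mult_right_mono)
    also have "\<dots> = (LINT x|lborel. (2 * C\<^sub>0 + C\<^sub>0\<^sup>2) * ((u x)\<^sup>2 * (hess_sq \<psi> x + (j x)\<^sup>2)))"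
      by simp
    also have "\<dots> \<le> (LINT x|lborel. (1/2) * Q x + M * indicator (cball 0 r) x)"
    proof (rule integral_mono)
      show "integrable lborel (\<lambda>x. (2 * C\<^sub>0 + C\<^sub>0\<^sup>2) * ((u x)\<^sup>2 * (hess_sq \<psi> x + (j x)\<^sup>2)))"
        by (rule integrable_vanishing[of _ r])
           (intro continuous_intros C_class_continuous[OF u2] continuous_on_hess_sq[OF \<psi>2] cj,
            simp add: jv hess_sq_vanishes[of r \<psi>] \<psi>0)
      show "integrable lborel (\<lambda>x. (1/2) * Q x + M * indicator (cball 0 r) x)"
        using int(1) emeasure_lborel_cball_finite[of "0::'a" r]
        by (intro Bochner_Integration.integrable_add integrable_mult_right integrable_real_indicator) auto
      show "(2 * C\<^sub>0 + C\<^sub>0\<^sup>2) * ((u x)\<^sup>2 * (hess_sq \<psi> x + (j x)\<^sup>2)) \<le> (1/2) * Q x + M * indicator (cball 0 r) x" for x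
      proof (cases "r < norm x")
        case True
        then show ?thesis by (simp add: jv hess_sq_vanishes[of r \<psi>] \<psi>0 Q_def)
      next
        case False
        have "(2 * C\<^sub>0 + C\<^sub>0\<^sup>2) * ((u x)\<^sup>2 * (hess_sq \<psi> x + (j x)\<^sup>2)) \<le> (2 * C\<^sub>0 + C\<^sub>0\<^sup>2) * ((u x)\<^sup>2 * (K * \<eta> x ^ (2 * m - 4)))"
          using C0 by (intro mult_left_mono weight_le) auto
        also have "\<dots> = L * ((u x)\<^sup>2 * \<eta> x ^ (2 * m - 4))" by (simp add: L_def)
        also have "\<dots> \<le> u x powr (p + 1) * \<eta> x ^ (2 * m) / 2 + M"
          unfolding M_def by (rule absorb_square[OF pos \<eta>(2,3) L p m])
        also have "u x powr (p + 1) * \<eta> x ^ (2 * m) \<le> Q x"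
        proof (cases "norm x \<le> 1")
          case True
          then show ?thesis using hole m by (simp add: Q_def \<psi>_def power_0_left)
        next
          case False
          then have "1 * u x powr (p + 1) \<le> weight a x * u x powr (p + 1)"
            by (intro mult_right_mono weight_ge_1 a) auto
          then have "u x powr (p + 1) * \<eta> x ^ (2 * m) \<le> weight a x * u x powr (p + 1) * \<eta> x ^ (2 * m)"
            using \<eta>(2)[of x] by (intro mult_right_mono) auto
          then show ?thesis by (simp add: Q_def \<psi>_def mult.commute[of 2] power_mult)
        qed
        finally show ?thesis using False by (simp add: indicator_def)
      qed
    qed
    also have "\<dots> = (1/2) * integral\<^sup>L lborel Q + V"
      unfolding V_def using int(1) emeasure_lborel_cball_finite[of "0::'a" r]
      by (subst Bochner_Integration.integral_add) (auto intro!: integrable_mult_right integrable_real_indicator)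
    finally have "integral\<^sup>L lborel Q + integral\<^sup>L lborel W \<le> (1/2) * integral\<^sup>L lborel Q + V" .
    moreover have "0 \<le> integral\<^sup>L lborel W" by (rule Bochner_Integration.integral_nonneg) (simp add: W_def)
    ultimately have "integral\<^sup>L lborel Q + integral\<^sup>L lborel W \<le> 2 * V" by simp
    moreover have "(LINT x|lborel. (weight a x * u x powr (p + 1) + (\<Delta> u x)\<^sup>2) * \<eta> x ^ (2 * m)) = (LINT x|lborel. Q x + W x)"
      by (simp add: Q_def W_def \<psi>_def distrib_right mult.commute[of 2] power_mult)
    ultimately show ?thesis using int by simp
  qed
  then show ?thesis using m(1) by (intro exI[of _ m] exI[of _ "2 * V"]) auto
qed

section \<open>Bounds on an annulus\<close>

lemma integral_weighted_le:
  fixes f g k \<rho> :: "'a::euclidean_space \<Rightarrow> real"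
  assumes f: "continuous_on UNIV f" "\<And>x. 0 \<le> f x" and \<rho>: "continuous_on UNIV \<rho>" "\<And>x. r < norm x \<Longrightarrow> \<rho> x = 0"
    and k: "continuous_on UNIV k" "\<And>x. r < norm x \<Longrightarrow> k x = 0" "\<And>x. k x \<le> K * \<rho> x" and K: "0 \<le> K"
    and le: "(LINT x|lborel. f x * \<rho> x) \<le> C"
  shows "(LINT x|lborel. f x * k x) \<le> K * C"
proof -
  have "(LINT x|lborel. f x * k x) \<le> (LINT x|lborel. K * (f x * \<rho> x))"
  proof (rule integral_mono)
    show "integrable lborel (\<lambda>x. f x * k x)"
      by (rule integrable_vanishing[of _ r]) (intro continuous_intros f k, simp add: k(2))
    show "integrable lborel (\<lambda>x. K * (f x * \<rho> x))"
      by (rule integrable_vanishing[of _ r]) (intro continuous_intros f \<rho>, simp add: \<rho>(2))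
    show "f x * k x \<le> K * (f x * \<rho> x)" for x
      using mult_left_mono[OF k(3) f(2), of x x] by (simp add: mult_ac)
  qed
  also have "\<dots> \<le> K * C" using le K by (simp add: mult_left_mono)
  finally show ?thesis .
qed

text \<open>
  The energy bound is applied with a cutoff \<open>\<eta>\<close> that equals 1 on the support of \<open>\<sigma>\<close>; there it controls
  \<open>u\<^sup>2\<close>, \<open>(\<Delta>u)\<^sup>2\<close> and \<open>|x|^a u^(p+1)\<close> against any bounded weight. The gradient and Hessian estimates
  with weights built from \<open>\<sigma>\<close> then supply the remaining two terms.
\<close>

lemma annular_bounds:
  fixes \<sigma> :: "'a::euclidean_space \<Rightarrow> real"
  assumes a: "0 \<le> a" and p: "1 < p" and \<sigma>: "C_class (Suc (Suc 0)) \<sigma>"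
    and supp: "\<And>x::'a. x \<bullet> x < 2 \<or> 7 < x \<bullet> x \<Longrightarrow> \<sigma> x = 0"
  shows "\<exists>C. \<forall>u. positive_solution a p u \<longrightarrow> stable_outside 1 a p u \<longrightarrow>
    (LINT x|lborel. ((u x)\<^sup>2 + (\<Delta> u x)\<^sup>2 + weight a x * u x powr (p + 1) + grad_dot u u x + hess_sq u x) * (\<sigma> x)\<^sup>2) \<le> C"
proof -
  have norm_iff: "norm x \<le> r \<longleftrightarrow> x \<bullet> x \<le> r\<^sup>2" if "0 \<le> r" for x :: 'a and r
    using that by (simp add: norm_le_square)
  have norm_3: "9 < x \<bullet> x" if "3 < norm x" for x :: 'a
    using that norm_iff[of 3 x] by simp
  obtain g1 :: "'a \<Rightarrow> real" where g1: "C_class 4 g1" "\<And>x. 0 \<le> g1 x" "\<And>x. g1 x \<le> 1"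
    "\<And>x. x \<bullet> x \<le> 1 \<Longrightarrow> g1 x = 0" "\<And>x. 2 \<le> x \<bullet> x \<Longrightarrow> g1 x = 1"
    by (rule exterior_cutoff_exists[of 1 2 4]) auto
  obtain g2 :: "'a \<Rightarrow> real" where g2: "C_class 4 g2" "\<And>x. 0 \<le> g2 x" "\<And>x. g2 x \<le> 1"
    "\<And>x. x \<bullet> x \<le> 7 \<Longrightarrow> g2 x = 0" "\<And>x. 8 \<le> x \<bullet> x \<Longrightarrow> g2 x = 1"
    by (rule exterior_cutoff_exists[of 7 8 4]) auto
  define \<eta> where "\<eta> x = g1 x * (1 - g2 x)" for x
  have \<eta>: "C_class 4 \<eta>" "\<And>x. 0 \<le> \<eta> x" "\<And>x. \<eta> x \<le> 1"
    unfolding \<eta>_def using g1 g2 by (auto intro!: C_class_intros mult_le_one)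
  have \<eta>0: "\<eta> x = 0" if "3 < norm x \<or> norm x \<le> 1" for x
    using that g2(5)[of x] g1(4)[of x] norm_3[of x] norm_iff[of 1 x] by (auto simp: \<eta>_def)
  have \<eta>1: "\<eta> x = 1" if "2 \<le> x \<bullet> x" "x \<bullet> x \<le> 7" for x
    using that g1(5) g2(4) by (simp add: \<eta>_def)
  obtain m C where m: "0 < m" and C: "\<And>u. positive_solution a p u \<Longrightarrow> stable_outside 1 a p u \<Longrightarrow>
    (LINT x|lborel. (weight a x * u x powr (p + 1) + (\<Delta> u x)\<^sup>2) * \<eta> x ^ (2 * m)) \<le> C"
    using annular_energy_bound[OF a p \<eta>, of 3] \<eta>0 by auto
  define \<rho> where "\<rho> x = \<eta> x ^ (2 * m)" for x
  have c\<rho>: "continuous_on A \<rho>" for A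
    unfolding \<rho>_def by (intro continuous_intros C_class_continuous[OF \<eta>(1)])
  have \<rho>: "0 \<le> \<rho> x" for x using \<eta>(2) by (simp add: \<rho>_def)
  have \<rho>0: "\<rho> x = 0" if "3 < norm x \<or> norm x \<le> 1" for x using that \<eta>0 m by (simp add: \<rho>_def power_0_left)
  have \<rho>1: "\<rho> x = 1" if "2 \<le> x \<bullet> x" "x \<bullet> x \<le> 7" for x using \<eta>1[OF that] by (simp add: \<rho>_def)
  have int\<rho>: "integrable lborel \<rho>" by (rule integrable_vanishing[OF c\<rho>, of 3]) (simp add: \<rho>0)
  define C' where "C' = integral\<^sup>L lborel \<rho> + 2 * C"
  \<comment> \<open>the part of the density that is bounded without integration by parts\<close>
  define b where "b u x = (u x)\<^sup>2 + (\<Delta> u x)\<^sup>2 + weight a x * u x powr (p + 1)" for u :: "'a \<Rightarrow> real" and x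
  note \<sigma>1 = C_class_Suc_D[OF \<sigma>]
  have op: "open {x::'a. x \<bullet> x < 2 \<or> 7 < x \<bullet> x}"
    by (intro open_Collect_disj open_Collect_less continuous_intros)
  have supp_d: "grad_dot \<sigma> \<sigma> x = 0" "hess_sq \<sigma> x = 0" if "x \<bullet> x < 2 \<or> 7 < x \<bullet> x" for x
    using that supp by (auto intro!: grad_dot_locally_constant[OF op] hess_sq_locally_constant[OF op])
  note vanish = supp[OF disjI2] supp_d[OF disjI2]
  have out: "7 < x \<bullet> x" if "3 < norm x" for x :: 'a using norm_3[OF that] by simp
  obtain K where K: "0 \<le> K" "\<And>x. (\<sigma> x)\<^sup>2 \<le> K" "\<And>x. grad_dot \<sigma> \<sigma> x \<le> K" "\<And>x. hess_sq \<sigma> x \<le> K"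
  proof -
    have c: "continuous_on UNIV (\<lambda>x. (\<sigma> x)\<^sup>2 + grad_dot \<sigma> \<sigma> x + hess_sq \<sigma> x)"
      by (intro continuous_intros C_class_continuous[OF \<sigma>] continuous_on_grad_dot[OF \<sigma> \<sigma>] continuous_on_hess_sq[OF \<sigma>])
    obtain K where K: "0 \<le> K" "\<And>x. \<bar>(\<sigma> x)\<^sup>2 + grad_dot \<sigma> \<sigma> x + hess_sq \<sigma> x\<bar> \<le> K"
      using bounded_vanishing[OF c, of 3] out vanish by auto
    have "(\<sigma> x)\<^sup>2 \<le> K \<and> grad_dot \<sigma> \<sigma> x \<le> K \<and> hess_sq \<sigma> x \<le> K" for x
      using K(2)[of x] grad_dot_self_nonneg[of \<sigma> x] hess_sq_nonneg[of \<sigma> x] zero_le_power2[of "\<sigma> x"] by linarith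
    with K(1) that show ?thesis by blast
  qed
  have le\<rho>: "k x \<le> K * \<rho> x" if "k x \<le> K" "\<And>x. x \<bullet> x < 2 \<or> 7 < x \<bullet> x \<Longrightarrow> k x = 0" for k x
    using that(1) that(2)[of x] \<rho>[of x] \<rho>1[of x] K(1) by (cases "x \<bullet> x < 2 \<or> 7 < x \<bullet> x") auto
  define Q where "Q = K * C'"
  have main: "(LINT x|lborel. (b u x + grad_dot u u x + hess_sq u x) * (\<sigma> x)\<^sup>2) \<le> 47 * Q"
    if sol: "positive_solution a p u" and stab: "stable_outside 1 a p u" for u
  proof -
    have pos: "u x > 0" for x using sol by (simp add: positive_solution_def)
    have u3: "C_class (Suc (Suc (Suc 0))) u" using positive_solution_C_class[OF sol] by simp
    note u2 = C_class_Suc_D[OF u3]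
    note cont = continuous_on_nonlinearity[OF a sol] C_class_continuous[OF u3] continuous_on_laplacian[OF u3]
      continuous_on_grad_dot[OF u3 u3] continuous_on_hess_sq[OF u3] C_class_continuous[OF \<sigma>]
      continuous_on_grad_dot[OF \<sigma> \<sigma>] continuous_on_hess_sq[OF \<sigma>]
    have b0: "0 \<le> b u x" for x
      unfolding b_def by (intro add_nonneg_nonneg mult_nonneg_nonneg weight_nonneg) auto
    have cb: "continuous_on UNIV (b u)" unfolding b_def by (intro continuous_intros cont)
    \<comment> \<open>where \<open>\<rho> \<noteq> 0\<close> the weight is at least 1, so \<open>u\<^sup>2 \<le> 1 + u^(p+1)\<close> is controlled by the energy\<close>
    have "(LINT x|lborel. b u x * \<rho> x) \<le> C'"
    proof -
      define e where "e x = (weight a x * u x powr (p + 1) + (\<Delta> u x)\<^sup>2) * \<rho> x" for x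
      have e: "integrable lborel e"
        unfolding e_def[abs_def] by (rule integrable_vanishing[of _ 3]) (intro continuous_intros cont c\<rho>, simp add: \<rho>0)
      have "(LINT x|lborel. b u x * \<rho> x) \<le> (LINT x|lborel. \<rho> x + 2 * e x)"
      proof (rule integral_mono)
        show "integrable lborel (\<lambda>x. b u x * \<rho> x)"
          by (rule integrable_vanishing[of _ 3]) (intro continuous_intros cb c\<rho>, simp add: \<rho>0)
        show "integrable lborel (\<lambda>x. \<rho> x + 2 * e x)" using int\<rho> e by simp
        show "b u x * \<rho> x \<le> \<rho> x + 2 * e x" for x
        proof (cases "norm x \<le> 1")
          case False
          define P where "P = weight a x * u x powr (p + 1)"
          have w: "u x powr (p + 1) \<le> P" unfolding P_def
            using mult_right_mono[OF weight_ge_1[OF a, of x], of "u x powr (p + 1)"] False by simp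
          have sq: "(u x)\<^sup>2 \<le> 1 + u x powr (p + 1)"
          proof (cases "u x \<le> 1")
            case True
            then have "(u x)\<^sup>2 \<le> 1" using pos[of x] by (simp add: power_le_one)
            then show ?thesis by (simp add: add_increasing2)
          next
            case False
            then have "u x powr 2 \<le> u x powr (p + 1)" using p by (intro powr_mono) auto
            then show ?thesis using pos[of x] by (simp add: powr_numeral)
          qed
          have "s + d + P \<le> 1 + 2 * (P + d)" if "s \<le> 1 + t" "t \<le> P" "0 \<le> d" for s t d :: real
            using that by simp
          from this[OF sq w zero_le_power2[of "\<Delta> u x"]]
          have "b u x \<le> 1 + 2 * (P + (\<Delta> u x)\<^sup>2)" unfolding b_def P_def[symmetric] .
          then have "b u x * \<rho> x \<le> (1 + 2 * (P + (\<Delta> u x)\<^sup>2)) * \<rho> x" using \<rho> by (intro mult_right_mono)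
          then show ?thesis by (simp add: e_def P_def algebra_simps)
        qed (simp add: \<rho>0 e_def)
      qed
      also have "\<dots> = integral\<^sup>L lborel \<rho> + 2 * integral\<^sup>L lborel e" using int\<rho> e by simp
      also have "\<dots> \<le> C'" using C[OF sol stab] by (simp add: C'_def e_def[abs_def] \<rho>_def)
      finally show ?thesis .
    qed
    note wle = integral_weighted_le[OF cb b0 c\<rho> _ _ _ _ K(1) this, of 3]
    have b\<sigma>: "(LINT x|lborel. b u x * (\<sigma> x)\<^sup>2) \<le> Q"
      unfolding Q_def by (rule wle) (auto intro!: continuous_intros cont le\<rho> K simp: \<rho>0 supp out)
    have bg: "(LINT x|lborel. b u x * grad_dot \<sigma> \<sigma> x) \<le> Q"
      unfolding Q_def by (rule wle) (auto intro!: continuous_intros cont le\<rho> K simp: \<rho>0 supp_d out)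
    have bh: "(LINT x|lborel. b u x * hess_sq \<sigma> x) \<le> Q"
      unfolding Q_def by (rule wle) (auto intro!: continuous_intros cont le\<rho> K simp: \<rho>0 supp_d out)
    have uv_b: "\<bar>u x * \<Delta> u x\<bar> \<le> b u x" "(u x)\<^sup>2 \<le> b u x" "(\<Delta> u x)\<^sup>2 \<le> b u x" for x
    proof -
      have P: "0 \<le> weight a x * u x powr (p + 1)" by (intro mult_nonneg_nonneg weight_nonneg) auto
      show "(u x)\<^sup>2 \<le> b u x" "(\<Delta> u x)\<^sup>2 \<le> b u x" using P by (simp_all add: b_def)
      have "2 * \<bar>u x * \<Delta> u x\<bar> \<le> (u x)\<^sup>2 + (\<Delta> u x)\<^sup>2"
        using sum_squares_bound[of "\<bar>u x\<bar>" "\<bar>\<Delta> u x\<bar>"] by (simp add: abs_mult)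
      then show "\<bar>u x * \<Delta> u x\<bar> \<le> b u x" using P abs_ge_zero[of "u x * \<Delta> u x"] unfolding b_def by simp
    qed
    have leb: "(LINT x|lborel. f x * k x) \<le> Q"
      if f: "continuous_on UNIV f" "\<And>x. f x \<le> b u x" and k: "continuous_on UNIV k" "\<And>x. 0 \<le> k x" "\<And>x. 7 < x \<bullet> x \<Longrightarrow> k x = 0"
        and bk: "(LINT x|lborel. b u x * k x) \<le> Q" for f k
    proof -
      have "(LINT x|lborel. f x * k x) \<le> (LINT x|lborel. b u x * k x)"
      proof (rule integral_mono)
        show "integrable lborel (\<lambda>x. f x * k x)"
          by (rule integrable_vanishing[of _ 3]) (intro continuous_intros f k, simp add: k(3) out)
        show "integrable lborel (\<lambda>x. b u x * k x)"
          by (rule integrable_vanishing[of _ 3]) (intro continuous_intros cb k, simp add: k(3) out)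
        show "f x * k x \<le> b u x * k x" for x by (rule mult_right_mono[OF f(2) k(2)])
      qed
      with bk show ?thesis by linarith
    qed
    have c\<sigma>2: "continuous_on UNIV (\<lambda>x. (\<sigma> x)\<^sup>2)" by (intro continuous_intros cont)
    have cuv: "continuous_on UNIV (\<lambda>x. \<bar>u x * \<Delta> u x\<bar>)" "continuous_on UNIV (\<lambda>x. (u x)\<^sup>2)" "continuous_on UNIV (\<lambda>x. (\<Delta> u x)\<^sup>2)"
      by (intro continuous_intros cont)+
    note gr = grad_dot_self_nonneg hess_sq_nonneg
    have \<sigma>3: "\<sigma> x = 0" if "3 < norm x" for x using out[OF that] supp by simp
    have G1: "(LINT x|lborel. grad_dot u u x * (\<sigma> x)\<^sup>2) \<le> 6 * Q"
    proof -
      have "(LINT x|lborel. grad_dot u u x * (\<sigma> x)\<^sup>2)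
          \<le> 2 * (LINT x|lborel. \<bar>u x * \<Delta> u x\<bar> * (\<sigma> x)\<^sup>2) + 4 * (LINT x|lborel. (u x)\<^sup>2 * grad_dot \<sigma> \<sigma> x)"
        by (rule gradient_estimate[OF u2 \<sigma>1 \<sigma>3])
      moreover have "(LINT x|lborel. \<bar>u x * \<Delta> u x\<bar> * (\<sigma> x)\<^sup>2) \<le> Q"
        by (rule leb[OF cuv(1) uv_b(1) c\<sigma>2 _ _ b\<sigma>]) (auto simp: supp)
      moreover have "(LINT x|lborel. (u x)\<^sup>2 * grad_dot \<sigma> \<sigma> x) \<le> Q"
        by (rule leb[OF cuv(2) uv_b(2) _ _ _ bg]) (auto simp: supp_d gr intro: cont)
      ultimately show ?thesis by linarith
    qed
    have G2: "(LINT x|lborel. grad_dot u u x * grad_dot \<sigma> \<sigma> x) \<le> 6 * Q"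
    proof -
      have "(LINT x|lborel. grad_dot u u x * grad_dot \<sigma> \<sigma> x)
          \<le> 2 * (LINT x|lborel. \<bar>u x * \<Delta> u x\<bar> * grad_dot \<sigma> \<sigma> x) + 4 * (LINT x|lborel. (u x)\<^sup>2 * hess_sq \<sigma> x)"
        by (rule gradient_estimate_gradient_weight[OF u2 \<sigma> \<sigma>3])
      moreover have "(LINT x|lborel. \<bar>u x * \<Delta> u x\<bar> * grad_dot \<sigma> \<sigma> x) \<le> Q"
        by (rule leb[OF cuv(1) uv_b(1) _ _ _ bg]) (auto simp: supp_d gr intro: cont)
      moreover have "(LINT x|lborel. (u x)\<^sup>2 * hess_sq \<sigma> x) \<le> Q"
        by (rule leb[OF cuv(2) uv_b(2) _ _ _ bh]) (auto simp: supp_d gr intro: cont)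
      ultimately show ?thesis by linarith
    qed
    have H: "(LINT x|lborel. hess_sq u x * (\<sigma> x)\<^sup>2) \<le> 40 * Q"
    proof -
      have D: "(LINT x|lborel. (\<Delta> u x)\<^sup>2 * (\<sigma> x)\<^sup>2) \<le> Q"
        by (rule leb[OF cuv(3) uv_b(3) c\<sigma>2 _ _ b\<sigma>]) (auto simp: supp)
      have "(LINT x|lborel. hess_sq u x * (\<sigma> x)\<^sup>2)
          \<le> 4 * (LINT x|lborel. (\<Delta> u x)\<^sup>2 * (\<sigma> x)\<^sup>2) + 6 * (LINT x|lborel. grad_dot u u x * grad_dot \<sigma> \<sigma> x)"
        by (rule hessian_estimate[OF u3 \<sigma>1 \<sigma>3])
      then show ?thesis using D G2 by linarith
    qed
    have int: "integrable lborel (\<lambda>x. b u x * (\<sigma> x)\<^sup>2)" "integrable lborel (\<lambda>x. grad_dot u u x * (\<sigma> x)\<^sup>2)"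
      "integrable lborel (\<lambda>x. hess_sq u x * (\<sigma> x)\<^sup>2)"
      by (rule integrable_vanishing[of _ 3], intro continuous_intros cont cb, simp add: \<sigma>3)+
    have KC: "0 \<le> Q"
    proof -
      have "0 \<le> (LINT x|lborel. b u x * (\<sigma> x)\<^sup>2)" by (intro Bochner_Integration.integral_nonneg) (simp add: b0)
      with b\<sigma> show ?thesis by linarith
    qed
    have "(LINT x|lborel. (b u x + grad_dot u u x + hess_sq u x) * (\<sigma> x)\<^sup>2)
      = (LINT x|lborel. b u x * (\<sigma> x)\<^sup>2) + (LINT x|lborel. grad_dot u u x * (\<sigma> x)\<^sup>2) + (LINT x|lborel. hess_sq u x * (\<sigma> x)\<^sup>2)"
      using int by (simp add: distrib_right)
    also have "\<dots> \<le> 47 * Q"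
      using b\<sigma> G1 H KC by linarith
    finally show ?thesis .
  qed
  then show ?thesis unfolding b_def by blast
qed

section \<open>The Pohozaev identity\<close>

definition radial_deriv :: "('a::euclidean_space \<Rightarrow> real) \<Rightarrow> 'a \<Rightarrow> real"
  where "radial_deriv f x = (\<Sum>i\<in>Basis. (x \<bullet> i) * \<partial> i f x)"

lemma radial_deriv_mult:
  "C_class (Suc k) f \<Longrightarrow> C_class (Suc l) g \<Longrightarrow>
    radial_deriv (\<lambda>x. f x * g x) x = f x * radial_deriv g x + radial_deriv f x * g x"
  by (simp add: radial_deriv_def partial_deriv_mult sum.distrib sum_distrib_left sum_distrib_right algebra_simps)

lemma C_class_radial_deriv: "C_class (Suc k) f \<Longrightarrow> C_class k (radial_deriv f)"
  unfolding radial_deriv_def[abs_def] by (intro C_class_intros C_class_partial_deriv)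

lemma radial_deriv_squared_le: "(radial_deriv f x)\<^sup>2 \<le> (x \<bullet> x) * grad_dot f f x"
  using Cauchy_Schwarz_ineq_sum[of "\<lambda>i. x \<bullet> i" "\<lambda>i. \<partial> i f x" Basis]
  by (simp add: radial_deriv_def grad_dot_def power2_eq_square euclidean_inner[of x x])

lemma partial_deriv_radial_deriv:
  assumes f: "C_class (Suc (Suc k)) f" and i: "i \<in> Basis"
  shows "\<partial> i (radial_deriv f) = (\<lambda>x. \<partial> i f x + radial_deriv (\<partial> i f) x)"
proof
  fix x :: 'a
  note df = C_class_partial_deriv[OF f]
  have "\<partial> i (radial_deriv f) x = (\<Sum>j\<in>Basis. (x \<bullet> j) * \<partial> i (\<partial> j f) x + (i \<bullet> j) * \<partial> j f x)"
    unfolding radial_deriv_def[abs_def]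
    by (subst partial_deriv_sum[of _ k])
       (simp_all add: C_class_mult[OF C_class_inner df] partial_deriv_mult[OF C_class_inner df] partial_deriv_inner)
  also have "\<dots> = (\<Sum>j\<in>Basis. (x \<bullet> j) * \<partial> j (\<partial> i f) x) + (\<Sum>j\<in>Basis. (i \<bullet> j) * \<partial> j f x)"
    using partial_deriv_commute[OF f i] by (simp add: sum.distrib)
  also have "(\<Sum>j\<in>Basis. (i \<bullet> j) * \<partial> j f x) = \<partial> i f x"
    using i by (simp add: inner_Basis if_distrib[of "\<lambda>t. t * _"] cong: if_cong)
  finally show "\<partial> i (radial_deriv f) x = \<partial> i f x + radial_deriv (\<partial> i f) x"
    unfolding radial_deriv_def[of "\<partial> i f" x] by simp
qed

text \<open>
  The commutator of the Laplacian with the generator of dilations.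
\<close>

lemma laplacian_radial_deriv:
  assumes f: "C_class (Suc (Suc (Suc k))) f"
  shows "\<Delta> (radial_deriv f) x = 2 * \<Delta> f x + radial_deriv (\<Delta> f) x"
proof -
  note df = C_class_partial_deriv[OF f]
  have "\<partial> i (\<partial> i (radial_deriv f)) x = 2 * \<partial> i (\<partial> i f) x + radial_deriv (\<partial> i (\<partial> i f)) x" if i: "i \<in> Basis" for i
    unfolding partial_deriv_radial_deriv[OF f i]
    using partial_deriv_add[OF df[OF i] C_class_radial_deriv[OF df[OF i]], of i]
      partial_deriv_radial_deriv[OF df[OF i] i] by simp
  then have "\<Delta> (radial_deriv f) x = 2 * \<Delta> f x + (\<Sum>i\<in>Basis. radial_deriv (\<partial> i (\<partial> i f)) x)"
    by (simp add: laplacian_def sum.distrib sum_distrib_left)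
  also have "(\<Sum>i\<in>Basis. radial_deriv (\<partial> i (\<partial> i f)) x) = radial_deriv (\<Delta> f) x"
    unfolding radial_deriv_def laplacian_def[abs_def]
    by (subst sum.swap) (simp add: partial_deriv_sum[of _ k] C_class_partial_deriv[OF df] sum_distrib_left)
  finally show ?thesis .
qed

lemma grad_dot_radial_deriv_self_le:
  assumes f: "C_class (Suc (Suc k)) f"
  shows "grad_dot (radial_deriv f) (radial_deriv f) x \<le> 2 * grad_dot f f x + 2 * ((x \<bullet> x) * hess_sq f x)"
proof -
  have "\<partial> i (radial_deriv f) x * \<partial> i (radial_deriv f) x
      \<le> 2 * (\<partial> i f x * \<partial> i f x) + 2 * ((x \<bullet> x) * grad_dot (\<partial> i f) (\<partial> i f) x)" if i: "i \<in> Basis" for i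
  proof -
    have "\<partial> i (radial_deriv f) x * \<partial> i (radial_deriv f) x = (\<partial> i f x + radial_deriv (\<partial> i f) x)\<^sup>2"
      by (simp add: partial_deriv_radial_deriv[OF f i] power2_eq_square)
    also have "\<dots> \<le> 2 * (\<partial> i f x * \<partial> i f x) + 2 * (radial_deriv (\<partial> i f) x)\<^sup>2"
      using zero_le_power2[of "\<partial> i f x - radial_deriv (\<partial> i f) x"] by (simp add: power2_eq_square algebra_simps)
    finally show ?thesis using radial_deriv_squared_le[of "\<partial> i f" x] by simp
  qed
  then have "grad_dot (radial_deriv f) (radial_deriv f) x
      \<le> (\<Sum>i\<in>Basis. 2 * (\<partial> i f x * \<partial> i f x) + 2 * ((x \<bullet> x) * grad_dot (\<partial> i f) (\<partial> i f) x))"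
    unfolding grad_dot_def[of "radial_deriv f"] by (rule sum_mono)
  also have "\<dots> = 2 * grad_dot f f x + 2 * ((x \<bullet> x) * (\<Sum>i\<in>Basis. grad_dot (\<partial> i f) (\<partial> i f) x))"
    by (simp add: sum.distrib sum_distrib_left grad_dot_def[of f])
  also have "(\<Sum>i\<in>Basis. grad_dot (\<partial> i f) (\<partial> i f) x) = hess_sq f x"
    unfolding hess_sq_def grad_dot_def power2_eq_square by (rule sum.swap)
  finally show ?thesis .
qed

lemma
  fixes u :: "'a::euclidean_space \<Rightarrow> real"
  assumes u: "C_class (Suc 0) u" and pos: "\<And>x. 0 < u x"
  shows C_class_powr: "C_class (Suc 0) (\<lambda>x. u x powr q)"
    and partial_deriv_powr: "\<partial> i (\<lambda>x. u x powr q) = (\<lambda>x. q * u x powr (q - 1) * \<partial> i u x)"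
proof -
  have *: "((\<lambda>x. u x powr q) has_derivative (\<lambda>h. q * u x powr (q - 1) * frechet_derivative u (at x) h)) (at x)" for x
    by (rule has_derivative_compose[where g = "\<lambda>t. t powr q" and f = u, OF
          has_derivative_works[OF C_class_differentiable[OF u]]
          has_real_derivative_powr[OF pos, unfolded has_field_derivative_def]])
  have d: "\<partial> i (\<lambda>x. u x powr q) = (\<lambda>x. q * u x powr (q - 1) * \<partial> i u x)" for i
    by (rule ext, rule partial_deriv_eq[OF *, THEN trans]) (simp only: partial_deriv_def)
  then show "\<partial> i (\<lambda>x. u x powr q) = (\<lambda>x. q * u x powr (q - 1) * \<partial> i u x)" .
  show "C_class (Suc 0) (\<lambda>x. u x powr q)"
  proof (rule C_class_SucI)
    show "(\<lambda>x. u x powr q) differentiable (at x)" for x using differentiableI[OF *] .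
    show "C_class 0 (\<partial> i (\<lambda>x. u x powr q))" if "i \<in> Basis" for i
    proof -
      have "continuous_on UNIV u" by (rule C_class_continuous[OF u])
      then have "continuous_on UNIV (\<lambda>x. u x powr (q - 1))"
        using pos by (intro continuous_on_powr continuous_on_const) (auto simp: less_imp_neq[symmetric])
      then show ?thesis unfolding d C_class.simps(1)
        by (intro continuous_on_mult continuous_on_const continuous_on_partial_deriv[OF u that])
    qed
  qed
qed

text \<open>
  The equation is multiplied by \<open>\<zeta> z\<close> with \<open>z = x \<bullet> \<nabla>u\<close>. On the right-hand side,
  \<open>(p + 1) |x|^a u^p z\<close> is \<open>|x|^a\<close> times the radial derivative of \<open>u^(p+1)\<close>. On the left-hand side two
  integrations by parts and \<open>\<Delta>z = 2 \<Delta>u + x \<bullet> \<nabla>\<Delta>u\<close> produce the radial derivative of \<open>(\<Delta>u)\<^sup>2\<close>. The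
  dilation identity, with weight exponent \<open>a\<close> and 0 respectively, evaluates both.
\<close>

lemma pohozaev_identity:
  fixes u \<zeta> :: "'a::euclidean_space \<Rightarrow> real"
  assumes a: "0 \<le> a" and p: "1 < p" and sol: "positive_solution a p u"
    and \<zeta>: "C_class (Suc (Suc 0)) \<zeta>" and supp: "\<And>x. r < norm x \<Longrightarrow> \<zeta> x = 0"
  shows "(real DIM('a) + a) / (p + 1) * (LINT x|lborel. weight a x * u x powr (p + 1) * \<zeta> x)
      + (LINT x|lborel. weight a x * u x powr (p + 1) * radial_deriv \<zeta> x) / (p + 1)
    = (real DIM('a) - 4) / 2 * (LINT x|lborel. (\<Delta> u x)\<^sup>2 * \<zeta> x)
      + (LINT x|lborel. (\<Delta> u x)\<^sup>2 * radial_deriv \<zeta> x) / 2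
      - (LINT x|lborel. \<Delta> u x * (2 * grad_dot (radial_deriv u) \<zeta> x + radial_deriv u x * \<Delta> \<zeta> x))"
proof -
  have pos: "u x > 0" for x using sol by (simp add: positive_solution_def)
  note uk = positive_solution_C_class[OF sol]
  have u4: "C_class (Suc (Suc (Suc (Suc 0)))) u" using uk by simp
  note u3 = C_class_Suc_D[OF u4]
  note u2 = C_class_Suc_D[OF u3]
  note u1 = C_class_Suc_D[OF u2]
  note v2 = C_class_laplacian[OF u4]
  note v1 = C_class_Suc_D[OF v2]
  note \<zeta>1 = C_class_Suc_D[OF \<zeta>]
  define z where "z = radial_deriv u"
  have z2: "C_class (Suc (Suc 0)) z" unfolding z_def by (rule C_class_radial_deriv[OF u3])
  note z\<zeta> = C_class_mult[OF z2 \<zeta>]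
  have vR: "radial_deriv \<zeta> x = 0" if "r < norm x" for x
    using partial_deriv_vanishes[of r \<zeta>] supp that by (simp add: radial_deriv_def)
  define iP where "iP x = weight a x * u x powr (p + 1) * \<zeta> x" for x
  define iPR where "iPR x = weight a x * u x powr (p + 1) * radial_deriv \<zeta> x" for x
  define iG where "iG x = \<Delta> (\<Delta> u) x * (z x * \<zeta> x)" for x
  define iV where "iV x = (\<Delta> u x)\<^sup>2 * \<zeta> x" for x
  define iVR where "iVR x = (\<Delta> u x)\<^sup>2 * radial_deriv \<zeta> x" for x
  define iE where "iE x = \<Delta> u x * (2 * grad_dot z \<zeta> x + z x * \<Delta> \<zeta> x)" for x
  define iW where "iW x = radial_deriv (\<lambda>x. (\<Delta> u x)\<^sup>2 * \<zeta> x) x" for x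
  note defs = iP_def[abs_def] iPR_def[abs_def] iG_def[abs_def] iV_def[abs_def] iVR_def[abs_def] iE_def[abs_def]
    iW_def[abs_def]
  have v2\<zeta>: "C_class (Suc 0) (\<lambda>x. (\<Delta> u x)\<^sup>2 * \<zeta> x)" by (intro C_class_mult C_class_power v1 \<zeta>1)
  note cont = continuous_on_nonlinearity[OF a sol] C_class_continuous[OF C_class_radial_deriv[OF \<zeta>1]]
    C_class_continuous[OF \<zeta>] C_class_continuous[OF z2] continuous_on_laplacian[OF v2] continuous_on_laplacian[OF u2]
    continuous_on_grad_dot[OF z2 \<zeta>] continuous_on_laplacian[OF \<zeta>] C_class_continuous[OF C_class_radial_deriv[OF v2\<zeta>]]
  have vW: "iW x = 0" if "r < norm x" for x
    unfolding iW_def radial_deriv_def using partial_deriv_vanishes[of r "\<lambda>x. (\<Delta> u x)\<^sup>2 * \<zeta> x"] supp that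
    by (intro sum.neutral) simp
  have int: "integrable lborel iP" "integrable lborel iPR" "integrable lborel iG" "integrable lborel iV"
    "integrable lborel iVR" "integrable lborel iE"
    unfolding defs
    by (rule integrable_vanishing[of _ r], intro continuous_intros cont,
        simp add: supp vR laplacian_vanishes[of r \<zeta>] grad_dot_vanishes[of r \<zeta>])+
  have intW: "integrable lborel iW"
    by (rule integrable_vanishing[of _ r]) (simp_all add: vW, simp add: iW_def[abs_def] cont)
  have nonlinear: "integral\<^sup>L lborel iPR + (p + 1) * integral\<^sup>L lborel iG = - (real DIM('a) + a) * integral\<^sup>L lborel iP"
  proof -
    have F: "C_class (Suc 0) (\<lambda>x. u x powr (p + 1) * \<zeta> x)"
      by (intro C_class_mult C_class_powr u1 pos \<zeta>1)
    have "radial_deriv (\<lambda>x. u x powr (p + 1)) x = (p + 1) * u x powr p * z x" for x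
      by (simp add: radial_deriv_def z_def partial_deriv_powr[OF u1 pos] sum_distrib_left mult_ac)
    then have "weight a x * radial_deriv (\<lambda>x. u x powr (p + 1) * \<zeta> x) x = iPR x + (p + 1) * iG x" for x
      using sol unfolding radial_deriv_mult[OF C_class_powr[OF u1 pos] \<zeta>1]
      by (simp add: iPR_def iG_def positive_solution_def algebra_simps)
    moreover have "(LINT x|lborel. weight a x * radial_deriv (\<lambda>x. u x powr (p + 1) * \<zeta> x) x)
        = - (real DIM('a) + a) * (LINT x|lborel. weight a x * (u x powr (p + 1) * \<zeta> x))"
      unfolding radial_deriv_def by (rule integral_weight_radial_derivative[OF a F, of r]) (simp add: supp)
    ultimately show ?thesis using int by (simp add: iP_def[abs_def] mult.assoc)
  qed
  have dilation: "integral\<^sup>L lborel iW = - real DIM('a) * integral\<^sup>L lborel iV"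
  proof -
    have "(LINT x|lborel. weight 0 x * radial_deriv (\<lambda>x. (\<Delta> u x)\<^sup>2 * \<zeta> x) x)
        = - (real DIM('a) + 0) * (LINT x|lborel. weight 0 x * ((\<Delta> u x)\<^sup>2 * \<zeta> x))"
      unfolding radial_deriv_def by (rule integral_weight_radial_derivative[OF order_refl v2\<zeta>, of r]) (simp add: supp)
    then show ?thesis by (simp add: weight_def iW_def[abs_def] iV_def[abs_def])
  qed
  have green: "integral\<^sup>L lborel iG = integral\<^sup>L lborel iE + 2 * integral\<^sup>L lborel iV
      + (integral\<^sup>L lborel iW - integral\<^sup>L lborel iVR) / 2"
  proof -
    have "\<Delta> u x * \<Delta> (\<lambda>x. z x * \<zeta> x) x = iE x + 2 * iV x + (iW x - iVR x) / 2" for x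
    proof -
      have "iW x = iVR x + 2 * \<Delta> u x * radial_deriv (\<Delta> u) x * \<zeta> x"
        using radial_deriv_mult[OF C_class_power[OF v1] \<zeta>1, of 2] radial_deriv_mult[OF v1 v1]
        by (simp add: iW_def iVR_def power2_eq_square algebra_simps)
      moreover have "\<Delta> (\<lambda>x. z x * \<zeta> x) x = z x * \<Delta> \<zeta> x + 2 * grad_dot z \<zeta> x + \<zeta> x * (2 * \<Delta> u x + radial_deriv (\<Delta> u) x)"
        unfolding laplacian_mult[OF z2 \<zeta>] by (simp add: z_def laplacian_radial_deriv[OF u3])
      ultimately show ?thesis
        by (simp add: iE_def iV_def power2_eq_square algebra_simps)
    qed
    then have "(LINT x|lborel. \<Delta> u x * \<Delta> (\<lambda>x. z x * \<zeta> x) x) = integral\<^sup>L lborel iE + 2 * integral\<^sup>L lborel iV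
      + (integral\<^sup>L lborel iW - integral\<^sup>L lborel iVR) / 2"
      using int intW by simp
    then show ?thesis
      using integral_laplacian_symmetric[OF v2 z\<zeta>, of r] supp by (simp add: iG_def[abs_def])
  qed
  have "(real DIM('a) + a) / (p + 1) * integral\<^sup>L lborel iP + integral\<^sup>L lborel iPR / (p + 1)
      = ((real DIM('a) + a) * integral\<^sup>L lborel iP + integral\<^sup>L lborel iPR) / (p + 1)"
    by (simp only: add_divide_distrib[of _ "integral\<^sup>L lborel iPR"] times_divide_eq_left)
  also have "\<dots> = - integral\<^sup>L lborel iG"
    using nonlinear p by (simp add: divide_eq_eq algebra_simps)
  also have "\<dots> = (real DIM('a) - 4) / 2 * integral\<^sup>L lborel iV + integral\<^sup>L lborel iVR / 2 - integral\<^sup>L lborel iE"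
    unfolding green dilation by (simp add: field_simps)
  finally show ?thesis unfolding defs z_def .
qed

text \<open>
  Every term of \<open>err\<close> below contains a derivative of \<open>\<beta>\<close>, hence lives where \<open>\<sigma> = 1\<close>, and is there
  dominated by the density of \<open>annular_bounds\<close>. In particular \<open>|\<nabla>z|\<^sup>2\<close> for \<open>z = x \<bullet> \<nabla>u\<close> is what requires
  the bound for the Hessian.
\<close>

lemma pohozaev_bound:
  fixes \<beta> :: "'a::euclidean_space \<Rightarrow> real"
  assumes a: "0 \<le> a" and p: "1 < p" and subcritical: "(real DIM('a) - 4) / 2 < (real DIM('a) + a) / (p + 1)"
    and \<beta>: "C_class 4 \<beta>" and \<beta>1: "\<And>x. x \<bullet> x \<le> 3 \<Longrightarrow> \<beta> x = 1" and \<beta>0: "\<And>x. 6 \<le> x \<bullet> x \<Longrightarrow> \<beta> x = 0"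
  shows "\<exists>C. \<forall>u. positive_solution a p u \<longrightarrow> stable_outside 1 a p u \<longrightarrow>
    (LINT x|lborel. weight a x * u x powr (p + 1) * \<beta> x) \<le> C"
proof -
  have \<beta>2: "C_class (Suc (Suc 0)) \<beta>" using \<beta> by (rule C_class_mono) simp
  note \<beta>1' = C_class_Suc_D[OF \<beta>2]
  have out: "7 < x \<bullet> x" if "3 < norm x" for x :: 'a
    using that norm_le_square[of x 3] by (auto simp: not_le)
  obtain g1 :: "'a \<Rightarrow> real" where g1: "C_class (Suc (Suc 0)) g1" "\<And>x. 0 \<le> g1 x" "\<And>x. g1 x \<le> 1"
    "\<And>x. x \<bullet> x \<le> 2 \<Longrightarrow> g1 x = 0" "\<And>x. 3 \<le> x \<bullet> x \<Longrightarrow> g1 x = 1"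
    by (rule exterior_cutoff_exists[of 2 3]) auto
  obtain g2 :: "'a \<Rightarrow> real" where g2: "C_class (Suc (Suc 0)) g2" "\<And>x. 0 \<le> g2 x" "\<And>x. g2 x \<le> 1"
    "\<And>x. x \<bullet> x \<le> 6 \<Longrightarrow> g2 x = 0" "\<And>x. 7 \<le> x \<bullet> x \<Longrightarrow> g2 x = 1"
    by (rule exterior_cutoff_exists[of 6 7]) auto
  define \<sigma> where "\<sigma> x = g1 x * (1 - g2 x)" for x
  have \<sigma>: "C_class (Suc (Suc 0)) \<sigma>"
    unfolding \<sigma>_def by (intro C_class_intros g1 g2)
  have \<sigma>0: "\<sigma> x = 0" if "x \<bullet> x < 2 \<or> 7 < x \<bullet> x" for x
    using that g1(4)[of x] g2(5)[of x] by (auto simp: \<sigma>_def)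
  have \<sigma>1: "\<sigma> x = 1" if "3 \<le> x \<bullet> x" "x \<bullet> x \<le> 6" for x
    using that g1(5)[of x] g2(4)[of x] by (auto simp: \<sigma>_def)
  obtain C where C: "\<And>u. positive_solution a p u \<Longrightarrow> stable_outside 1 a p u \<Longrightarrow>
    (LINT x|lborel. ((u x)\<^sup>2 + (\<Delta> u x)\<^sup>2 + weight a x * u x powr (p + 1) + grad_dot u u x + hess_sq u x) * (\<sigma> x)\<^sup>2) \<le> C"
    using annular_bounds[OF a p \<sigma> \<sigma>0] by blast
  have op: "open {x::'a. x \<bullet> x < 3}" "open {x::'a. 6 < x \<bullet> x}"
    by (intro open_Collect_less continuous_intros)+
  have \<beta>flat: "radial_deriv \<beta> x = 0 \<and> \<Delta> \<beta> x = 0 \<and> grad_dot \<beta> \<beta> x = 0 \<and> (\<forall>f. grad_dot f \<beta> x = 0)"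
    if "x \<bullet> x < 3 \<or> 6 < x \<bullet> x" for x
  proof -
    obtain S c where S: "open S" "x \<in> S" "\<And>y. y \<in> S \<Longrightarrow> \<beta> y = c"
      using \<open>x \<bullet> x < 3 \<or> 6 < x \<bullet> x\<close> op \<beta>1 \<beta>0 
      by (metis (mono_tags, lifting) less_imp_le mem_Collect_eq)
    show ?thesis
      using partial_deriv_locally_constant[OF S] laplacian_locally_constant[OF S] grad_dot_locally_constant[OF S]
      by (simp add: radial_deriv_def)
  qed
  have supp: "\<beta> x = 0" "radial_deriv \<beta> x = 0" "\<Delta> \<beta> x = 0" "grad_dot f \<beta> x = 0" if "3 < norm x" for x f
    using \<beta>flat[of x] \<beta>0[of x] out[OF that] by auto
  obtain B where B: "0 \<le> B" "\<And>x. \<bar>radial_deriv \<beta> x\<bar> \<le> B" "\<And>x. \<bar>\<Delta> \<beta> x\<bar> \<le> B" "\<And>x. grad_dot \<beta> \<beta> x \<le> B"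
  proof -
    have c: "continuous_on UNIV (\<lambda>x. \<bar>radial_deriv \<beta> x\<bar> + \<bar>\<Delta> \<beta> x\<bar> + grad_dot \<beta> \<beta> x)"
      by (intro continuous_intros C_class_continuous[OF C_class_radial_deriv[OF \<beta>1']] continuous_on_laplacian[OF \<beta>2]
          continuous_on_grad_dot[OF \<beta>2 \<beta>2])
    obtain B where B: "0 \<le> B" "\<And>x. \<bar>\<bar>radial_deriv \<beta> x\<bar> + \<bar>\<Delta> \<beta> x\<bar> + grad_dot \<beta> \<beta> x\<bar> \<le> B"
      using bounded_vanishing[OF c, of 3] supp by auto
    have "\<bar>radial_deriv \<beta> x\<bar> \<le> B \<and> \<bar>\<Delta> \<beta> x\<bar> \<le> B \<and> grad_dot \<beta> \<beta> x \<le> B" for x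
      using B(2)[of x] grad_dot_self_nonneg[of \<beta> x] by linarith
    with B(1) that show ?thesis by blast
  qed
  define n where "n = (real DIM('a) - 4) / 2"
  define c where "c = (real DIM('a) + a) / (p + 1) - n"
  have c: "0 < c" using subcritical by (simp add: c_def n_def)
  define k where "k = 1 + B + B\<^sup>2"
  \<comment> \<open>the sum of the constants in \<open>e1\<close> to \<open>e4\<close> below\<close>
  define M where "M = (20 + 3 * \<bar>n\<bar>) * k"
  note ssb = sum_squares_bound[unfolded mult.assoc]
  have k: "1 \<le> k" "B \<le> k" "B\<^sup>2 \<le> k" using B(1) by (simp_all add: k_def)
  have "(LINT x|lborel. weight a x * u x powr (p + 1) * \<beta> x) \<le> M * C / c"
    if sol: "positive_solution a p u" and stab: "stable_outside 1 a p u" for u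
  proof -
    have pos: "u x > 0" for x using sol by (simp add: positive_solution_def)
    have u4: "C_class (Suc (Suc (Suc (Suc 0)))) u" using positive_solution_C_class[OF sol] by simp
    note u3 = C_class_Suc_D[OF u4]
    note u2 = C_class_Suc_D[OF u3]
    note v2 = C_class_laplacian[OF u4]
    define P where "P x = weight a x * u x powr (p + 1)" for x
    define z where "z = radial_deriv u"
    have z2: "C_class (Suc (Suc 0)) z" unfolding z_def by (rule C_class_radial_deriv[OF u3])
    have P0: "0 \<le> P x" for x by (simp add: P_def weight_nonneg)
    have cP: "continuous_on A P" for A unfolding P_def by (rule continuous_on_nonlinearity[OF a sol])
    define S where "S x = (u x)\<^sup>2 + (\<Delta> u x)\<^sup>2 + P x + grad_dot u u x + hess_sq u x" for x
    define i0 where "i0 x = P x * \<beta> x" for x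
    define iV where "iV x = (\<Delta> u x)\<^sup>2 * \<beta> x" for x
    define i1 where "i1 x = P x * radial_deriv \<beta> x" for x
    define i2 where "i2 x = (\<Delta> u x)\<^sup>2 * radial_deriv \<beta> x" for x
    define i3 where "i3 x = \<Delta> u x * (2 * grad_dot z \<beta> x + z x * \<Delta> \<beta> x)" for x
    define i4 where "i4 x = \<Delta> u x * (2 * grad_dot u \<beta> x + u x * \<Delta> \<beta> x)" for x
    note defs = i0_def[abs_def] iV_def[abs_def] i1_def[abs_def] i2_def[abs_def] i3_def[abs_def] i4_def[abs_def]
    note cont = cP C_class_continuous[OF C_class_radial_deriv[OF \<beta>1']] C_class_continuous[OF \<beta>2]
      C_class_continuous[OF z2] C_class_continuous[OF u2] continuous_on_laplacian[OF u2] continuous_on_laplacian[OF \<beta>2]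
      continuous_on_grad_dot[OF z2 \<beta>2] continuous_on_grad_dot[OF u2 \<beta>2] C_class_continuous[OF \<sigma>]
      continuous_on_grad_dot[OF u2 u2] continuous_on_hess_sq[OF u2]
    have int: "integrable lborel i0" "integrable lborel iV" "integrable lborel i1" "integrable lborel i2"
      "integrable lborel i3" "integrable lborel i4"
      unfolding defs by (rule integrable_vanishing[of _ 3], intro continuous_intros cont, simp add: supp)+
    have energy: "integral\<^sup>L lborel i0 = integral\<^sup>L lborel iV + integral\<^sup>L lborel i4"
    proof -
      have "i0 x = \<Delta> (\<Delta> u) x * (u x * \<beta> x)" for x
        using positive_solution_multiplied[OF sol, of x] by (simp add: i0_def P_def mult.assoc[symmetric])
      then have "integral\<^sup>L lborel i0 = (LINT x|lborel. \<Delta> (\<Delta> u) x * (u x * \<beta> x))" by (metis (no_types, lifting) ext)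
      also have "\<dots> = (LINT x|lborel. \<Delta> u x * \<Delta> (\<lambda>x. u x * \<beta> x) x)"
        by (rule integral_laplacian_symmetric[OF v2 C_class_mult[OF u2 \<beta>2], of 3]) (simp add: supp)
      also have "\<dots> = (LINT x|lborel. iV x + i4 x)"
        by (simp only: laplacian_mult[OF u2 \<beta>2] iV_def i4_def) (simp add: power2_eq_square algebra_simps)
      finally show ?thesis using int by simp
    qed
    \<comment> \<open>the coefficient \<open>n\<close> in front of \<open>i4\<close> eliminates \<open>\<integral> (\<Delta>u)\<^sup>2 \<beta>\<close> by the energy identity\<close>
    define err where "err x = - (i1 x / (p + 1)) + i2 x / 2 - i3 x - n * i4 x" for x
    have int_err: "integrable lborel err" unfolding err_def[abs_def] using int by simp
    have "c * integral\<^sup>L lborel i0 = integral\<^sup>L lborel err"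
    proof -
      have "(n + c) * integral\<^sup>L lborel i0 + integral\<^sup>L lborel i1 / (p + 1)
          = n * integral\<^sup>L lborel iV + integral\<^sup>L lborel i2 / 2 - integral\<^sup>L lborel i3"
        using pohozaev_identity[OF a p sol \<beta>2 supp(1)] by (simp add: c_def n_def defs P_def z_def)
      then show ?thesis
        using int energy by (simp add: err_def[abs_def] algebra_simps)
    qed
    also have "\<dots> \<le> (LINT x|lborel. M * (S x * (\<sigma> x)\<^sup>2))"
    proof (rule integral_mono[OF int_err])
      show "integrable lborel (\<lambda>x. M * (S x * (\<sigma> x)\<^sup>2))"
        unfolding S_def by (rule integrable_vanishing[of _ 3]) (intro continuous_intros cont, simp add: \<sigma>0 out)
      have S0: "0 \<le> S x" for x by (simp add: S_def P0 grad_dot_self_nonneg hess_sq_nonneg)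
      have M0: "0 \<le> M" using k by (simp add: M_def)
      show "err x \<le> M * (S x * (\<sigma> x)\<^sup>2)" for x
      proof (cases "x \<bullet> x < 3 \<or> 6 < x \<bullet> x")
        case True
        then have "err x = 0" using \<beta>flat[OF True] by (simp add: err_def i1_def i2_def i3_def i4_def)
        then show ?thesis using S0 M0 by simp
      next
        case False
        then have x6: "x \<bullet> x \<le> 6" and \<sigma>x: "\<sigma> x = 1" using \<sigma>1[of x] by auto
        define kS where "kS = k * S x"
        have parts: "(u x)\<^sup>2 \<le> S x" "(\<Delta> u x)\<^sup>2 \<le> S x" "P x \<le> S x" "grad_dot u u x + hess_sq u x \<le> S x" "grad_dot u u x \<le> S x"
          by (simp_all add: S_def P0 grad_dot_self_nonneg hess_sq_nonneg)
        have le_kS: "s * t \<le> kS" if "s \<le> k" "0 \<le> t" "t \<le> S x" for s t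
          unfolding kS_def using that k by (intro mult_mono) auto
        have v: "(\<Delta> u x)\<^sup>2 \<le> kS" using le_kS[of 1 "(\<Delta> u x)\<^sup>2"] k parts by simp
        have v': "(- \<Delta> u x)\<^sup>2 \<le> kS" using v by simp
        have kS0: "0 \<le> kS" using v by (rule order_trans[OF zero_le_power2])
        have Bg: "B * (grad_dot u u x + hess_sq u x) \<le> kS" "B * grad_dot u u x \<le> kS" "B\<^sup>2 * grad_dot u u x \<le> kS" "B\<^sup>2 * (u x)\<^sup>2 \<le> kS"
          by (rule le_kS; use k parts in \<open>simp add: grad_dot_self_nonneg hess_sq_nonneg\<close>)+
        have \<Delta>sq: "(\<Delta> \<beta> x)\<^sup>2 \<le> B\<^sup>2" using B(3)[of x] B(1) by (simp add: abs_le_square_iff[symmetric])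
        have e1: "- (i1 x / (p + 1)) \<le> kS"
        proof -
          have "- (i1 x / (p + 1)) = - i1 x / (p + 1)" by (rule minus_divide_left)
          also have "\<dots> \<le> \<bar>i1 x\<bar> / (p + 1)" using p by (intro divide_right_mono) auto
          also have "\<dots> \<le> \<bar>i1 x\<bar>" using divide_left_mono[of 1 "p + 1" "\<bar>i1 x\<bar>"] p by simp
          also have "\<dots> = \<bar>radial_deriv \<beta> x\<bar> * P x" using P0 by (simp add: i1_def abs_mult)
          also have "\<dots> \<le> kS" using B(2)[of x] k P0 parts by (intro le_kS) auto
          finally show ?thesis .
        qed
        have e2: "i2 x / 2 \<le> kS"
        proof -
          have "i2 x \<le> \<bar>radial_deriv \<beta> x\<bar> * (\<Delta> u x)\<^sup>2" by (simp add: i2_def mult.commute mult_right_mono)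
          also have "\<dots> \<le> kS" using B(2)[of x] k parts by (intro le_kS) auto
          finally have "i2 x \<le> kS" .
          then show ?thesis using kS0 by simp
        qed
        have e3: "- i3 x \<le> 18 * kS"
        proof -
          have g: "(grad_dot z \<beta> x)\<^sup>2 \<le> 12 * kS"
          proof -
            have "(grad_dot z \<beta> x)\<^sup>2 \<le> grad_dot z z x * grad_dot \<beta> \<beta> x" by (rule grad_dot_squared_le)
            also have "\<dots> \<le> (2 * grad_dot u u x + 2 * (6 * hess_sq u x)) * B"
            proof (rule mult_mono)
              have "(x \<bullet> x) * hess_sq u x \<le> 6 * hess_sq u x" using x6 by (intro mult_right_mono hess_sq_nonneg)
              then show "grad_dot z z x \<le> 2 * grad_dot u u x + 2 * (6 * hess_sq u x)"
                using grad_dot_radial_deriv_self_le[OF u2, of x] unfolding z_def by linarith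
            qed (use B in \<open>auto simp: grad_dot_self_nonneg hess_sq_nonneg\<close>)
            also have "\<dots> \<le> 12 * (B * (grad_dot u u x + hess_sq u x))"
              using mult_nonneg_nonneg[OF B(1) grad_dot_self_nonneg[of u x]] by (simp add: algebra_simps)
            finally show ?thesis using Bg(1) by linarith
          qed
          have zz: "(z x * \<Delta> \<beta> x)\<^sup>2 \<le> 6 * kS"
          proof -
            have "(z x)\<^sup>2 \<le> (x \<bullet> x) * grad_dot u u x" unfolding z_def by (rule radial_deriv_squared_le)
            also have "\<dots> \<le> 6 * grad_dot u u x" using x6 by (intro mult_right_mono grad_dot_self_nonneg)
            finally have "(z x)\<^sup>2 * (\<Delta> \<beta> x)\<^sup>2 \<le> (6 * grad_dot u u x) * B\<^sup>2"
              using \<Delta>sq by (intro mult_mono) (auto simp: grad_dot_self_nonneg)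
            then show ?thesis using Bg(3) by (simp add: power_mult_distrib mult_ac)
          qed
          have "- i3 x = 2 * ((- \<Delta> u x) * grad_dot z \<beta> x) + (- \<Delta> u x) * (z x * \<Delta> \<beta> x)" by (simp add: i3_def algebra_simps)
          then show ?thesis
            using ssb[of "- \<Delta> u x" "grad_dot z \<beta> x"] ssb[of "- \<Delta> u x" "z x * \<Delta> \<beta> x"]
              g zz v' kS0 by linarith
        qed
        have e4: "- (n * i4 x) \<le> 3 * \<bar>n\<bar> * kS"
        proof -
          have "(grad_dot u \<beta> x)\<^sup>2 \<le> grad_dot u u x * grad_dot \<beta> \<beta> x" by (rule grad_dot_squared_le)
          also have "\<dots> \<le> grad_dot u u x * B" by (intro mult_left_mono B grad_dot_self_nonneg)
          finally have g: "(grad_dot u \<beta> x)\<^sup>2 \<le> kS" using Bg(2) by (simp add: mult.commute)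
          have "(u x)\<^sup>2 * (\<Delta> \<beta> x)\<^sup>2 \<le> (u x)\<^sup>2 * B\<^sup>2" using \<Delta>sq by (intro mult_left_mono) auto
          then have uu: "(u x * \<Delta> \<beta> x)\<^sup>2 \<le> kS" using Bg(4) by (simp add: power_mult_distrib mult.commute)
          have "\<bar>i4 x\<bar> \<le> 3 * kS"
          proof (rule abs_leI)
            have "i4 x = 2 * (\<Delta> u x * grad_dot u \<beta> x) + \<Delta> u x * (u x * \<Delta> \<beta> x)" by (simp add: i4_def algebra_simps)
            then show "i4 x \<le> 3 * kS"
              using ssb[of "\<Delta> u x" "grad_dot u \<beta> x"] ssb[of "\<Delta> u x" "u x * \<Delta> \<beta> x"]
                g uu v by linarith
            have "- i4 x = 2 * ((- \<Delta> u x) * grad_dot u \<beta> x) + (- \<Delta> u x) * (u x * \<Delta> \<beta> x)" by (simp add: i4_def algebra_simps)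
            then show "- i4 x \<le> 3 * kS"
              using ssb[of "- \<Delta> u x" "grad_dot u \<beta> x"] ssb[of "- \<Delta> u x" "u x * \<Delta> \<beta> x"]
                g uu v' by linarith
          qed
          then have "\<bar>n\<bar> * \<bar>i4 x\<bar> \<le> \<bar>n\<bar> * (3 * kS)" by (rule mult_left_mono) simp
          moreover have "- (n * i4 x) \<le> \<bar>n\<bar> * \<bar>i4 x\<bar>" by (simp add: abs_mult[symmetric])
          ultimately show ?thesis by simp
        qed
        have "err x \<le> (20 + 3 * \<bar>n\<bar>) * kS"
          using e1 e2 e3 e4 by (simp add: err_def algebra_simps)
        then show ?thesis using \<sigma>x by (simp add: M_def kS_def mult.assoc)
      qed
    qed
    also have "\<dots> = M * (LINT x|lborel. S x * (\<sigma> x)\<^sup>2)" by simp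
    also have "\<dots> \<le> M * C"
      using C[OF sol stab] k by (intro mult_left_mono) (auto simp: S_def P_def M_def)
    finally show ?thesis using c by (simp add: i0_def[abs_def] P_def pos_le_divide_eq mult.commute)
  qed
  then show ?thesis by blast
qed

section \<open>Finite Morse index implies stability outside a ball\<close>

lemma C4_compact_supportD:
  assumes "\<phi> \<in> C4_compact_support"
  shows "C_class 4 \<phi>" "\<exists>r. \<forall>x. r < norm x \<longrightarrow> \<phi> x = 0"
proof -
  show "C_class 4 \<phi>" using assms by (simp add: C4_compact_support_def)
  have "bounded (closure {x. \<phi> x \<noteq> 0})"
    using assms by (simp add: C4_compact_support_def compact_imp_bounded)
  then have "bounded {x. \<phi> x \<noteq> 0}" by (meson bounded_subset closure_subset)
  then obtain r where "\<And>x. \<phi> x \<noteq> 0 \<Longrightarrow> norm x \<le> r" by (auto simp: bounded_iff)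
  then show "\<exists>r. \<forall>x. r < norm x \<longrightarrow> \<phi> x = 0" by (metis not_le)
qed

lemma subspace_C4_compact_support: "subspace C4_compact_support"
proof (rule subspaceI)
  show "0 \<in> C4_compact_support"
    by (rule C4_compact_supportI[of _ 0]) (simp_all add: zero_fun_def C_class_const)
  fix f g :: "'a \<Rightarrow> real" and c :: real
  assume f: "f \<in> C4_compact_support"
  obtain r where r: "\<And>x. r < norm x \<Longrightarrow> f x = 0" using C4_compact_supportD(2)[OF f] by blast
  show "c *\<^sub>R f \<in> C4_compact_support"
  proof (rule C4_compact_supportI[of _ r])
    show "C_class 4 (c *\<^sub>R f)" using C_class_cmult[OF C4_compact_supportD(1)[OF f]] by (simp add: scaleR_fun_def)
  qed (simp add: scaleR_fun_def r)
  assume g: "g \<in> C4_compact_support"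
  obtain s where s: "\<And>x. s < norm x \<Longrightarrow> g x = 0" using C4_compact_supportD(2)[OF g] by blast
  show "f + g \<in> C4_compact_support"
  proof (rule C4_compact_supportI[of _ "max r s"])
    show "C_class 4 (f + g)"
      using C_class_add[OF C4_compact_supportD(1)[OF f] C4_compact_supportD(1)[OF g]] by (simp add: plus_fun_def)
  qed (simp add: r s)
qed

lemma laplacian_add_cmult:
  assumes f: "C_class (Suc (Suc k)) f" and g: "C_class (Suc (Suc k)) g"
  shows "\<Delta> (\<lambda>x. f x + c * g x) x = \<Delta> f x + c * \<Delta> g x"
proof -
  have "\<partial> i (\<partial> i (\<lambda>x. f x + c * g x)) x = \<partial> i (\<partial> i f) x + c * \<partial> i (\<partial> i g) x" if i: "i \<in> Basis" for i
    unfolding partial_deriv_add[OF f C_class_cmult[OF g]] partial_deriv_cmult[OF g]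
      partial_deriv_add[OF C_class_partial_deriv[OF f i] C_class_cmult[OF C_class_partial_deriv[OF g i]]]
      partial_deriv_cmult[OF C_class_partial_deriv[OF g i]] ..
  then show ?thesis by (simp add: laplacian_def sum.distrib sum_distrib_left)
qed

lemma laplacian_cmult: "C_class (Suc (Suc k)) f \<Longrightarrow> \<Delta> (\<lambda>x. c * f x) = (\<lambda>x. c * \<Delta> f x)"
  using laplacian_add_cmult[OF C_class_const[of _ 0], of k f c] 
  by (simp add: fun_eq_iff laplacian_def partial_deriv_const)

text \<open>
  The gap between the two supports keeps every point in an open set on which one of the functions
  vanishes, so that the Laplacians have disjoint supports as well and no mixed term survives.
\<close>

lemma I_uu_add_disjoint:
  fixes u :: "'a::euclidean_space \<Rightarrow> real"
  assumes a: "0 \<le> a" and sol: "positive_solution a p u"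
    and f: "f \<in> C4_compact_support" "\<And>x. r < norm x \<Longrightarrow> f x = 0"
    and \<phi>: "\<phi> \<in> C4_compact_support" "\<And>x. norm x \<le> r + 1 \<Longrightarrow> \<phi> x = 0"
  shows "I_uu a p u (f + c *\<^sub>R \<phi>) = I_uu a p u f + c\<^sup>2 * I_uu a p u \<phi>"
proof -
  have f2: "C_class (Suc (Suc 0)) f" and \<phi>2: "C_class (Suc (Suc 0)) \<phi>"
    using C4_compact_supportD(1)[OF f(1)] C4_compact_supportD(1)[OF \<phi>(1)] by (auto elim!: C_class_mono)
  obtain s where s: "\<And>x. s < norm x \<Longrightarrow> \<phi> x = 0" using C4_compact_supportD(2)[OF \<phi>(1)] by blast
  have int: "integrable lborel (\<lambda>x. \<bar>\<Delta> g x\<bar>\<^sup>2)" "integrable lborel (\<lambda>x. weight a x * u x powr (p - 1) * (g x)\<^sup>2)"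
    if g: "C_class (Suc (Suc 0)) g" "\<And>x. t < norm x \<Longrightarrow> g x = 0" for g t
    by (rule integrable_vanishing[of _ t], 
        intro continuous_intros continuous_on_laplacian[OF g(1)] continuous_on_nonlinearity[OF a sol] C_class_continuous[OF g(1)],
        simp add: g(2) laplacian_vanishes[of t g])+
  have disj: "\<Delta> f x * \<Delta> \<phi> x = 0 \<and> f x * \<phi> x = 0" for x
  proof (cases "r < norm x")
    case True
    then show ?thesis using f(2) laplacian_vanishes[of r f x] by simp
  next
    case False
    have "open {x::'a. norm x < r + 1}" by (intro open_Collect_less continuous_intros)
    from laplacian_locally_constant[OF this, of x \<phi> 0] False \<phi>(2) show ?thesis by simp
  qed
  have 1: "\<bar>\<Delta> (f + c *\<^sub>R \<phi>) x\<bar>\<^sup>2 = \<bar>\<Delta> f x\<bar>\<^sup>2 + c\<^sup>2 * \<bar>\<Delta> \<phi> x\<bar>\<^sup>2" for x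
  proof -
    have "\<Delta> (f + c *\<^sub>R \<phi>) x = \<Delta> f x + c * \<Delta> \<phi> x"
      using laplacian_add_cmult[OF f2 \<phi>2, of c x] by (simp add: plus_fun_def scaleR_fun_def)
    then show ?thesis using disj[of x] by (simp add: power2_eq_square algebra_simps)
  qed
  have 2: "weight a x * u x powr (p - 1) * ((f + c *\<^sub>R \<phi>) x)\<^sup>2
      = weight a x * u x powr (p - 1) * (f x)\<^sup>2 + c\<^sup>2 * (weight a x * u x powr (p - 1) * (\<phi> x)\<^sup>2)" for x
    using disj[of x] by (auto simp: scaleR_fun_def power_mult_distrib)
  have intf: "integrable lborel (\<lambda>x. \<bar>\<Delta> f x\<bar>\<^sup>2)" "integrable lborel (\<lambda>x. weight a x * u x powr (p - 1) * (f x)\<^sup>2)"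
    by (rule int(1)[OF f2 f(2)], assumption) (rule int(2)[OF f2 f(2)])
  have int\<phi>: "integrable lborel (\<lambda>x. \<bar>\<Delta> \<phi> x\<bar>\<^sup>2)" "integrable lborel (\<lambda>x. weight a x * u x powr (p - 1) * (\<phi> x)\<^sup>2)"
    by (rule int(1)[OF \<phi>2 s], assumption) (rule int(2)[OF \<phi>2 s])
  show ?thesis
    unfolding I_uu_def 1 2 using intf int\<phi> by (simp add: right_diff_distrib distrib_left)
qed

text \<open>
  The finitely many basis functions of a maximal negative subspace have a common ball of support. A
  test function \<open>\<phi>\<close> with negative energy outside a larger ball is independent of them, and by
  \<open>I_uu_add_disjoint\<close> it spans together with them a negative subspace of dimension \<open>m + 1\<close>.
\<close>

lemma finite_morse_index_imp_stable_outside: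
  fixes u :: "'a::euclidean_space \<Rightarrow> real"
  assumes a: "0 \<le> a" and sol: "positive_solution a p u" and fin: "finite_morse_index a p u"
  shows "\<exists>r. stable_outside r a p u"
  using fin unfolding finite_morse_index_def
proof
  assume "stable a p u"
  then show ?thesis by (auto simp: stable_def stable_outside_def)
next
  assume "\<exists>m\<ge>1. has_morse_index a p u m"
  then obtain m where "has_morse_index a p u m" by blast
  then obtain X B where X: "negative_subspace a p u X" and B: "finite B" "independent B" "span B = X" "card B = m"
    and max: "\<And>Y. negative_subspace a p u Y \<Longrightarrow> \<exists>k\<le>m. has_finite_dim Y k"
    unfolding has_morse_index_def has_finite_dim_def by blast
  have XC: "X \<subseteq> C4_compact_support" and neg: "\<And>f. f \<in> X \<Longrightarrow> f \<noteq> 0 \<Longrightarrow> I_uu a p u f < 0"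
    using X by (auto simp: negative_subspace_def)
  have BC: "B \<subseteq> C4_compact_support" using span_superset[of B] XC B(3) by blast
  have "\<exists>r. \<forall>f\<in>B. \<forall>x. r < norm x \<longrightarrow> f x = 0"
  proof -
    have "\<forall>f\<in>B. \<exists>r. \<forall>x. r < norm x \<longrightarrow> f x = 0" using BC C4_compact_supportD(2) by blast
    then obtain \<rho> where \<rho>: "\<And>f x. f \<in> B \<Longrightarrow> \<rho> f < norm x \<Longrightarrow> f x = 0" by metis
    have "f x = 0" if "f \<in> B" "Max (insert 0 (\<rho> ` B)) < norm x" for f x
    proof (rule \<rho>[OF that(1)])
      have "\<rho> f \<le> Max (insert 0 (\<rho> ` B))" using that(1) B(1) by (intro Max_ge) auto
      with that(2) show "\<rho> f < norm x" by linarith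
    qed
    then show ?thesis by blast
  qed
  then obtain r where r: "\<And>f x. f \<in> B \<Longrightarrow> r < norm x \<Longrightarrow> f x = 0" by blast
  have "subspace {f :: 'a \<Rightarrow> real. \<forall>x. r < norm x \<longrightarrow> f x = 0}"
    by (auto simp: subspace_def scaleR_fun_def)
  then have Xr: "f x = 0" if "f \<in> X" "r < norm x" for f x
    using that r span_minimal[of B "{f. \<forall>x. r < norm x \<longrightarrow> f x = 0}"] B(3) by blast
  have "0 \<le> I_uu a p u \<phi>" if \<phi>: "\<phi> \<in> C4_compact_support" "\<And>x. norm x \<le> r + 1 \<Longrightarrow> \<phi> x = 0" for \<phi>
  proof (rule ccontr)
    assume "\<not> 0 \<le> I_uu a p u \<phi>"
    then have I\<phi>: "I_uu a p u \<phi> < 0" by simp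
    have "\<phi> \<noteq> 0"
    proof
      assume "\<phi> = 0"
      with I\<phi> show False
        by (simp add: I_uu_def zero_fun_def laplacian_def partial_deriv_const)
    qed
    have \<phi>X: "\<phi> \<notin> span B"
    proof
      assume "\<phi> \<in> span B"
      then have "\<phi> x = 0" for x using Xr[of \<phi> x] \<phi>(2)[of x] B(3) by (cases "r < norm x") auto
      with \<open>\<phi> \<noteq> 0\<close> show False by (simp add: fun_eq_iff)
    qed
    have "negative_subspace a p u (span (insert \<phi> B))"
      unfolding negative_subspace_def
    proof (intro conjI ballI)
      show "subspace (span (insert \<phi> B))" by (rule subspace_span)
      show "span (insert \<phi> B) \<subseteq> C4_compact_support"
        using \<phi>(1) BC by (intro span_minimal subspace_C4_compact_support) auto
      fix g assume g: "g \<in> span (insert \<phi> B) - {0}"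
      then obtain c where c: "g - c *\<^sub>R \<phi> \<in> X" using B(3) by (auto simp: span_insert)
      define f where "f = g - c *\<^sub>R \<phi>"
      have f: "f \<in> X" and gf: "g = f + c *\<^sub>R \<phi>" using c by (auto simp: f_def)
      have I: "I_uu a p u g = I_uu a p u f + c\<^sup>2 * I_uu a p u \<phi>"
        unfolding gf using f XC Xr[OF f] \<phi> by (intro I_uu_add_disjoint[OF a sol]) auto
      show "I_uu a p u g < 0"
      proof (cases "f = 0")
        case True
        then have "c \<noteq> 0" using g gf by auto
        moreover have "I_uu a p u (0::'a \<Rightarrow> real) = 0"
          by (simp add: I_uu_def zero_fun_def laplacian_def partial_deriv_const)
        ultimately show ?thesis using I True I\<phi> by (simp add: mult_pos_neg)
      next
        case False
        then have "I_uu a p u f < 0" by (rule neg[OF f])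
        moreover have "c\<^sup>2 * I_uu a p u \<phi> \<le> 0" using I\<phi> by (simp add: mult_nonneg_nonpos)
        ultimately show ?thesis using I by linarith
      qed
    qed
    then obtain k where "k \<le> m" "has_finite_dim (span (insert \<phi> B)) k" using max by blast
    then obtain B' where B': "finite B'" "span B' = span (insert \<phi> B)" "card B' \<le> m"
      unfolding has_finite_dim_def by blast
    have "independent (insert \<phi> B)" using B(2) \<phi>X by (simp add: independent_insert)
    moreover have "insert \<phi> B \<subseteq> span B'" unfolding B'(2) by (rule span_superset)
    ultimately have "card (insert \<phi> B) \<le> card B'"
      using independent_span_bound[OF B'(1)] by blast
    moreover have "\<phi> \<notin> B" using \<phi>X span_base by blast
    ultimately show False using B(1,4) B'(3) by simp
  qed
  then show ?thesis unfolding stable_outside_def by blast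
qed

lemma stable_outside_mono: "stable_outside r a p u \<Longrightarrow> r \<le> s \<Longrightarrow> stable_outside s a p u"
  by (force simp: stable_outside_def)

section \<open>Rescaling\<close>

text \<open>
  The exponent is forced by the equation: \<open>\<Delta>\<^sup>2\<close> contributes \<open>R^4\<close>, the weight contributes \<open>R^a\<close>, and
  the factor in front has to compensate both under the power \<open>p - 1\<close>.
\<close>

definition rescaled :: "real \<Rightarrow> real \<Rightarrow> real \<Rightarrow> ('a::euclidean_space \<Rightarrow> real) \<Rightarrow> 'a \<Rightarrow> real"
  where "rescaled a p R u x = R powr ((4 + a) / (p - 1)) * u (R *\<^sub>R x)"

lemma rescaling_factor:
  "1 < p \<Longrightarrow> ((R::real) powr ((4 + a) / (p - 1))) powr (p - 1) = R powr (4 + a)"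
  by (simp add: powr_powr)

lemma rescaled_positive_solution:
  assumes p: "1 < p" and R: "0 < R" and sol: "positive_solution a p u"
  shows "positive_solution a p (rescaled a p R u)"
proof -
  define c where "c = R powr ((4 + a) / (p - 1))"
  have c: "c > 0" "c powr (p - 1) = R powr (4 + a)" unfolding c_def using R rescaling_factor[OF p] by auto
  have pos: "u x > 0" for x using sol by (simp add: positive_solution_def)
  have U: "rescaled a p R u = (\<lambda>x. c * u (R *\<^sub>R x))" by (simp add: rescaled_def fun_eq_iff c_def)
  have u4: "C_class (Suc (Suc (Suc (Suc 0)))) u" using positive_solution_C_class[OF sol] by simp
  note v2 = C_class_laplacian[OF u4]
  have lap: "\<Delta> (\<Delta> (rescaled a p R u)) = (\<lambda>x. c * (R\<^sup>2 * (R\<^sup>2 * \<Delta> (\<Delta> u) (R *\<^sub>R x))))"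
    unfolding U laplacian_cmult[OF C_class_dilate[OF u4]] laplacian_dilate[OF u4]
      laplacian_cmult[OF C_class_cmult[OF C_class_dilate[OF v2]]] laplacian_cmult[OF C_class_dilate[OF v2]] laplacian_dilate[OF v2] ..
  have "\<Delta> (\<Delta> (rescaled a p R u)) x = weight a x * rescaled a p R u x powr p" for x
  proof -
    have "c powr p = c powr (p - 1) * c" using c(1) by (subst powr_diff) simp
    moreover have "R powr (4 + a) = R\<^sup>2 * R\<^sup>2 * R powr a"
      using R by (simp add: powr_add powr_numeral flip: power_add)
    ultimately have "rescaled a p R u x powr p = R\<^sup>2 * R\<^sup>2 * R powr a * c * u (R *\<^sub>R x) powr p"
      using c pos[of "R *\<^sub>R x"] by (simp add: U powr_mult)
    moreover have "\<Delta> (\<Delta> u) (R *\<^sub>R x) = R powr a * weight a x * u (R *\<^sub>R x) powr p"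
      using sol R by (simp add: positive_solution_def weight_dilate)
    ultimately show ?thesis by (simp add: lap mult_ac)
  qed
  moreover have "C_class 4 (rescaled a p R u)"
    unfolding U by (intro C_class_cmult C_class_dilate positive_solution_C_class[OF sol]) simp
  moreover have "rescaled a p R u x > 0" for x using c pos by (simp add: U)
  ultimately show ?thesis by (simp add: positive_solution_def)
qed

lemma integral_dilate_inverse:
  fixes f :: "'a::euclidean_space \<Rightarrow> real"
  assumes f: "continuous_on UNIV f" and R: "0 < R"
  shows "(LINT x|lborel. f (R *\<^sub>R x)) = (LINT x|lborel. f x) / R ^ DIM('a)"
  using integral_dilate[OF borel_measurable_continuous_onI[OF f] R] R by simp

text \<open>
  Under the substitution \<open>x = R y\<close> both parts of the quadratic form are multiplied by \<open>R^(4-N)\<close>, so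
  its sign is preserved.
\<close>

lemma rescaled_stable_outside:
  fixes u :: "'a::euclidean_space \<Rightarrow> real"
  assumes a: "0 \<le> a" and p: "1 < p" and R: "0 < R" and sol: "positive_solution a p u" and stab: "stable_outside R a p u"
  shows "stable_outside 1 a p (rescaled a p R u)"
  unfolding stable_outside_def
proof (intro ballI impI)
  fix \<phi> :: "'a \<Rightarrow> real" assume \<phi>: "\<phi> \<in> C4_compact_support" "\<forall>x. norm x \<le> 1 \<longrightarrow> \<phi> x = 0"
  define \<xi> where "\<xi> x = \<phi> ((1 / R) *\<^sub>R x)" for x
  have \<xi>4: "C_class 4 \<xi>" unfolding \<xi>_def by (rule C_class_dilate[OF C4_compact_supportD(1)[OF \<phi>(1)]])
  have \<xi>2: "C_class (Suc (Suc 0)) \<xi>" using \<xi>4 by (rule C_class_mono) simp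
  have \<phi>\<xi>: "\<phi> = (\<lambda>x. \<xi> (R *\<^sub>R x))" using R by (simp add: \<xi>_def fun_eq_iff)
  obtain s where s: "\<And>x. s < norm x \<Longrightarrow> \<phi> x = 0" using C4_compact_supportD(2)[OF \<phi>(1)] by blast
  have "\<xi> \<in> C4_compact_support"
    by (rule C4_compact_supportI[OF \<xi>4, of "R * s"]) (use R in \<open>simp add: \<xi>_def s field_simps\<close>)
  moreover have "\<xi> x = 0" if "norm x \<le> R" for x
    using that R \<phi>(2) by (simp add: \<xi>_def field_simps)
  ultimately have nonneg: "0 \<le> I_uu a p u \<xi>" using stab unfolding stable_outside_def by blast
  have pos: "u x > 0" for x using sol by (simp add: positive_solution_def)
  have R4: "R powr (4 + a) = R ^ 4 * R powr a" using R by (simp add: powr_add powr_numeral)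
  have 1: "(LINT x|lborel. \<bar>\<Delta> \<phi> x\<bar>\<^sup>2) = R ^ 4 / R ^ DIM('a) * (LINT x|lborel. \<bar>\<Delta> \<xi> x\<bar>\<^sup>2)"
  proof -
    have "(LINT x|lborel. \<bar>\<Delta> \<phi> x\<bar>\<^sup>2) = (LINT x|lborel. R ^ 4 * \<bar>\<Delta> \<xi> (R *\<^sub>R x)\<bar>\<^sup>2)"
      unfolding \<phi>\<xi> laplacian_dilate[OF \<xi>2] by (simp add: power_mult_distrib flip: power_mult)
    also have "\<dots> = R ^ 4 * ((LINT x|lborel. \<bar>\<Delta> \<xi> x\<bar>\<^sup>2) / R ^ DIM('a))"
      using integral_dilate_inverse[of "\<lambda>x. \<bar>\<Delta> \<xi> x\<bar>\<^sup>2" R] R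
      by (simp add: continuous_on_laplacian[OF \<xi>2] continuous_intros)
    finally show ?thesis by simp
  qed
  have 2: "(LINT x|lborel. weight a x * rescaled a p R u x powr (p - 1) * (\<phi> x)\<^sup>2)
    = R ^ 4 / R ^ DIM('a) * (LINT x|lborel. weight a x * u x powr (p - 1) * (\<xi> x)\<^sup>2)"
  proof -
    have "weight a x * rescaled a p R u x powr (p - 1) * (\<phi> x)\<^sup>2
      = R ^ 4 * (weight a (R *\<^sub>R x) * u (R *\<^sub>R x) powr (p - 1) * (\<xi> (R *\<^sub>R x))\<^sup>2)" for x
    proof -
      have "rescaled a p R u x powr (p - 1) = R ^ 4 * R powr a * u (R *\<^sub>R x) powr (p - 1)"
        unfolding rescaled_def using R pos[of "R *\<^sub>R x"] by (subst powr_mult) (auto simp: rescaling_factor[OF p] R4)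
      then show ?thesis using R by (simp add: \<phi>\<xi> weight_dilate mult_ac)
    qed
    then have "(LINT x|lborel. weight a x * rescaled a p R u x powr (p - 1) * (\<phi> x)\<^sup>2)
      = R ^ 4 * (LINT x|lborel. weight a (R *\<^sub>R x) * u (R *\<^sub>R x) powr (p - 1) * (\<xi> (R *\<^sub>R x))\<^sup>2)"
      by simp
    also have "\<dots> = R ^ 4 * ((LINT x|lborel. weight a x * u x powr (p - 1) * (\<xi> x)\<^sup>2) / R ^ DIM('a))"
      by (subst integral_dilate_inverse[OF _ R, of "\<lambda>x. weight a x * u x powr (p - 1) * (\<xi> x)\<^sup>2"])
         (intro continuous_intros continuous_on_nonlinearity[OF a sol] C_class_continuous[OF \<xi>2], simp)
    finally show ?thesis by simp
  qed
  have "I_uu a p (rescaled a p R u) \<phi> = R ^ 4 / R ^ DIM('a) * I_uu a p u \<xi>"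
    unfolding I_uu_def 1 2 by (simp add: algebra_simps)
  then show "0 \<le> I_uu a p (rescaled a p R u) \<phi>" using nonneg R by simp
qed

text \<open>
  The exponent on the right is positive precisely in the subcritical range, which drives the final
  contradiction.
\<close>

lemma rescaled_integral:
  fixes u \<beta> :: "'a::euclidean_space \<Rightarrow> real"
  assumes a: "0 \<le> a" and p: "1 < p" and R: "0 < R" and sol: "positive_solution a p u" and \<beta>: "continuous_on UNIV \<beta>"
  shows "(LINT x|lborel. weight a x * rescaled a p R u x powr (p + 1) * \<beta> x)
    = R powr (4 + (8 + 2 * a) / (p - 1) - real DIM('a)) * (LINT x|lborel. weight a x * u x powr (p + 1) * \<beta> ((1 / R) *\<^sub>R x))"
proof -
  define e where "e = 4 + (8 + 2 * a) / (p - 1)"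
  define f where "f x = weight a x * u x powr (p + 1) * \<beta> ((1 / R) *\<^sub>R x)" for x
  have pos: "u x > 0" for x using sol by (simp add: positive_solution_def)
  have cf: "continuous_on UNIV f" unfolding f_def
    by (intro continuous_intros continuous_on_nonlinearity[OF a sol] continuous_on_compose2[OF \<beta>]) auto
  have exponent: "(4 + a) / (p - 1) * (p + 1) = e + a"
    using p by (simp add: e_def field_simps)
  have R_exponent: "(R powr ((4 + a) / (p - 1))) powr (p + 1) = R powr e * R powr a"
    unfolding powr_powr exponent by (rule powr_add)
  have "weight a x * rescaled a p R u x powr (p + 1) * \<beta> x = R powr e * f (R *\<^sub>R x)" for x
  proof -
    have "rescaled a p R u x powr (p + 1) = R powr e * R powr a * u (R *\<^sub>R x) powr (p + 1)"
      unfolding rescaled_def using R pos[of "R *\<^sub>R x"]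
      by (subst powr_mult) (auto simp: R_exponent)
    then show ?thesis using R by (simp add: f_def weight_dilate mult_ac)
  qed
  then have "(LINT x|lborel. weight a x * rescaled a p R u x powr (p + 1) * \<beta> x) = R powr e * (LINT x|lborel. f (R *\<^sub>R x))"
    by simp
  also have "\<dots> = R powr e * ((LINT x|lborel. f x) / R ^ DIM('a))"
    unfolding integral_dilate_inverse[OF cf R] ..
  also have "\<dots> = R powr (e - real DIM('a)) * (LINT x|lborel. f x)"
    using R by (simp add: powr_diff powr_realpow)
  finally show ?thesis by (simp add: e_def f_def)
qed

section \<open>The Liouville theorem\<close>

lemma integral_pos_of_continuous:
  fixes f :: "'a::euclidean_space \<Rightarrow> real"
  assumes f: "continuous_on UNIV f" "\<And>x. 0 \<le> f x" "integrable lborel f" and x0: "0 < f x\<^sub>0"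
  shows "0 < (LINT x|lborel. f x)"
proof -
  have "isCont f x\<^sub>0" using f(1) by (simp add: continuous_on_eq_continuous_at)
  then obtain d where d: "d > 0" "\<And>x. dist x x\<^sub>0 < d \<Longrightarrow> dist (f x) (f x\<^sub>0) < f x\<^sub>0 / 2"
    unfolding continuous_at_eps_delta dist_norm using x0 by (metis half_gt_zero)
  have ball: "integrable lborel (\<lambda>x. f x\<^sub>0 / 2 * indicator (ball x\<^sub>0 d) x)"
    using emeasure_lborel_ball_finite[of x\<^sub>0 d] by (intro integrable_mult_right integrable_real_indicator) auto
  have "0 < f x\<^sub>0 / 2 * measure lborel (ball x\<^sub>0 d)"
    using x0 d(1) content_ball_pos[of d x\<^sub>0] by simp
  also have "\<dots> = (LINT x|lborel. f x\<^sub>0 / 2 * indicator (ball x\<^sub>0 d) x)" by simp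
  also have "\<dots> \<le> (LINT x|lborel. f x)"
  proof (rule integral_mono[OF ball f(3)])
    show "f x\<^sub>0 / 2 * indicator (ball x\<^sub>0 d) x \<le> f x" for x
    proof (cases "x \<in> ball x\<^sub>0 d")
      case True
      then have "dist x x\<^sub>0 < d" by (simp add: dist_commute)
      from d(2)[OF this] have "\<bar>f x - f x\<^sub>0\<bar> < f x\<^sub>0 / 2" by (simp only: dist_real_def)
      with True show ?thesis by (simp add: abs_if split: if_splits)
    qed (simp add: f(2))
  qed
  finally show ?thesis .
qed

text \<open>
  The uniform bound for the rescaled solutions, read in the original variables, says that
  \<open>R^s \<integral> |x|^a u^(p+1) \<beta>\<close> stays bounded as \<open>R \<rightarrow> \<infinity>\<close> with \<open>s > 0\<close>.
\<close>

theorem subcritical_no_finite_morse_index_solution: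
  fixes u :: "'a::euclidean_space \<Rightarrow> real"
  assumes a: "0 \<le> a" and p: "1 < p" and subcritical: "(real DIM('a) - 4) * (p - 1) < 8 + 2 * a"
    and sol: "positive_solution a p u"
  shows "\<not> finite_morse_index a p u"
proof
  assume fin: "finite_morse_index a p u"
  define s where "s = 4 + (8 + 2 * a) / (p - 1) - real DIM('a)"
  have s: "0 < s" using subcritical p by (simp add: s_def field_simps)
  have "(real DIM('a) - 4) * (p + 1) < 2 * (real DIM('a) + a)"
    using subcritical by (simp add: algebra_simps)
  then have pohozaev_sign: "(real DIM('a) - 4) / 2 < (real DIM('a) + a) / (p + 1)"
    using p by (simp add: field_simps)
  obtain g :: "'a \<Rightarrow> real" where g: "C_class 4 g" "\<And>x. 0 \<le> g x" "\<And>x. g x \<le> 1"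
    "\<And>x. x \<bullet> x \<le> 3 \<Longrightarrow> g x = 0" "\<And>x. 6 \<le> x \<bullet> x \<Longrightarrow> g x = 1"
    by (rule exterior_cutoff_exists[of 3 6 4]) auto
  define \<beta> where "\<beta> x = 1 - g x" for x
  have \<beta>: "C_class 4 \<beta>" "\<And>x. 0 \<le> \<beta> x" "\<And>x. \<beta> x \<le> 1"
    "\<And>x. x \<bullet> x \<le> 3 \<Longrightarrow> \<beta> x = 1" "\<And>x. 6 \<le> x \<bullet> x \<Longrightarrow> \<beta> x = 0"
    using g by (auto simp: \<beta>_def[abs_def] intro!: C_class_intros)
  have c\<beta>: "continuous_on UNIV \<beta>" by (rule C_class_continuous[OF \<beta>(1)])
  have supp: "\<beta> x = 0" if "3 < norm x" for x
    using that norm_le_square[of x 3] by (intro \<beta>(5)) (auto simp: not_le)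
  obtain C where C: "\<And>v. positive_solution a p v \<Longrightarrow> stable_outside 1 a p v \<Longrightarrow>
    (LINT x|lborel. weight a x * v x powr (p + 1) * \<beta> x) \<le> C"
    using pohozaev_bound[OF a p pohozaev_sign \<beta>(1,4,5)] by blast
  obtain r where r: "stable_outside r a p u"
    using finite_morse_index_imp_stable_outside[OF a sol fin] by blast
  define P where "P x = weight a x * u x powr (p + 1)" for x
  have pos: "u x > 0" for x using sol by (simp add: positive_solution_def)
  have P0: "0 \<le> P x" for x by (simp add: P_def weight_nonneg)
  have cP: "continuous_on UNIV P" unfolding P_def by (rule continuous_on_nonlinearity[OF a sol])
  define I where "I = (LINT x|lborel. P x * \<beta> x)"
  have int: "integrable lborel (\<lambda>x. P x * \<beta> x)"
    by (rule integrable_vanishing[of _ 3]) (intro continuous_intros cP c\<beta>, simp add: supp)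
  have I: "0 < I"
  proof -
    obtain e :: 'a where e: "e \<in> Basis" using nonempty_Basis by blast
    then have "0 < P e * \<beta> e"
      using pos[of e] weight_pos[of e a] nonzero_Basis[OF e] \<beta>(4)[of e] by (simp add: P_def)
    moreover have "continuous_on UNIV (\<lambda>x. P x * \<beta> x)" by (intro continuous_intros cP c\<beta>)
    ultimately show ?thesis
      unfolding I_def using int P0 \<beta>(2) by (intro integral_pos_of_continuous[where x\<^sub>0 = e]) auto
  qed
  have bound: "R powr s * I \<le> C" if R: "2 \<le> R" "r \<le> R" for R
  proof -
    have R0: "0 < R" using R by simp
    have "I \<le> (LINT x|lborel. P x * \<beta> ((1 / R) *\<^sub>R x))"
      unfolding I_def
    proof (rule integral_mono[OF int])
      show "integrable lborel (\<lambda>x. P x * \<beta> ((1 / R) *\<^sub>R x))"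
      proof (rule integrable_vanishing[of _ "3 * R"])
        show "continuous_on UNIV (\<lambda>x. P x * \<beta> ((1 / R) *\<^sub>R x))"
          by (intro continuous_intros cP continuous_on_compose2[OF c\<beta>]) auto
        show "P x * \<beta> ((1 / R) *\<^sub>R x) = 0" if "3 * R < norm x" for x
          using that R0 supp[of "(1 / R) *\<^sub>R x"] by (simp add: field_simps)
      qed
      \<comment> \<open>a point of the support of \<open>\<beta>\<close> is moved into the plateau, since \<open>6 / R\<^sup>2 \<le> 3\<close>\<close>
      show "P x * \<beta> x \<le> P x * \<beta> ((1 / R) *\<^sub>R x)" for x
      proof (rule mult_left_mono[OF _ P0])
        show "\<beta> x \<le> \<beta> ((1 / R) *\<^sub>R x)"
        proof (cases "6 \<le> x \<bullet> x")
          case False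
          have "2 * 2 \<le> R * R" using R by (intro mult_mono) auto
          then have "x \<bullet> x \<le> 3 * (R * R)" using False by linarith
          then have "((1 / R) *\<^sub>R x) \<bullet> ((1 / R) *\<^sub>R x) \<le> 3"
            using R0 by (simp add: field_simps)
          then show ?thesis using \<beta>(3,4) by simp
        qed (simp add: \<beta>)
      qed
    qed
    then have "R powr s * I \<le> R powr s * (LINT x|lborel. P x * \<beta> ((1 / R) *\<^sub>R x))"
      by (rule mult_left_mono) simp
    also have "\<dots> = (LINT x|lborel. weight a x * rescaled a p R u x powr (p + 1) * \<beta> x)"
      using rescaled_integral[OF a p R0 sol c\<beta>] by (simp add: s_def P_def)
    also have "\<dots> \<le> C"
      by (rule C[OF rescaled_positive_solution[OF p R0 sol]
            rescaled_stable_outside[OF a p R0 sol stable_outside_mono[OF r R(2)]]])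
    finally show ?thesis .
  qed
  \<comment> \<open>so large that \<open>R powr s * I\<close> exceeds \<open>C\<close>\<close>
  define R where "R = max (max 2 r) ((\<bar>C\<bar> / I + 1) powr (1 / s))"
  have "0 \<le> \<bar>C\<bar> / I" using I by simp
  then have "\<bar>C\<bar> / I + 1 = ((\<bar>C\<bar> / I + 1) powr (1 / s)) powr s"
    using s by (simp add: powr_powr)
  also have "\<dots> \<le> R powr s"
    using s by (intro powr_mono2) (auto simp: R_def)
  finally have "(\<bar>C\<bar> / I + 1) * I \<le> R powr s * I"
    using I by (intro mult_right_mono) auto
  also have "\<dots> \<le> C" by (rule bound) (auto simp: R_def)
  also have "(\<bar>C\<bar> / I + 1) * I = \<bar>C\<bar> + I" using I by (simp add: distrib_right)
  finally show False using I by simp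
qed

theorem theorem3:
  fixes a p :: real
  assumes "a \<ge> 0" and "CARD('n::finite) \<ge> 5"
    and "1 < p"
    and "p < (real CARD('n) + 4 + 2 * a) / (real CARD('n) - 4)"
  shows "\<not> (\<exists>u :: real ^ 'n \<Rightarrow> real. positive_solution a p u \<and> finite_morse_index a p u)"
proof -
  have "(real DIM(real ^ 'n) - 4) * (p - 1) < 8 + 2 * a"
    using assms by (simp add: field_simps)
  then show ?thesis
    using subcritical_no_finite_morse_index_solution[OF assms(1,3)] by blast
qed

end
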